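(* Let $G$ be a discrete group and $H \subseteq G$ a subgroup. For any $G$-module $M$ and any $n \geq 1$ there is an isomorphism $$H^n([G:H],M) \cong \ker\left[H^1\big(G,\mathrm{Hom}_{\mathbb{Z}}(I^{\otimes n-1},M)\big) \to H^1\big(H,\mathrm{Hom}_{\mathbb{Z}}(I^{\otimes n-1},M)\big)\right],$$ where the map is the restriction homomorphism. In particular, $$H^1([G:H],M) \cong \ker\left[H^1(G,M) \to H^1(H,M)\right].$$
   Context: $I$ is the kernel of the augmentation $\mathbb{Z}[G/H] \to \mathbb{Z}$, $gH \mapsto 1$; tensor powers are over $\mathbb{Z}$ with the diagonal $G$-action, and $I^{\otimes 0} = \mathbb{Z}$. $G$ acts on $\mathrm{Hom}_{\mathbb{Z}}(I^{\otimes n-1},M)$ by $(gf)(x) = g f(g^{-1}x)$. Adamson cohomology: An exact sequence of $G$-modules $\cdots \to M_{i+1} \xrightarrow{f_{i+1}} M_i \xrightarrow{f_i} M_{i-1} \to \cdots$ is $(G,H)$-exact if $\ker f_i$ is a direct summand of $M_i$ as an $H$-module for each $i$. A $G$-module $P$ is $(G,H)$-projective if for every $(G,H)$-exact sequence $M \xrightarrow{f} N \to 0$ and every $G$-homomorphism $g \colon P \to N$ there is a $G$-homomorphism $h \colon P \to M$ with $f \circ h = g$. A $(G,H)$-projective resolution of a $G$-module $L$ is a $(G,H)$-exact sequence $\cdots \to P_1 \to P_0 \to L \to 0$ with every $P_i$ being $(G,H)$-projective. The Adamson cohomology of $G$ with respect to $H$ with coefficients in $M$ is $H^n([G:H],M)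 = H^n(\mathrm{Hom}_G(P_*,M))$, where $P_*$ is a $(G,H)$-projective resolution of the trivial $G$-module $\mathbb{Z}$. *)

theory Defs
  imports "HOL-Algebra.Algebra" "HOL-Algebra.Left_Coset"
begin

text \<open>
  Abelian groups, also those underlying modules, are written multiplicatively, as in the theory of
  free Abelian groups of \<^verbatim>\<open>HOL-Algebra\<close>.  Only the values of the action at elements of the two
  carriers are meaningful.  A \<open>G\<close>-module is an \<open>H\<close>-module for every subgroup \<open>H\<close>, viewed as
  the group \<open>G\<lparr>carrier := H\<rparr>\<close>.
\<close>

section \<open>Modules over a group\<close>

record ('g, 'a) gmod = "'a monoid" +
  act :: "'g \<Rightarrow> 'a \<Rightarrow> 'a"

definition with_act :: "('a, 'b) monoid_scheme \<Rightarrow> ('g \<Rightarrow> 'a \<Rightarrow> 'a) \<Rightarrow> ('g, 'a) gmod" where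
  "with_act A \<phi> = \<lparr>carrier = carrier A, monoid.mult = monoid.mult A, one = one A, act = \<phi>\<rparr>"

definition gmodule :: "('g, 'b) monoid_scheme \<Rightarrow> ('g, 'a) gmod \<Rightarrow> bool" where
  "gmodule G M \<longleftrightarrow> comm_group M
     \<and> (\<forall>g\<in>carrier G. act M g \<in> hom M M)
     \<and> (\<forall>x\<in>carrier M. act M \<one>\<^bsub>G\<^esub> x = x)
     \<and> (\<forall>g\<in>carrier G. \<forall>h\<in>carrier G. \<forall>x\<in>carrier M. act M (g \<otimes>\<^bsub>G\<^esub> h) x = act M g (act M h x))"

definition gsubmodule :: "('g, 'b) monoid_scheme \<Rightarrow> ('g, 'a) gmod \<Rightarrow> 'a set \<Rightarrow> bool" where
  "gsubmodule G M K \<longleftrightarrow> subgroup K M \<and> (\<forall>g\<in>carrier G. \<forall>x\<in>K. act M g x \<in> K)"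

definition direct_summand :: "('g, 'b) monoid_scheme \<Rightarrow> ('g, 'a) gmod \<Rightarrow> 'a set \<Rightarrow> bool" where
  "direct_summand G M K \<longleftrightarrow> gsubmodule G M K
     \<and> (\<exists>L. gsubmodule G M L \<and> K \<inter> L = {\<one>\<^bsub>M\<^esub>} \<and> K <#>\<^bsub>M\<^esub> L = carrier M)"

definition ghom :: "('g, 'b) monoid_scheme \<Rightarrow> ('g, 'a) gmod \<Rightarrow> ('g, 'c) gmod \<Rightarrow> ('a \<Rightarrow> 'c) set" where
  "ghom G A B = {f \<in> hom A B. \<forall>g\<in>carrier G. \<forall>x\<in>carrier A. f (act A g x) = act B g (f x)}"

text \<open>Hom groups are groups of functions that are \<^const>\<open>undefined\<close> outside the source.\<close>

definition ghom_group ::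
    "('g, 'b) monoid_scheme \<Rightarrow> ('g, 'a) gmod \<Rightarrow> ('g, 'c) gmod \<Rightarrow> ('a \<Rightarrow> 'c) monoid" where
  "ghom_group G A B =
     (product_group (carrier A) (\<lambda>_. B))\<lparr>carrier := ghom G A B \<inter> extensional (carrier A)\<rparr>"

definition hom_module ::
    "('g, 'b) monoid_scheme \<Rightarrow> ('g, 'a) gmod \<Rightarrow> ('g, 'c) gmod \<Rightarrow> ('g, 'a \<Rightarrow> 'c) gmod" where
  "hom_module G A B = with_act
     ((product_group (carrier A) (\<lambda>_. B))\<lparr>carrier := hom A B \<inter> extensional (carrier A)\<rparr>)
     (\<lambda>g f. \<lambda>x\<in>carrier A. act B g (f (act A (inv\<^bsub>G\<^esub> g) x)))"

definition trivial_int_module :: "('g, int) gmod" where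
  "trivial_int_module = with_act integer_group (\<lambda>_ x. x)"


section \<open>Cohomology of cochain complexes\<close>

definition coboundaries ::
    "(nat \<Rightarrow> ('a, 'b) monoid_scheme) \<Rightarrow> (nat \<Rightarrow> 'a \<Rightarrow> 'a) \<Rightarrow> nat \<Rightarrow> 'a set" where
  "coboundaries C \<delta> n = (case n of 0 \<Rightarrow> {\<one>\<^bsub>C 0\<^esub>} | Suc m \<Rightarrow> \<delta> m ` carrier (C m))"

definition cohomology ::
    "(nat \<Rightarrow> ('a, 'b) monoid_scheme) \<Rightarrow> (nat \<Rightarrow> 'a \<Rightarrow> 'a) \<Rightarrow> nat \<Rightarrow> 'a set monoid" where
  "cohomology C \<delta> n =
     (C n)\<lparr>carrier := kernel (C n) (C (Suc n)) (\<delta> n)\<rparr> Mod coboundaries C \<delta> n"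


section \<open>Group cohomology\<close>

text \<open>The complex of inhomogeneous cochains: functions of \<open>n\<close> group elements.\<close>

definition tuples :: "'g set \<Rightarrow> nat \<Rightarrow> 'g list set" where
  "tuples S n = {xs. length xs = n \<and> set xs \<subseteq> S}"

definition cochains ::
    "('g, 'b) monoid_scheme \<Rightarrow> ('g, 'a) gmod \<Rightarrow> nat \<Rightarrow> ('g list \<Rightarrow> 'a) monoid" where
  "cochains G A n = product_group (tuples (carrier G) n) (\<lambda>_. A)"

text \<open>
  In additive notation,
  \<open>(\<delta> f)(g\<^sub>0, \<dots>, g\<^sub>n) = g\<^sub>0 f(g\<^sub>1, \<dots>, g\<^sub>n)
    + (\<Sum>i<n. (-1)\<^sup>i\<^sup>+\<^sup>1 f(g\<^sub>0, \<dots>, g\<^sub>i g\<^sub>i\<^sub>+\<^sub>1, \<dots>, g\<^sub>n)) + (-1)\<^sup>n\<^sup>+\<^sup>1 f(g\<^sub>0, \<dots>, g\<^sub>n\<^sub>-\<^sub>1)\<close>.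
\<close>

definition cochain_diff ::
    "('g, 'b) monoid_scheme \<Rightarrow> ('g, 'a) gmod \<Rightarrow> nat \<Rightarrow> ('g list \<Rightarrow> 'a) \<Rightarrow> 'g list \<Rightarrow> 'a" where
  "cochain_diff G A n f = (\<lambda>xs\<in>tuples (carrier G) (Suc n).
     act A (hd xs) (f (tl xs))
     \<otimes>\<^bsub>A\<^esub> (\<Otimes>\<^bsub>A\<^esub>i\<in>{..<n}. f (take i xs @ (xs ! i \<otimes>\<^bsub>G\<^esub> xs ! Suc i) # drop (i + 2) xs)
                            [^]\<^bsub>A\<^esub> ((-1) ^ Suc i :: int))
     \<otimes>\<^bsub>A\<^esub> f (butlast xs) [^]\<^bsub>A\<^esub> ((-1) ^ Suc n :: int))"

definition group_cohomology ::
    "('g, 'b) monoid_scheme \<Rightarrow> ('g, 'a) gmod \<Rightarrow> nat \<Rightarrow> ('g list \<Rightarrow> 'a) set monoid" where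
  "group_cohomology G A = cohomology (cochains G A) (cochain_diff G A)"

text \<open>The map of cohomology classes \<open>[f] \<mapsto> [f|\<^sub>H]\<close>; \<^const>\<open>the_elem\<close> extracts the class common to
  all representatives.\<close>

definition restriction_map ::
    "('g, 'b) monoid_scheme \<Rightarrow> 'g set \<Rightarrow> ('g, 'a) gmod \<Rightarrow> nat
      \<Rightarrow> ('g list \<Rightarrow> 'a) set \<Rightarrow> ('g list \<Rightarrow> 'a) set" where
  "restriction_map G H A n \<xi> =
     (let K = G\<lparr>carrier := H\<rparr>
      in the_elem ((\<lambda>f. coboundaries (cochains K A) (cochain_diff K A) n
                            #>\<^bsub>cochains K A n\<^esub> restrict f (tuples H n)) ` \<xi>))"

definition restriction_kernel ::
    "('g, 'b) monoid_scheme \<Rightarrow> 'g set \<Rightarrow> ('g, 'a) gmod \<Rightarrow> nat \<Rightarrow> ('g list \<Rightarrow> 'a) set monoid" where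
  "restriction_kernel G H A n = (group_cohomology G A n)
     \<lparr>carrier := kernel (group_cohomology G A n) (group_cohomology (G\<lparr>carrier := H\<rparr>) A n)
                   (restriction_map G H A n)\<rparr>"


section \<open>The augmentation kernel and its tensor powers\<close>

definition coset_module :: "('g, 'b) monoid_scheme \<Rightarrow> 'g set \<Rightarrow> ('g, 'g set \<Rightarrow>\<^sub>0 int) gmod" where
  "coset_module G H = with_act (free_Abelian_group (lcosets\<^bsub>G\<^esub> H))
     (\<lambda>g. frag_extend (\<lambda>c. frag_of (g <#\<^bsub>G\<^esub> c)))"

definition augmentation :: "('a \<Rightarrow>\<^sub>0 int) \<Rightarrow> int" where
  "augmentation x = (\<Sum>a\<in>Poly_Mapping.keys x. Poly_Mapping.lookup x a)"

definition augmentation_kernel ::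
    "('g, 'b) monoid_scheme \<Rightarrow> 'g set \<Rightarrow> ('g, 'g set \<Rightarrow>\<^sub>0 int) gmod" where
  "augmentation_kernel G H =
     (coset_module G H)\<lparr>carrier := kernel (coset_module G H) integer_group augmentation\<rparr>"

text \<open>
  The \<open>k\<close>-th tensor power over the integers is the free Abelian group on the \<open>k\<close>-tuples of elements,
  modulo the relations making \<open>(x\<^sub>1, \<dots>, x\<^sub>k) \<mapsto> x\<^sub>1 \<otimes> \<dots> \<otimes> x\<^sub>k\<close> additive in each entry.  For \<open>k = 0\<close>
  there is one tuple and no relation, so this is the trivial module of integers.
  The action of a group element on the free group permutes the relations, so it
  maps each coset of the subgroup of relations onto another one.
\<close>

definition multilinear_relations :: "('a, 'b) monoid_scheme \<Rightarrow> nat \<Rightarrow> ('a list \<Rightarrow>\<^sub>0 int) set" where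
  "multilinear_relations A k = generate (free_Abelian_group (tuples (carrier A) k))
     {frag_of (xs[i := x \<otimes>\<^bsub>A\<^esub> y]) - frag_of (xs[i := x]) - frag_of (xs[i := y]) | xs i x y.
        xs \<in> tuples (carrier A) k \<and> i < k \<and> x \<in> carrier A \<and> y \<in> carrier A}"

definition tensor_power :: "('g, 'a) gmod \<Rightarrow> nat \<Rightarrow> ('g, ('a list \<Rightarrow>\<^sub>0 int) set) gmod" where
  "tensor_power A k = with_act
     (free_Abelian_group (tuples (carrier A) k) Mod multilinear_relations A k)
     (\<lambda>g c. frag_extend (\<lambda>xs. frag_of (map (act A g) xs)) ` c)"


section \<open>Adamson cohomology\<close>

text \<open>\<open>M \<longrightarrow> N \<longrightarrow> 0\<close> is a \<open>(G,H)\<close>-exact sequence of \<open>G\<close>-modules.\<close>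

definition rel_epi ::
    "('g, 'b) monoid_scheme \<Rightarrow> 'g set \<Rightarrow> ('g, 'm) gmod \<Rightarrow> ('m \<Rightarrow> 'n) \<Rightarrow> ('g, 'n) gmod \<Rightarrow> bool" where
  "rel_epi G H M f N \<longleftrightarrow> gmodule G M \<and> gmodule G N \<and> f \<in> ghom G M N
     \<and> f ` carrier M = carrier N \<and> direct_summand (G\<lparr>carrier := H\<rparr>) M (kernel M N f)"

text \<open>
  The types of the test modules \<open>M\<close> and \<open>N\<close> have to be fixed here.  They are large enough: by the
  lemma \<open>rel_projective_lift\<close> below, the lifting property for these types implies the one for
  modules over arbitrary types.
\<close>

definition rel_projective :: "('g, 'b) monoid_scheme \<Rightarrow> 'g set \<Rightarrow> ('g, 'p) gmod \<Rightarrow> bool" where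
  "rel_projective G H P \<longleftrightarrow> gmodule G P
     \<and> (\<forall>(M :: ('g, ('g \<times> 'p \<Rightarrow>\<^sub>0 int) set) gmod) (N :: ('g, 'p) gmod) f g.
          rel_epi G H M f N \<and> g \<in> ghom G P N
            \<longrightarrow> (\<exists>h\<in>ghom G P M. \<forall>x\<in>carrier P. f (h x) = g x))"

text \<open>\<open>\<dots> \<longrightarrow> P 1 \<longrightarrow> P 0 \<longrightarrow> L \<longrightarrow> 0\<close>, with \<open>d n\<close> mapping \<open>P (Suc n)\<close> to \<open>P n\<close>.\<close>

definition rel_projective_resolution ::
    "('g, 'b) monoid_scheme \<Rightarrow> 'g set \<Rightarrow> (nat \<Rightarrow> ('g, 'p) gmod) \<Rightarrow> (nat \<Rightarrow> 'p \<Rightarrow> 'p)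
      \<Rightarrow> ('p \<Rightarrow> 'l) \<Rightarrow> ('g, 'l) gmod \<Rightarrow> bool" where
  "rel_projective_resolution G H P d \<epsilon> L \<longleftrightarrow>
     (\<forall>n. rel_projective G H (P n)) \<and> gmodule G L
     \<and> (\<forall>n. d n \<in> ghom G (P (Suc n)) (P n)) \<and> \<epsilon> \<in> ghom G (P 0) L
     \<and> \<epsilon> ` carrier (P 0) = carrier L
     \<and> d 0 ` carrier (P 1) = kernel (P 0) L \<epsilon>
     \<and> (\<forall>n. d (Suc n) ` carrier (P (Suc (Suc n))) = kernel (P (Suc n)) (P n) (d n))
     \<and> direct_summand (G\<lparr>carrier := H\<rparr>) (P 0) (kernel (P 0) L \<epsilon>)
     \<and> (\<forall>n. direct_summand (G\<lparr>carrier := H\<rparr>) (P (Suc n)) (kernel (P (Suc n)) (P n) (d n)))"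

text \<open>\<open>H\<^sup>n(Hom\<^sub>G(P, M))\<close>, which for a \<open>(G,H)\<close>-projective resolution \<open>P\<close> of the trivial module of
  integers is \<open>H\<^sup>n([G:H], M)\<close>.\<close>

definition adamson_cohomology ::
    "('g, 'b) monoid_scheme \<Rightarrow> (nat \<Rightarrow> ('g, 'p) gmod) \<Rightarrow> (nat \<Rightarrow> 'p \<Rightarrow> 'p) \<Rightarrow> ('g, 'm) gmod
      \<Rightarrow> nat \<Rightarrow> ('p \<Rightarrow> 'm) set monoid" where
  "adamson_cohomology G P d M =
     cohomology (\<lambda>n. ghom_group G (P n) M) (\<lambda>n f. compose (carrier (P (Suc n))) f (d n))"

subsection \<open>Independence of the types of the test modules\<close>

lemma gmoduleD:
  assumes "gmodule G M"
  shows "comm_group M" "group M"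
    "\<And>g. g \<in> carrier G \<Longrightarrow> act M g \<in> hom M M"
    "\<And>g x. g \<in> carrier G \<Longrightarrow> x \<in> carrier M \<Longrightarrow> act M g x \<in> carrier M"
    "\<And>g x y. g \<in> carrier G \<Longrightarrow> x \<in> carrier M \<Longrightarrow> y \<in> carrier M
       \<Longrightarrow> act M g (x \<otimes>\<^bsub>M\<^esub> y) = act M g x \<otimes>\<^bsub>M\<^esub> act M g y"
    "\<And>x. x \<in> carrier M \<Longrightarrow> act M \<one>\<^bsub>G\<^esub> x = x"
    "\<And>g h x. g \<in> carrier G \<Longrightarrow> h \<in> carrier G \<Longrightarrow> x \<in> carrier M
       \<Longrightarrow> act M (g \<otimes>\<^bsub>G\<^esub> h) x = act M g (act M h x)"
  using assms by (auto simp: gmodule_def comm_group.axioms(2) hom_def Pi_iff)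

lemma gmodule_subgroup:
  assumes "gmodule G M" "subgroup H G"
  shows "gmodule (G\<lparr>carrier := H\<rparr>) M"
  using assms subgroup.subset[OF assms(2)] unfolding gmodule_def by (auto simp: subset_iff)

lemma section_of_direct_summand:
  fixes M :: "('g, 'm) gmod" and N :: "('g, 'n) gmod"
  assumes M: "gmodule G M" and N: "gmodule G N" and f: "f \<in> ghom G M N"
    and surj: "f ` carrier M = carrier N" and ds: "direct_summand G M (kernel M N f)"
  obtains t where "t \<in> ghom G N M" "\<And>x. x \<in> carrier N \<Longrightarrow> f (t x) = x"
proof -
  interpret M: comm_group M using gmoduleD[OF M] by simp
  interpret N: comm_group N using gmoduleD[OF N] by simp
  interpret f: group_hom M N f
    using f by unfold_locales (auto simp: ghom_def)
  obtain L where L: "gsubmodule G M L" "kernel M N f \<inter> L = {\<one>\<^bsub>M\<^esub>}"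
      "kernel M N f <#>\<^bsub>M\<^esub> L = carrier M"
    using ds by (auto simp: direct_summand_def)
  have sL: "subgroup L M" and actL: "\<And>g x. g \<in> carrier G \<Longrightarrow> x \<in> L \<Longrightarrow> act M g x \<in> L"
    using L(1) by (auto simp: gsubmodule_def)
  have LM: "x \<in> carrier M" if "x \<in> L" for x
    using subgroup.subset[OF sL] that by blast
  have ex: "\<exists>l\<in>L. f l = x" if x: "x \<in> carrier N" for x
  proof -
    obtain m where m: "m \<in> carrier M" "f m = x" using x unfolding surj[symmetric] by blast
    have "m \<in> kernel M N f <#>\<^bsub>M\<^esub> L" unfolding L(3) by (rule m(1))
    then obtain k l where kl: "k \<in> kernel M N f" "l \<in> L" "m = k \<otimes>\<^bsub>M\<^esub> l"
      by (auto simp: set_mult_def)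
    then have "f m = f l" using LM by (simp add: kernel_def)
    then show ?thesis using kl m by auto
  qed
  have uniq: "l = l'" if "l \<in> L" "l' \<in> L" "f l = f l'" for l l'
  proof -
    have "l \<otimes>\<^bsub>M\<^esub> inv\<^bsub>M\<^esub> l' \<in> L"
      using sL that by (simp add: subgroup.m_closed subgroup.m_inv_closed)
    moreover have "l \<otimes>\<^bsub>M\<^esub> inv\<^bsub>M\<^esub> l' \<in> kernel M N f"
      using that LM by (simp add: kernel_def)
    ultimately have "l \<otimes>\<^bsub>M\<^esub> inv\<^bsub>M\<^esub> l' = \<one>\<^bsub>M\<^esub>" using L(2) by blast
    then show ?thesis using that LM by (metis M.inv_closed M.r_cancel M.r_inv)
  qed
  define t where "t x = (SOME l. l \<in> L \<and> f l = x)" for x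
  have t: "t x \<in> L" "f (t x) = x" if "x \<in> carrier N" for x
    using someI_ex[of "\<lambda>l. l \<in> L \<and> f l = x"] ex[OF that] by (auto simp: t_def)
  have "t \<in> ghom G N M"
  proof -
    have "t (x \<otimes>\<^bsub>N\<^esub> y) = t x \<otimes>\<^bsub>M\<^esub> t y" if "x \<in> carrier N" "y \<in> carrier N" for x y
      by (rule uniq) (use that t LM sL in \<open>simp_all add: subgroup.m_closed\<close>)
    moreover have "t (act N g x) = act M g (t x)" if "g \<in> carrier G" "x \<in> carrier N" for g x
      by (rule uniq) (use that t LM actL f in \<open>simp_all add: gmoduleD[OF N] ghom_def\<close>)
    ultimately show ?thesis using t LM by (auto simp: ghom_def hom_def)
  qed
  then show ?thesis using t that by blast
qed

lemma direct_summand_of_section: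
  fixes M :: "('g, 'm) gmod" and N :: "('g, 'n) gmod"
  assumes M: "gmodule G M" and N: "gmodule G N" and f: "f \<in> ghom G M N"
    and t: "t \<in> ghom G N M" "\<And>x. x \<in> carrier N \<Longrightarrow> f (t x) = x"
  shows "direct_summand G M (kernel M N f)"
proof -
  interpret M: comm_group M using gmoduleD[OF M] by simp
  interpret N: comm_group N using gmoduleD[OF N] by simp
  interpret f: group_hom M N f
    using f by unfold_locales (auto simp: ghom_def)
  interpret t: group_hom N M t
    using t by unfold_locales (auto simp: ghom_def)
  have f_act: "f (act M g x) = act N g (f x)" if "g \<in> carrier G" "x \<in> carrier M" for g x
    using f that by (simp add: ghom_def)
  have t_act: "act M g (t x) = t (act N g x)" if "g \<in> carrier G" "x \<in> carrier N" for g x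
    using t(1) that by (simp add: ghom_def)
  have act_one: "act N g \<one>\<^bsub>N\<^esub> = \<one>\<^bsub>N\<^esub>" if "g \<in> carrier G" for g
    using hom_one[OF gmoduleD(3)[OF N that]] by simp
  have 1: "gsubmodule G M (kernel M N f)"
    using f.subgroup_kernel f_act act_one gmoduleD(4)[OF M] by (auto simp: gsubmodule_def kernel_def)
  have 2: "gsubmodule G M (t ` carrier N)"
    using t.img_is_subgroup t_act gmoduleD(4)[OF N] by (auto simp: gsubmodule_def)
  have 3: "kernel M N f \<inter> t ` carrier N = {\<one>\<^bsub>M\<^esub>}"
  proof -
    have "\<one>\<^bsub>M\<^esub> \<in> t ` carrier N" by (metis N.one_closed image_eqI t.hom_one)
    moreover have "y = \<one>\<^bsub>M\<^esub>" if y: "y \<in> kernel M N f" "y \<in> t ` carrier N" for y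
    proof -
      obtain x where x: "x \<in> carrier N" "y = t x" using y by blast
      then have "x = \<one>\<^bsub>N\<^esub>" using y t(2) by (simp add: kernel_def)
      then show ?thesis using x by simp
    qed
    moreover have "\<one>\<^bsub>M\<^esub> \<in> kernel M N f" by (simp add: kernel_def)
    ultimately show ?thesis by blast
  qed
  have set_mult_mem: "k \<otimes>\<^bsub>M\<^esub> l \<in> K <#>\<^bsub>M\<^esub> L" if "k \<in> K" "l \<in> L" for k l K L
    using that by (auto simp: set_mult_def)
  have 4: "x \<in> kernel M N f <#>\<^bsub>M\<^esub> t ` carrier N" if "x \<in> carrier M" for x
  proof -
    have "x \<otimes>\<^bsub>M\<^esub> inv\<^bsub>M\<^esub> (t (f x)) \<in> kernel M N f"
      using that t(2) by (simp add: kernel_def)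
    moreover have "x = (x \<otimes>\<^bsub>M\<^esub> inv\<^bsub>M\<^esub> (t (f x))) \<otimes>\<^bsub>M\<^esub> t (f x)"
      using that by (simp add: M.m_assoc)
    moreover have "t (f x) \<in> t ` carrier N" using that by simp
    ultimately show ?thesis by (metis set_mult_mem)
  qed
  have "kernel M N f <#>\<^bsub>M\<^esub> t ` carrier N = carrier M"
    using 4 by (auto simp: set_mult_def kernel_def)
  then show ?thesis using 1 2 3 unfolding direct_summand_def by blast
qed

lemma ghom_subgroup:
  assumes "f \<in> ghom G A B" "subgroup H G"
  shows "f \<in> ghom (G\<lparr>carrier := H\<rparr>) A B"
  using assms(1) subgroup.subset[OF assms(2)] by (auto simp: ghom_def)

lemma rel_projective_lift:
  fixes G :: "('g, 'b) monoid_scheme" and P :: "('g, 'p) gmod"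
    and M :: "('g, 'm) gmod" and N :: "('g, 'n) gmod"
  assumes G: "group G" and H: "subgroup H G" and proj: "rel_projective G H P"
    and epi: "rel_epi G H M f N" and g: "g \<in> ghom G P N"
  shows "\<exists>h\<in>ghom G P M. \<forall>x\<in>carrier P. f (h x) = g x"
proof -
  let ?H = "G\<lparr>carrier := H\<rparr>"
  interpret G: group G by fact
  have P: "gmodule G P" using proj by (simp add: rel_projective_def)
  have M: "gmodule G M" and N: "gmodule G N" and f: "f \<in> ghom G M N"
    and surj: "f ` carrier M = carrier N" and ds: "direct_summand ?H M (kernel M N f)"
    using epi by (auto simp: rel_epi_def)
  have HG: "x \<in> carrier G" if "x \<in> H" for x using subgroup.subset[OF H] that by blast
  interpret P: comm_group P using gmoduleD[OF P] by simp
  interpret M: comm_group M using gmoduleD[OF M] by simp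
  interpret N: comm_group N using gmoduleD[OF N] by simp
  interpret f: group_hom M N f using f by unfold_locales (auto simp: ghom_def)
  interpret g: group_hom P N g using g by unfold_locales (auto simp: ghom_def)
  obtain t where t: "t \<in> ghom ?H N M" "\<And>x. x \<in> carrier N \<Longrightarrow> f (t x) = x"
    by (rule section_of_direct_summand[OF gmodule_subgroup[OF M H] gmodule_subgroup[OF N H]
          ghom_subgroup[OF f H] surj ds]) blast
  define u where "u p = t (g p)" for p
  have u_closed: "u p \<in> carrier M" if "p \<in> carrier P" for p
    using t(1) that by (auto simp: ghom_def hom_def u_def)
  have u_mult: "u (p \<otimes>\<^bsub>P\<^esub> q) = u p \<otimes>\<^bsub>M\<^esub> u q" if "p \<in> carrier P" "q \<in> carrier P" for p q
    using t(1) that by (auto simp: ghom_def hom_def u_def)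
  have u_act: "u (act P x p) = act M x (u p)" if "x \<in> H" "p \<in> carrier P" for x p
    using t(1) g that HG by (auto simp: ghom_def u_def)
  have fu: "f (u p) = g p" if "p \<in> carrier P" for p
    using t(2) that by (simp add: u_def)
  note closed = gmoduleD(4)[OF M] gmoduleD(4)[OF P]
  note act_mult = gmoduleD(5)[OF M] gmoduleD(5)[OF P]
  note act_act = gmoduleD(7)[OF M] gmoduleD(7)[OF P]
  let ?D = "M \<times>\<times> P"
  interpret D: comm_group ?D
  proof -
    interpret D0: group ?D by (rule DirProd_group) (rule M.is_group P.is_group)+
    show "comm_group ?D"
      by unfold_locales (auto simp: M.m_comm P.m_comm)
  qed
  define a where "a x z = (act M x (fst z), act P x (snd z))" for x z
  let ?X = "carrier G \<times> carrier P"
  define b where "b y = a (fst y) (u (snd y), snd y)" for y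
  let ?F = "free_Abelian_group ?X"
  have b_closed: "b ` ?X \<subseteq> carrier ?D"
    by (auto simp: b_def a_def closed u_closed)
  obtain \<psi> where \<psi>: "\<psi> \<in> hom ?F ?D" and \<psi>_of: "\<And>y. y \<in> ?X \<Longrightarrow> \<psi> (frag_of y) = b y"
    using D.free_Abelian_group_universal[OF b_closed] by blast
  interpret \<psi>: group_hom ?F ?D \<psi>
    using \<psi> by (simp add: group_hom_def group_hom_axioms_def D.is_group)
  define E where "E = generate ?D (b ` ?X)"
  have sE: "subgroup E ?D" unfolding E_def by (rule D.generate_is_subgroup[OF b_closed])
  have E_mult: "z \<otimes>\<^bsub>?D\<^esub> z' \<in> E" if "z \<in> E" "z' \<in> E" for z z'
    using subgroup.m_closed[OF sE] that by blast
  have E_one: "\<one>\<^bsub>?D\<^esub> \<in> E" by (rule subgroup.one_closed[OF sE])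
  have bE: "b y \<in> E" if "y \<in> ?X" for y
    unfolding E_def by (rule generate.incl) (use that in blast)
  have ED: "fst z \<in> carrier M" "snd z \<in> carrier P" if "z \<in> E" for z
    using subgroup.subset[OF sE] that by auto
  have E_img: "E \<subseteq> \<psi> ` carrier ?F"
    unfolding E_def
  proof (rule D.generate_subgroup_incl[OF _ \<psi>.img_is_subgroup], rule image_subsetI)
    fix y assume y: "y \<in> ?X"
    then have "frag_of y \<in> carrier ?F" by simp
    then show "b y \<in> \<psi> ` carrier ?F" using \<psi>_of[OF y] by (metis image_eqI)
  qed
  have a_hom: "a x \<in> hom ?D ?D" if "x \<in> carrier G" for x
    using that by (auto simp: hom_def a_def closed act_mult)
  have a_b: "a x (b (y, p)) = b (x \<otimes>\<^bsub>G\<^esub> y, p)"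
    if "x \<in> carrier G" "y \<in> carrier G" "p \<in> carrier P" for x y p
    using that by (simp add: a_def b_def act_act u_closed)
  have a_E: "a x z \<in> E" if x: "x \<in> carrier G" and z: "z \<in> E" for x z
  proof -
    interpret a: group_hom ?D ?D "a x"
      using a_hom[OF x] by (simp add: group_hom_def group_hom_axioms_def D.is_group)
    have *: "a x y \<in> E" if "y \<in> b ` ?X" for y
      using that x by (auto simp: a_b intro!: bE)
    have "a x ` E = generate ?D (a x ` b ` ?X)"
      unfolding E_def by (rule a.generate_img[OF b_closed, symmetric])
    also have "\<dots> \<subseteq> E"
      by (rule D.generate_subgroup_incl[OF _ sE]) (use * in blast)
    finally show ?thesis using z by blast
  qed
  have fg: "f (fst z) = g (snd z)" if "z \<in> E" for z
  proof -
    let ?S = "{z \<in> carrier ?D. f (fst z) = g (snd z)}"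
    have "subgroup ?S ?D"
      by (rule D.subgroupI) (auto simp: M.is_group P.is_group mult_DirProd'
        intro!: exI[of _ "\<one>\<^bsub>M\<^esub>"] exI[of _ "\<one>\<^bsub>P\<^esub>"])
    moreover have "b ` ?X \<subseteq> ?S"
      using f g by (auto simp: b_def a_def closed u_closed ghom_def fu)
    ultimately have "E \<subseteq> ?S"
      unfolding E_def by (rule D.generate_subgroup_incl[rotated])
    then show ?thesis using that by blast
  qed
  define e where "e z = {c \<in> carrier ?F. \<psi> c = z}" for z
  define e' where "e' = inv_into E e"
  have "inj_on e E"
  proof (rule inj_onI)
    fix z z' assume z: "z \<in> E" "z' \<in> E" "e z = e z'"
    then obtain c where "c \<in> carrier ?F" "\<psi> c = z" using E_img by blast
    then have "c \<in> e z" by (simp add: e_def)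
    then show "z = z'" using z(3) by (auto simp: e_def)
  qed
  then have e'e: "e' (e z) = z" if "z \<in> E" for z
    using that by (simp add: e'_def)
  define Q where "Q = \<lparr>carrier = e ` E, monoid.mult = (\<lambda>x y. e (e' x \<otimes>\<^bsub>?D\<^esub> e' y)),
    one = e \<one>\<^bsub>?D\<^esub>, act = (\<lambda>x y. e (a x (e' y)))\<rparr>"
  have Q_simps: "carrier Q = e ` E" "\<one>\<^bsub>Q\<^esub> = e \<one>\<^bsub>?D\<^esub>"
    "\<And>y z. y \<in> E \<Longrightarrow> z \<in> E \<Longrightarrow> e y \<otimes>\<^bsub>Q\<^esub> e z = e (y \<otimes>\<^bsub>?D\<^esub> z)"
    "\<And>x z. z \<in> E \<Longrightarrow> act Q x (e z) = e (a x z)"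
    by (simp_all add: Q_def e'e)
  have E_carrier: "z \<in> carrier ?D" if "z \<in> E" for z
    using subgroup.subset[OF sE] that by blast
  have Q_mem: "e z \<in> carrier Q" if "z \<in> E" for z
    using that unfolding Q_simps by (rule imageI)
  have Q_cases: thesis if "x \<in> carrier Q" "\<And>z. z \<in> E \<Longrightarrow> x = e z \<Longrightarrow> thesis" for x thesis
    using that unfolding Q_simps by blast
  have Q_comm: "comm_group Q"
  proof (rule comm_groupI)
    show "\<one>\<^bsub>Q\<^esub> \<in> carrier Q" unfolding Q_simps(2) by (rule Q_mem[OF E_one])
  next
    fix x assume "x \<in> carrier Q"
    then obtain z where z: "z \<in> E" "x = e z" by (rule Q_cases)
    have i: "inv\<^bsub>?D\<^esub> z \<in> E" using subgroup.m_inv_closed[OF sE z(1)] .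
    have "e (inv\<^bsub>?D\<^esub> z) \<otimes>\<^bsub>Q\<^esub> x = \<one>\<^bsub>Q\<^esub>"
      unfolding z(2) Q_simps(3)[OF i z(1)] D.l_inv[OF E_carrier[OF z(1)]] Q_simps(2) ..
    then show "\<exists>y\<in>carrier Q. y \<otimes>\<^bsub>Q\<^esub> x = \<one>\<^bsub>Q\<^esub>" using Q_mem[OF i] by blast
    show "\<one>\<^bsub>Q\<^esub> \<otimes>\<^bsub>Q\<^esub> x = x"
      unfolding z(2) Q_simps(2) Q_simps(3)[OF E_one z(1)] D.l_one[OF E_carrier[OF z(1)]] ..
  next
    fix x y assume "x \<in> carrier Q" "y \<in> carrier Q"
    then obtain z z' where z: "z \<in> E" "x = e z" "z' \<in> E" "y = e z'" by (metis Q_cases)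
    show "x \<otimes>\<^bsub>Q\<^esub> y \<in> carrier Q"
      unfolding z(2,4) Q_simps(3)[OF z(1,3)] by (rule Q_mem[OF E_mult[OF z(1,3)]])
    show "x \<otimes>\<^bsub>Q\<^esub> y = y \<otimes>\<^bsub>Q\<^esub> x"
      unfolding z(2,4) Q_simps(3)[OF z(1,3)] Q_simps(3)[OF z(3,1)]
      using D.m_comm[OF z(1,3)[THEN E_carrier]] by (rule arg_cong)
    fix w assume "w \<in> carrier Q"
    then obtain z'' where z'': "z'' \<in> E" "w = e z''" by (rule Q_cases)
    show "x \<otimes>\<^bsub>Q\<^esub> y \<otimes>\<^bsub>Q\<^esub> w = x \<otimes>\<^bsub>Q\<^esub> (y \<otimes>\<^bsub>Q\<^esub> w)"
      unfolding z(2,4) z''(2) Q_simps(3)[OF z(1,3)] Q_simps(3)[OF z(3) z''(1)]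
        Q_simps(3)[OF E_mult[OF z(1,3)] z''(1)] Q_simps(3)[OF z(1) E_mult[OF z(3) z''(1)]]
      using D.m_assoc[OF E_carrier E_carrier E_carrier, OF z(1,3) z''(1)] by (rule arg_cong)
  qed
  have Q_act_hom: "act Q x (y \<otimes>\<^bsub>Q\<^esub> z) = act Q x y \<otimes>\<^bsub>Q\<^esub> act Q x z"
    if x: "x \<in> carrier G" and yz: "y \<in> carrier Q" "z \<in> carrier Q" for x y z
  proof -
    obtain v w where v: "v \<in> E" "y = e v" and w: "w \<in> E" "z = e w" using yz by (metis Q_cases)
    have "a x (v \<otimes>\<^bsub>?D\<^esub> w) = a x v \<otimes>\<^bsub>?D\<^esub> a x w"
      by (rule hom_mult[OF a_hom[OF x]]) (rule E_carrier v w)+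
    then show ?thesis
      by (simp add: v w Q_simps(3,4) E_mult a_E[OF x] del: mult_DirProd)
  qed
  have Q: "gmodule G Q"
    unfolding gmodule_def
  proof (intro conjI ballI)
    fix x assume x: "x \<in> carrier G"
    have "act Q x y \<in> carrier Q" if y: "y \<in> carrier Q" for y
    proof -
      obtain z where z: "z \<in> E" "y = e z" using y by (rule Q_cases)
      show ?thesis unfolding z(2) Q_simps(4)[OF z(1)] by (rule Q_mem[OF a_E[OF x z(1)]])
    qed
    then show "act Q x \<in> hom Q Q"
      using Q_act_hom[OF x] by (auto simp: hom_def)
  next
    fix y assume "y \<in> carrier Q"
    then obtain z where z: "z \<in> E" "y = e z" by (rule Q_cases)
    then show "act Q \<one>\<^bsub>G\<^esub> y = y"
      using ED[OF z(1)] by (simp add: Q_simps(4) a_def gmoduleD(6)[OF M] gmoduleD(6)[OF P])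
  next
    fix x x' y assume x: "x \<in> carrier G" "x' \<in> carrier G" and "y \<in> carrier Q"
    then obtain z where z: "z \<in> E" "y = e z" by (metis Q_cases)
    have "a (x \<otimes>\<^bsub>G\<^esub> x') z = a x (a x' z)"
      using x ED[OF z(1)] by (simp add: a_def act_act)
    then show "act Q (x \<otimes>\<^bsub>G\<^esub> x') y = act Q x (act Q x' y)"
      using x z by (simp add: Q_simps(4) a_E)
  qed (rule Q_comm)
  let ?q = "\<lambda>y. snd (e' y)"
  have q: "?q \<in> ghom G Q P"
    unfolding ghom_def hom_def
  proof (intro CollectI conjI ballI funcsetI)
    fix y assume "y \<in> carrier Q"
    then obtain z where z: "z \<in> E" "y = e z" by (rule Q_cases)
    show "?q y \<in> carrier P" unfolding z(2) e'e[OF z(1)] by (rule ED[OF z(1)])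
    fix w assume "w \<in> carrier Q"
    then obtain z' where z': "z' \<in> E" "w = e z'" by (rule Q_cases)
    show "?q (y \<otimes>\<^bsub>Q\<^esub> w) = ?q y \<otimes>\<^bsub>P\<^esub> ?q w"
      unfolding z(2) z'(2) Q_simps(3)[OF z(1) z'(1)] e'e[OF z(1)] e'e[OF z'(1)]
        e'e[OF E_mult[OF z(1) z'(1)]] by (simp add: mult_DirProd')
  next
    fix x y assume x: "x \<in> carrier G" and "y \<in> carrier Q"
    then obtain z where z: "z \<in> E" "y = e z" by (metis Q_cases)
    show "?q (act Q x y) = act P x (?q y)"
      unfolding z(2) Q_simps(4)[OF z(1)] e'e[OF z(1)] e'e[OF a_E[OF x z(1)]]
      by (simp add: a_def)
  qed
  define s where "s p = e (u p, p)" for p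
  have uE: "(u p, p) \<in> E" if "p \<in> carrier P" for p
    using bE[of "(\<one>\<^bsub>G\<^esub>, p)"] that
    by (simp add: b_def a_def gmoduleD(6)[OF M] gmoduleD(6)[OF P] u_closed)
  have s: "s \<in> ghom ?H P Q"
    unfolding ghom_def hom_def
  proof (intro CollectI conjI ballI funcsetI)
    fix p p' assume p: "p \<in> carrier P" "p' \<in> carrier P"
    show "s (p \<otimes>\<^bsub>P\<^esub> p') = s p \<otimes>\<^bsub>Q\<^esub> s p'"
      unfolding s_def Q_simps(3)[OF uE[OF p(1)] uE[OF p(2)]] using p by (simp add: u_mult)
  next
    fix p assume p: "p \<in> carrier P"
    show "s p \<in> carrier Q" unfolding s_def by (rule Q_mem[OF uE[OF p]])
    fix x assume "x \<in> carrier ?H"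
    then show "s (act P x p) = act Q x (s p)"
      unfolding s_def Q_simps(4)[OF uE[OF p]] using p by (simp add: a_def u_act)
  qed
  have qs: "?q (s p) = p" if "p \<in> carrier P" for p
    using uE[OF that] by (simp add: s_def e'e)
  have "direct_summand ?H Q (kernel Q P ?q)"
    by (rule direct_summand_of_section[OF gmodule_subgroup[OF Q H] gmodule_subgroup[OF P H]
          ghom_subgroup[OF q H] s qs])
  moreover have "?q ` carrier Q = carrier P"
  proof
    show "?q ` carrier Q \<subseteq> carrier P" using q by (auto simp: ghom_def hom_def)
    show "carrier P \<subseteq> ?q ` carrier Q"
    proof
      fix p assume p: "p \<in> carrier P"
      have "s p \<in> carrier Q" using s p by (auto simp: ghom_def hom_def)
      then show "p \<in> ?q ` carrier Q" using qs[OF p] by (metis image_eqI)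
    qed
  qed
  ultimately have "rel_epi G H Q ?q P"
    using Q P q by (simp add: rel_epi_def)
  moreover have "(\<lambda>x. x) \<in> ghom G P P" by (auto simp: ghom_def hom_def)
  ultimately obtain r where r: "r \<in> ghom G P Q" "\<And>x. x \<in> carrier P \<Longrightarrow> ?q (r x) = x"
    using proj unfolding rel_projective_def by blast
  let ?h = "\<lambda>x. fst (e' (r x))"
  have r_closed: "r x \<in> e ` E" if "x \<in> carrier P" for x
    using r(1) that by (auto simp: ghom_def hom_def Q_simps)
  have e'r: "e' (r x) \<in> E" "e (e' (r x)) = r x" if "x \<in> carrier P" for x
    unfolding e'_def using r_closed[OF that] by (rule inv_into_into, rule f_inv_into_f)
  have "?h \<in> ghom G P M"
  proof -
    have "e' (r (x \<otimes>\<^bsub>P\<^esub> y)) = e' (r x) \<otimes>\<^bsub>?D\<^esub> e' (r y)" if "x \<in> carrier P" "y \<in> carrier P" for x y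
    proof -
      have "r (x \<otimes>\<^bsub>P\<^esub> y) = r x \<otimes>\<^bsub>Q\<^esub> r y" using r(1) that by (auto simp: ghom_def hom_def)
      also have "\<dots> = e (e' (r x) \<otimes>\<^bsub>?D\<^esub> e' (r y))" by (simp add: Q_def)
      finally show ?thesis using e'r that by (simp add: e'e E_mult)
    qed
    moreover have "e' (r (act P x y)) = a x (e' (r y))" if "x \<in> carrier G" "y \<in> carrier P" for x y
    proof -
      have "r (act P x y) = act Q x (r y)" using r(1) that by (auto simp: ghom_def)
      also have "\<dots> = e (a x (e' (r y)))" by (simp add: Q_def)
      finally show ?thesis using e'r that by (simp add: e'e a_E)
    qed
    ultimately show ?thesis
      using e'r ED by (auto simp: ghom_def hom_def mult_DirProd' a_def)
  qed
  moreover have "f (?h x) = g x" if "x \<in> carrier P" for x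
    using fg[OF e'r(1)[OF that]] r(2)[OF that] by simp
  ultimately show ?thesis by (intro bexI[of _ ?h] ballI)
qed

end

theory Submission
  imports Defs
begin

text \<open>
  A \<open>1\<close>-cocycle of \<open>Hom\<^sub>G(P, M)\<close> is a \<open>G\<close>-map on the kernel of \<open>\<epsilon>\<close>; extend it to an additive map \<open>F\<close>
  on \<open>P\<^sub>0\<close>, which can be done equivariantly over \<open>H\<close>.  Then \<open>F(gp) - gF(p) = \<epsilon>(p) c(g)\<close> defines a crossed
  homomorphism \<open>c\<close>, principal on \<open>H\<close>; conversely, such a \<open>c\<close> defines an \<open>H\<close>-split extension
  of \<open>\<int>\<close> by \<open>M\<close>, to which \<open>\<epsilon>\<close> lifts.  This is the case \<open>n = 1\<close>.

  For larger \<open>n\<close>, shift dimensions in the coefficients along the \<open>H\<close>-split sequences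
  \<open>0 \<rightarrow> A\<^sub>k \<rightarrow> Hom(\<int>[G/H], A\<^sub>k) \<rightarrow> A\<^sub>k\<^sub>+\<^sub>1 \<rightarrow> 0\<close> with \<open>A\<^sub>k = Hom(I\<^sup>\<otimes>\<^sup>k, M)\<close>.  The middle term is
  coinduced from \<open>H\<close>, hence acyclic, because the resolution splits over \<open>H\<close>.  The modules \<open>A\<^sub>k\<close>
  are handled as modules of multilinear maps.  All isomorphisms of cohomology groups come from
  additive relations between cocycles, so that no choices of lifts have to be made additive.
\<close>

section \<open>Groups of functions and quotients\<close>

text \<open>The resolution is arbitrary, so nothing about its shape can be used. What is available
  is relative projectivity, exactness and the splitting of every image over \<open>H\<close>, and
  therefore degrees are lowered in the coefficients. A sequence of coefficients stays exact under
  \<open>Hom_G(P_n, -)\<close> because it splits over \<open>H\<close>. Its modules live on types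
  unrelated to that of the resolution, so lifts along epimorphisms go through
  \<open>rel_projective_lift\<close>.

  The sequence used is \<open>0 -> I -> Z[G/H] -> Z -> 0\<close>, tensored with \<open>I^k\<close>
  and mapped into \<open>M\<close>. Each shift trades one degree for one factor \<open>I\<close>, so
  \<open>n - 1\<close> shifts lead from degree \<open>n\<close> to degree 1; this is the origin of
  the exponent. With multilinear maps the sequence becomes currying in a new first argument, and no
  exactness of tensor products has to be proved. The quotient defining the tensor power enters only
  at the end, through its universal property.

  In the comments below groups are written additively where this is shorter.\<close>

lemma (in comm_group) mult_quotient:
  assumes "a \<in> carrier G" "b \<in> carrier G" "c \<in> carrier G" "e \<in> carrier G"
  shows "(a \<otimes> b) \<otimes> inv (c \<otimes> e) = (a \<otimes> inv c) \<otimes> (b \<otimes> inv e)"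
  using assms by (simp add: inv_mult m_ac)

lemma (in group) quotient_eq_iff:
  assumes "a \<in> carrier G" "b \<in> carrier G" "c \<in> carrier G"
  shows "a \<otimes> inv b = c \<longleftrightarrow> a = c \<otimes> b"
  using assms by (metis inv_solve_right inv_solve_right')

lemma (in group) cancel_left:
  assumes "a \<in> carrier G" "b \<in> carrier G"
  shows "a \<otimes> (inv a \<otimes> b) = b" "inv a \<otimes> (a \<otimes> b) = b"
  using assms by (simp_all add: m_assoc[symmetric])

lemma (in comm_group) quotient_swap:
  assumes "b \<in> carrier G" "c \<in> carrier G" "a = b \<otimes> inv c"
  shows "c = b \<otimes> inv a"
proof -
  have "b \<otimes> inv a = b \<otimes> (inv b \<otimes> c)" using assms by (simp add: inv_mult m_comm)
  then show ?thesis using assms by (simp add: cancel_left)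
qed

text \<open>Closure under pointwise quotients yields everything: \<open>f\<close> by
  \<open>f\<close> is the unit, the unit by \<open>f\<close> the inverse, and \<open>f\<close> by
  the inverse of \<open>g\<close> the product. The groups of cocycles, crossed homomorphisms and
  multilinear maps all enter as such sets of extensional functions.\<close>

lemma subgroup_product_groupI:
  assumes A: "group A" and sub: "S \<subseteq> T \<rightarrow>\<^sub>E carrier A" and ne: "S \<noteq> {}"
    and quot: "\<And>f g. f \<in> S \<Longrightarrow> g \<in> S \<Longrightarrow> (\<lambda>x\<in>T. f x \<otimes>\<^bsub>A\<^esub> inv\<^bsub>A\<^esub> g x) \<in> S"
  shows "subgroup S (product_group T (\<lambda>_. A))"
proof -
  interpret A: group A by fact
  interpret K: group "product_group T (\<lambda>_. A)" by (simp add: A)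
  have c: "f x \<in> carrier A" if "f \<in> S" "x \<in> T" for f x using sub that by auto
  have one: "(\<lambda>x\<in>T. \<one>\<^bsub>A\<^esub>) \<in> S"
  proof -
    obtain f where f: "f \<in> S" using ne by blast
    have "(\<lambda>x\<in>T. f x \<otimes>\<^bsub>A\<^esub> inv\<^bsub>A\<^esub> f x) = (\<lambda>x\<in>T. \<one>\<^bsub>A\<^esub>)" using c[OF f] by (auto intro!: restrict_ext)
    then show ?thesis using quot[OF f f] by simp
  qed
  have inv: "(\<lambda>x\<in>T. inv\<^bsub>A\<^esub> f x) \<in> S" if f: "f \<in> S" for f
  proof -
    have "(\<lambda>x\<in>T. (\<lambda>x\<in>T. \<one>\<^bsub>A\<^esub>) x \<otimes>\<^bsub>A\<^esub> inv\<^bsub>A\<^esub> f x) = (\<lambda>x\<in>T. inv\<^bsub>A\<^esub> f x)"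
      using c[OF f] by (auto intro!: restrict_ext)
    then show ?thesis using quot[OF one f] by simp
  qed
  show ?thesis
  proof (rule K.subgroupI)
    show "S \<subseteq> carrier (product_group T (\<lambda>_. A))" using sub by simp
  next
    fix f assume f: "f \<in> S"
    then show "inv\<^bsub>product_group T (\<lambda>_. A)\<^esub> f \<in> S"
      using inv sub by (subst inv_product_group) (auto simp: A)
    fix g assume g: "g \<in> S"
    have "(\<lambda>x\<in>T. f x \<otimes>\<^bsub>A\<^esub> inv\<^bsub>A\<^esub> (\<lambda>x\<in>T. inv\<^bsub>A\<^esub> g x) x) = (\<lambda>x\<in>T. f x \<otimes>\<^bsub>A\<^esub> g x)"
      using c[OF g] by (auto intro!: restrict_ext)
    then show "f \<otimes>\<^bsub>product_group T (\<lambda>_. A)\<^esub> g \<in> S" using quot[OF f inv[OF g]] by simp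
  qed (fact ne)
qed

lemma subgroup_product_groupD:
  assumes A: "group A" and S: "subgroup S (product_group T (\<lambda>_. A))" and fg: "f \<in> S" "g \<in> S"
  shows "(\<lambda>x\<in>T. f x \<otimes>\<^bsub>A\<^esub> inv\<^bsub>A\<^esub> g x) \<in> S"
proof -
  have "inv\<^bsub>product_group T (\<lambda>_. A)\<^esub> g = (\<lambda>x\<in>T. inv\<^bsub>A\<^esub> g x)"
    using subgroup.subset[OF S] fg A by (intro inv_product_group) auto
  then show ?thesis
    using subgroup.m_closed[OF S fg(1) subgroup.m_inv_closed[OF S fg(2)]]
    by (simp cong: restrict_cong)
qed

lemma comm_group_product_group:
  assumes "comm_group A"
  shows "comm_group (product_group T (\<lambda>_. A))"
proof -
  interpret comm_group A by fact
  show ?thesis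
    by (rule group.group_comm_groupI) (auto intro!: restrict_ext m_comm)
qed

lemma comm_group_subgroup:
  assumes "comm_group A" "subgroup S A"
  shows "comm_group (A\<lparr>carrier := S\<rparr>)"
proof -
  interpret comm_group A by fact
  interpret S: group "A\<lparr>carrier := S\<rparr>" by (rule subgroup.subgroup_is_group[OF assms(2) is_group])
  show ?thesis
    by (rule S.group_comm_groupI) (use subgroup.subset[OF assms(2)] m_comm in \<open>auto simp: subset_iff\<close>)
qed

text \<open>A Goursat-type argument: \<open>W\<close> maps onto both quotients, and the assumption
  on \<open>B\<close> and \<open>B'\<close> says that the two composite maps have the same kernel.
  Both quotients are therefore \<open>W\<close> modulo that kernel, and no map between
  \<open>Z\<close> and \<open>Z'\<close> is involved.\<close>

lemma Mod_iso_if_relation: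
  assumes Z: "comm_group Z" "comm_group Z'" and B: "subgroup B Z" "subgroup B' Z'"
    and W: "subgroup W (Z \<times>\<times> Z')" and onto: "fst ` W = carrier Z" "snd ` W = carrier Z'"
    and BB': "\<And>z z'. (z, z') \<in> W \<Longrightarrow> z \<in> B \<longleftrightarrow> z' \<in> B'"
  shows "Z Mod B \<cong> Z' Mod B'"
proof -
  interpret Z: comm_group Z by fact
  interpret Z': comm_group Z' by fact
  interpret B: normal B Z by (rule Z.subgroup_imp_normal[OF B(1)])
  interpret B': normal B' Z' by (rule Z'.subgroup_imp_normal[OF B(2)])
  let ?W = "(Z \<times>\<times> Z')\<lparr>carrier := W\<rparr>"
  interpret D: group "Z \<times>\<times> Z'" by (rule DirProd_group) (rule Z.is_group Z'.is_group)+
  interpret W: group ?W by (rule subgroup.subgroup_is_group[OF W D.is_group])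
  have Wc: "fst w \<in> carrier Z" "snd w \<in> carrier Z'" if "w \<in> W" for w
    using onto that by auto
  interpret p: group_hom ?W "Z Mod B" "\<lambda>w. B #>\<^bsub>Z\<^esub> fst w"
  proof -
    have "B #>\<^bsub>Z\<^esub> fst (v \<otimes>\<^bsub>Z \<times>\<times> Z'\<^esub> w) = (B #>\<^bsub>Z\<^esub> fst v) <#>\<^bsub>Z\<^esub> (B #>\<^bsub>Z\<^esub> fst w)"
      if "v \<in> W" "w \<in> W" for v w
      using Wc that by (simp add: B.rcos_sum mult_DirProd')
    then show "group_hom ?W (Z Mod B) (\<lambda>w. B #>\<^bsub>Z\<^esub> fst w)"
      using Wc by (simp add: group_hom_def group_hom_axioms_def W.is_group B.factorgroup_is_group
          hom_def carrier_FactGroup)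
  qed
  interpret p': group_hom ?W "Z' Mod B'" "\<lambda>w. B' #>\<^bsub>Z'\<^esub> snd w"
  proof -
    have "B' #>\<^bsub>Z'\<^esub> snd (v \<otimes>\<^bsub>Z \<times>\<times> Z'\<^esub> w) = (B' #>\<^bsub>Z'\<^esub> snd v) <#>\<^bsub>Z'\<^esub> (B' #>\<^bsub>Z'\<^esub> snd w)"
      if "v \<in> W" "w \<in> W" for v w
      using Wc that by (simp add: B'.rcos_sum mult_DirProd')
    then show "group_hom ?W (Z' Mod B') (\<lambda>w. B' #>\<^bsub>Z'\<^esub> snd w)"
      using Wc by (simp add: group_hom_def group_hom_axioms_def W.is_group B'.factorgroup_is_group
          hom_def carrier_FactGroup)
  qed
  let ?K = "kernel ?W (Z Mod B) (\<lambda>w. B #>\<^bsub>Z\<^esub> fst w)"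
  have K: "?K = {w \<in> W. fst w \<in> B}"
    using Wc by (auto simp: kernel_def Z.coset_join2[OF _ B(1)] dest: Z.coset_join1[OF _ _ B(1)])
  have K': "kernel ?W (Z' Mod B') (\<lambda>w. B' #>\<^bsub>Z'\<^esub> snd w) = {w \<in> W. snd w \<in> B'}"
    using Wc by (auto simp: kernel_def Z'.coset_join2[OF _ B(2)] dest: Z'.coset_join1[OF _ _ B(2)])
  have eq: "?K = kernel ?W (Z' Mod B') (\<lambda>w. B' #>\<^bsub>Z'\<^esub> snd w)"
    unfolding K K' using BB' by force
  have 1: "?W Mod ?K \<cong> Z Mod B"
  proof -
    have "(\<lambda>w. B #>\<^bsub>Z\<^esub> fst w) ` carrier ?W = carrier (Z Mod B)"
      unfolding carrier_FactGroup onto(1)[symmetric] by (simp add: image_image)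
    then show ?thesis using p.FactGroup_iso_set is_isoI by blast
  qed
  have 2: "?W Mod (kernel ?W (Z' Mod B') (\<lambda>w. B' #>\<^bsub>Z'\<^esub> snd w)) \<cong> Z' Mod B'"
  proof -
    have "(\<lambda>w. B' #>\<^bsub>Z'\<^esub> snd w) ` carrier ?W = carrier (Z' Mod B')"
      unfolding carrier_FactGroup onto(2)[symmetric] by (simp add: image_image)
    then show ?thesis using p'.FactGroup_iso_set is_isoI by blast
  qed
  have "Z Mod B \<cong> ?W Mod ?K"
    by (rule group.iso_sym[OF normal.factorgroup_is_group[OF p.normal_kernel] 1])
  then show ?thesis unfolding eq using 2 by (rule iso_trans)
qed

text \<open>The form in which cohomology groups are compared. \<open>R z z'\<close> will say that
  some auxiliary lift links \<open>z\<close> and \<open>z'\<close>; lifts can be divided pointwise,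
  so closure under quotients is the natural condition.\<close>

lemma function_quotient_iso:
  assumes A: "comm_group A" "comm_group A'"
    and Z: "subgroup Z (product_group T (\<lambda>_. A))" "subgroup Z' (product_group T' (\<lambda>_. A'))"
    and B: "subgroup B (product_group T (\<lambda>_. A))" "subgroup B' (product_group T' (\<lambda>_. A'))"
    and BZ: "B \<subseteq> Z" "B' \<subseteq> Z'"
    and R: "\<And>z z'. R z z' \<Longrightarrow> z \<in> Z \<and> z' \<in> Z'"
    and quot: "\<And>y y' z z'. R y y' \<Longrightarrow> R z z'
      \<Longrightarrow> R (\<lambda>x\<in>T. y x \<otimes>\<^bsub>A\<^esub> inv\<^bsub>A\<^esub> z x) (\<lambda>x\<in>T'. y' x \<otimes>\<^bsub>A'\<^esub> inv\<^bsub>A'\<^esub> z' x)"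
    and onto: "\<And>z. z \<in> Z \<Longrightarrow> \<exists>z'. R z z'" "\<And>z'. z' \<in> Z' \<Longrightarrow> \<exists>z. R z z'"
    and BB': "\<And>z z'. R z z' \<Longrightarrow> z \<in> B \<longleftrightarrow> z' \<in> B'"
  shows "(product_group T (\<lambda>_. A))\<lparr>carrier := Z\<rparr> Mod B \<cong> (product_group T' (\<lambda>_. A'))\<lparr>carrier := Z'\<rparr> Mod B'"
proof -
  let ?K = "product_group T (\<lambda>_. A)" and ?K' = "product_group T' (\<lambda>_. A')"
  let ?Z = "?K\<lparr>carrier := Z\<rparr>" and ?Z' = "?K'\<lparr>carrier := Z'\<rparr>"
  let ?W = "{(z, z'). R z z'}"
  interpret A: comm_group A by fact
  interpret A': comm_group A' by fact
  interpret K: comm_group ?K by (rule comm_group_product_group[OF A(1)])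
  interpret K': comm_group ?K' by (rule comm_group_product_group[OF A(2)])
  interpret Z: comm_group ?Z by (rule comm_group_subgroup[OF K.comm_group_axioms Z(1)])
  interpret Z': comm_group ?Z' by (rule comm_group_subgroup[OF K'.comm_group_axioms Z(2)])
  interpret D: group "?Z \<times>\<times> ?Z'" by (rule DirProd_group) (rule Z.is_group Z'.is_group)+
  have inv: "inv\<^bsub>?Z\<^esub> z = (\<lambda>x\<in>T. inv\<^bsub>A\<^esub> z x)" if "z \<in> Z" for z
    using that subgroup.subset[OF Z(1)] by (subst K.m_inv_consistent[OF Z(1)]) auto
  have inv': "inv\<^bsub>?Z'\<^esub> z = (\<lambda>x\<in>T'. inv\<^bsub>A'\<^esub> z x)" if "z \<in> Z'" for z
    using that subgroup.subset[OF Z(2)] by (subst K'.m_inv_consistent[OF Z(2)]) auto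
  have c: "z x \<in> carrier A" if "z \<in> Z" "x \<in> T" for z x
    using that subgroup.subset[OF Z(1)] by auto
  have c': "z x \<in> carrier A'" if "z \<in> Z'" "x \<in> T'" for z x
    using that subgroup.subset[OF Z(2)] by auto
  have one: "R (\<lambda>x\<in>T. \<one>\<^bsub>A\<^esub>) (\<lambda>x\<in>T'. \<one>\<^bsub>A'\<^esub>)"
  proof -
    obtain z z' where z: "R z z'" using onto(1) subgroup.one_closed[OF Z(1)] by blast
    have "(\<lambda>x\<in>T. z x \<otimes>\<^bsub>A\<^esub> inv\<^bsub>A\<^esub> z x) = (\<lambda>x\<in>T. \<one>\<^bsub>A\<^esub>)"
      "(\<lambda>x\<in>T'. z' x \<otimes>\<^bsub>A'\<^esub> inv\<^bsub>A'\<^esub> z' x) = (\<lambda>x\<in>T'. \<one>\<^bsub>A'\<^esub>)"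
      using R[OF z] c c' by (auto intro!: restrict_ext)
    then show ?thesis using quot[OF z z] by simp
  qed
  have Rinv: "R (\<lambda>x\<in>T. inv\<^bsub>A\<^esub> z x) (\<lambda>x\<in>T'. inv\<^bsub>A'\<^esub> z' x)" if z: "R z z'" for z z'
  proof -
    have "(\<lambda>x\<in>T. (\<lambda>x\<in>T. \<one>\<^bsub>A\<^esub>) x \<otimes>\<^bsub>A\<^esub> inv\<^bsub>A\<^esub> z x) = (\<lambda>x\<in>T. inv\<^bsub>A\<^esub> z x)"
      "(\<lambda>x\<in>T'. (\<lambda>x\<in>T'. \<one>\<^bsub>A'\<^esub>) x \<otimes>\<^bsub>A'\<^esub> inv\<^bsub>A'\<^esub> z' x) = (\<lambda>x\<in>T'. inv\<^bsub>A'\<^esub> z' x)"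
      using R[OF z] c c' by (auto intro!: restrict_ext)
    then show ?thesis using quot[OF one z] by simp
  qed
  have Rmult: "R (\<lambda>x\<in>T. y x \<otimes>\<^bsub>A\<^esub> z x) (\<lambda>x\<in>T'. y' x \<otimes>\<^bsub>A'\<^esub> z' x)" if y: "R y y'" and z: "R z z'" for y y' z z'
  proof -
    have "(\<lambda>x\<in>T. y x \<otimes>\<^bsub>A\<^esub> inv\<^bsub>A\<^esub> (\<lambda>x\<in>T. inv\<^bsub>A\<^esub> z x) x) = (\<lambda>x\<in>T. y x \<otimes>\<^bsub>A\<^esub> z x)"
      "(\<lambda>x\<in>T'. y' x \<otimes>\<^bsub>A'\<^esub> inv\<^bsub>A'\<^esub> (\<lambda>x\<in>T'. inv\<^bsub>A'\<^esub> z' x) x) = (\<lambda>x\<in>T'. y' x \<otimes>\<^bsub>A'\<^esub> z' x)"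
      using R[OF z] c c' by (auto intro!: restrict_ext)
    then show ?thesis using quot[OF y Rinv[OF z]] by simp
  qed
  have W: "subgroup ?W (?Z \<times>\<times> ?Z')"
  proof (rule D.subgroupI)
    show "?W \<subseteq> carrier (?Z \<times>\<times> ?Z')" using R by auto
    show "?W \<noteq> {}" using one by blast
    show "inv\<^bsub>?Z \<times>\<times> ?Z'\<^esub> w \<in> ?W" if "w \<in> ?W" for w
      using that R Rinv by (auto simp: inv_DirProd[OF Z.is_group Z'.is_group] inv inv')
    show "v \<otimes>\<^bsub>?Z \<times>\<times> ?Z'\<^esub> w \<in> ?W" if "v \<in> ?W" "w \<in> ?W" for v w
      using that Rmult by (auto simp: mult_DirProd')
  qed
  show ?thesis
  proof (rule Mod_iso_if_relation[OF Z.comm_group_axioms Z'.comm_group_axioms _ _ W])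
    show "subgroup B ?Z" by (rule K.subgroup_incl[OF B(1) Z(1) BZ(1)])
    show "subgroup B' ?Z'" by (rule K'.subgroup_incl[OF B(2) Z(2) BZ(2)])
    show "fst ` ?W = carrier ?Z" using R onto(1) by (auto simp: image_def) 
    show "snd ` ?W = carrier ?Z'" using R onto(2) by (auto simp: image_def) 
  qed (use BB' in auto)
qed

section \<open>Homomorphisms of modules and Adamson cocycles\<close>

lemma restrict_eq_iff: "restrict f A = restrict g A \<longleftrightarrow> (\<forall>x\<in>A. f x = g x)"
  by (auto simp: restrict_def fun_eq_iff)

lemma ghomD:
  assumes "f \<in> ghom G A B"
  shows "f \<in> hom A B" "\<And>x. x \<in> carrier A \<Longrightarrow> f x \<in> carrier B"
    "\<And>x y. x \<in> carrier A \<Longrightarrow> y \<in> carrier A \<Longrightarrow> f (x \<otimes>\<^bsub>A\<^esub> y) = f x \<otimes>\<^bsub>B\<^esub> f y"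
    "\<And>g x. g \<in> carrier G \<Longrightarrow> x \<in> carrier A \<Longrightarrow> f (act A g x) = act B g (f x)"
  using assms by (auto simp: ghom_def hom_def Pi_iff)

lemma ghomI:
  assumes "\<And>x. x \<in> carrier A \<Longrightarrow> f x \<in> carrier B"
    "\<And>x y. x \<in> carrier A \<Longrightarrow> y \<in> carrier A \<Longrightarrow> f (x \<otimes>\<^bsub>A\<^esub> y) = f x \<otimes>\<^bsub>B\<^esub> f y"
    "\<And>g x. g \<in> carrier G \<Longrightarrow> x \<in> carrier A \<Longrightarrow> f (act A g x) = act B g (f x)"
  shows "f \<in> ghom G A B"
  using assms by (auto simp: ghom_def hom_def Pi_iff)

lemma gmodule_group_hom:
  assumes "gmodule G A" "gmodule G B" "f \<in> ghom G A B"
  shows "group_hom A B f"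
  using gmoduleD(2)[OF assms(1)] gmoduleD(2)[OF assms(2)] ghomD(1)[OF assms(3)]
  by (simp add: group_hom_def group_hom_axioms_def)

lemma ghom_one_inv:
  assumes "gmodule G A" "gmodule G B" "f \<in> ghom G A B"
  shows "f \<one>\<^bsub>A\<^esub> = \<one>\<^bsub>B\<^esub>" "\<And>x. x \<in> carrier A \<Longrightarrow> f (inv\<^bsub>A\<^esub> x) = inv\<^bsub>B\<^esub> (f x)"
proof -
  interpret group_hom A B f by (rule gmodule_group_hom[OF assms])
  show "f \<one>\<^bsub>A\<^esub> = \<one>\<^bsub>B\<^esub>" "\<And>x. x \<in> carrier A \<Longrightarrow> f (inv\<^bsub>A\<^esub> x) = inv\<^bsub>B\<^esub> (f x)" by simp_all
qed

lemma gmodule_act_one_inv: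
  assumes "gmodule G M" "g \<in> carrier G"
  shows "act M g \<one>\<^bsub>M\<^esub> = \<one>\<^bsub>M\<^esub>" "\<And>x. x \<in> carrier M \<Longrightarrow> act M g (inv\<^bsub>M\<^esub> x) = inv\<^bsub>M\<^esub> (act M g x)"
proof -
  interpret group_hom M M "act M g"
    using gmoduleD(2,3)[OF assms(1)] assms(2) by (simp add: group_hom_def group_hom_axioms_def)
  show "act M g \<one>\<^bsub>M\<^esub> = \<one>\<^bsub>M\<^esub>" "\<And>x. x \<in> carrier M \<Longrightarrow> act M g (inv\<^bsub>M\<^esub> x) = inv\<^bsub>M\<^esub> (act M g x)" by simp_all
qed

lemma gmodule_act_inverse:
  assumes "group G" "gmodule G M" "g \<in> carrier G" "x \<in> carrier M"
  shows "act M g (act M (inv\<^bsub>G\<^esub> g) x) = x" "act M (inv\<^bsub>G\<^esub> g) (act M g x) = x"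
proof -
  interpret group G by fact
  show "act M g (act M (inv\<^bsub>G\<^esub> g) x) = x" "act M (inv\<^bsub>G\<^esub> g) (act M g x) = x"
    using assms(3,4) gmoduleD(6,7)[OF assms(2)] by (metis inv_closed r_inv, metis inv_closed l_inv)
qed

lemma ghom_cong:
  assumes "gmodule G A" "f \<in> ghom G A B" "\<And>x. x \<in> carrier A \<Longrightarrow> f' x = f x"
  shows "f' \<in> ghom G A B"
proof -
  interpret comm_group A by (rule gmoduleD(1)[OF assms(1)])
  show ?thesis
    by (rule ghomI) (simp_all add: assms(3) ghomD[OF assms(2)] gmoduleD(4)[OF assms(1)])
qed

lemma ghom_restrict:
  assumes "gmodule G A" "f \<in> ghom G A B"
  shows "restrict f (carrier A) \<in> ghom G A B"
  using assms by (rule ghom_cong) simp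

lemma ghom_comp:
  assumes "f \<in> ghom G A B" "f' \<in> ghom G B C"
  shows "(\<lambda>x. f' (f x)) \<in> ghom G A C"
  by (rule ghomI) (simp_all add: ghomD[OF assms(1)] ghomD[OF assms(2)])

lemma ghom_quotient:
  assumes "gmodule G B" "f \<in> ghom G A B" "f' \<in> ghom G A B"
  shows "(\<lambda>x. f x \<otimes>\<^bsub>B\<^esub> inv\<^bsub>B\<^esub> f' x) \<in> ghom G A B"
proof -
  interpret comm_group B by (rule gmoduleD(1)[OF assms(1)])
  show ?thesis
    by (rule ghomI)
      (simp_all add: ghomD[OF assms(2)] ghomD[OF assms(3)] gmoduleD(5)[OF assms(1)]
        gmodule_act_one_inv[OF assms(1)] mult_quotient)
qed

lemma ghom_trivial:
  assumes "gmodule G B"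
  shows "(\<lambda>x. \<one>\<^bsub>B\<^esub>) \<in> ghom G A B"
proof -
  interpret comm_group B by (rule gmoduleD(1)[OF assms(1)])
  show ?thesis by (rule ghomI) (simp_all add: gmodule_act_one_inv[OF assms])
qed

text \<open>Indexed by \<open>m\<close> for degree \<open>m + 1\<close>: only positive degrees
  occur, so that a preceding module \<open>P m\<close> always exists.\<close>

definition adamson_cocycles ::
    "('g, 'b) monoid_scheme \<Rightarrow> (nat \<Rightarrow> ('g, 'p) gmod) \<Rightarrow> (nat \<Rightarrow> 'p \<Rightarrow> 'p) \<Rightarrow> ('g, 'm) gmod
      \<Rightarrow> nat \<Rightarrow> ('p \<Rightarrow> 'm) set" where
  "adamson_cocycles G P d M m = {f \<in> ghom G (P (Suc m)) M \<inter> extensional (carrier (P (Suc m))).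
     \<forall>x\<in>carrier (P (Suc (Suc m))). f (d (Suc m) x) = \<one>\<^bsub>M\<^esub>}"

text \<open>The witness \<open>F\<close> is not asked to be extensional, because its values off the
  carrier of \<open>P m\<close> are never reached through \<open>d m\<close>.\<close>

definition adamson_coboundaries ::
    "('g, 'b) monoid_scheme \<Rightarrow> (nat \<Rightarrow> ('g, 'p) gmod) \<Rightarrow> (nat \<Rightarrow> 'p \<Rightarrow> 'p) \<Rightarrow> ('g, 'm) gmod
      \<Rightarrow> nat \<Rightarrow> ('p \<Rightarrow> 'm) set" where
  "adamson_coboundaries G P d M m = {f \<in> ghom G (P (Suc m)) M \<inter> extensional (carrier (P (Suc m))).
     \<exists>F\<in>ghom G (P m) M. \<forall>x\<in>carrier (P (Suc m)). f x = F (d m x)}"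

locale adamson_resolution =
  fixes G :: "('g, 'b) monoid_scheme" and H :: "'g set"
    and P :: "nat \<Rightarrow> ('g, 'p) gmod" and d :: "nat \<Rightarrow> 'p \<Rightarrow> 'p" and \<epsilon> :: "'p \<Rightarrow> int"
  assumes G: "group G" and H: "subgroup H G"
    and resolution: "rel_projective_resolution G H P d \<epsilon> trivial_int_module"
begin

sublocale G: group G by (rule G)

abbreviation "Hg \<equiv> G\<lparr>carrier := H\<rparr>"

lemma H_in_G: "h \<in> H \<Longrightarrow> h \<in> carrier G"
  using subgroup.subset[OF H] by blast

lemma proj: "rel_projective G H (P n)"
  using resolution by (simp add: rel_projective_resolution_def)

lemma P: "gmodule G (P n)"
  using proj by (simp add: rel_projective_def)

lemma int_module: "gmodule G trivial_int_module"
  using resolution by (simp add: rel_projective_resolution_def)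

lemma d: "d n \<in> ghom G (P (Suc n)) (P n)"
  using resolution by (simp add: rel_projective_resolution_def)

lemma \<epsilon>: "\<epsilon> \<in> ghom G (P 0) trivial_int_module"
  using resolution by (simp add: rel_projective_resolution_def)

lemma d_exact: "d (Suc n) ` carrier (P (Suc (Suc n))) = kernel (P (Suc n)) (P n) (d n)"
  using resolution by (simp add: rel_projective_resolution_def)

lemma \<epsilon>_exact: "d 0 ` carrier (P (Suc 0)) = kernel (P 0) (trivial_int_module :: ('g, int) gmod) \<epsilon>"
  using resolution by (simp add: rel_projective_resolution_def)

lemma \<epsilon>_onto: "\<epsilon> ` carrier (P 0) = carrier (trivial_int_module :: ('g, int) gmod)"
  using resolution by (simp add: rel_projective_resolution_def)

text \<open>Speaking of the image of \<open>d n\<close> instead of the kernel that it equals merges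
  two cases: the kernel of \<epsilon> in degree 0 and the kernels of the differentials in higher
  degrees.\<close>

lemma image_summand: "direct_summand Hg (P n) (d n ` carrier (P (Suc n)))"
  using resolution by (cases n) (simp_all add: rel_projective_resolution_def)

lemma d_d:
  assumes "x \<in> carrier (P (Suc (Suc n)))"
  shows "d n (d (Suc n) x) = \<one>\<^bsub>P n\<^esub>"
  using d_exact[of n] assms by (auto simp: kernel_def)

lemma coboundaries_subset_cocycles:
  assumes M: "gmodule G M"
  shows "adamson_coboundaries G P d M m \<subseteq> adamson_cocycles G P d M m"
proof
  fix f assume f: "f \<in> adamson_coboundaries G P d M m"
  then obtain F where F: "F \<in> ghom G (P m) M" "\<And>x. x \<in> carrier (P (Suc m)) \<Longrightarrow> f x = F (d m x)"
    by (auto simp: adamson_coboundaries_def)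
  show "f \<in> adamson_cocycles G P d M m"
    using f ghom_one_inv(1)[OF P M F(1)] ghomD(2)[OF d]
    by (auto simp: adamson_coboundaries_def adamson_cocycles_def F(2) d_d)
qed

lemma subgroup_cocycles:
  assumes M: "gmodule G M"
  shows "subgroup (adamson_cocycles G P d M m) (product_group (carrier (P (Suc m))) (\<lambda>_. M))"
proof (rule subgroup_product_groupI)
  interpret M: comm_group M by (rule gmoduleD(1)[OF M])
  show "group M" by (rule M.is_group)
  show "adamson_cocycles G P d M m \<subseteq> carrier (P (Suc m)) \<rightarrow>\<^sub>E carrier M"
    by (auto simp: adamson_cocycles_def PiE_def intro: ghomD)
  have "(\<lambda>x\<in>carrier (P (Suc m)). \<one>\<^bsub>M\<^esub>) \<in> adamson_cocycles G P d M m"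
    using ghom_restrict[OF P ghom_trivial[OF M]] ghomD(2)[OF d]
    by (auto simp: adamson_cocycles_def)
  then show "adamson_cocycles G P d M m \<noteq> {}" by blast
  fix f f' assume "f \<in> adamson_cocycles G P d M m" "f' \<in> adamson_cocycles G P d M m"
  then show "(\<lambda>x\<in>carrier (P (Suc m)). f x \<otimes>\<^bsub>M\<^esub> inv\<^bsub>M\<^esub> f' x) \<in> adamson_cocycles G P d M m"
    using ghom_restrict[OF P ghom_quotient[OF M]] ghomD(2)[OF d]
    by (auto simp: adamson_cocycles_def)
qed

lemma subgroup_coboundaries:
  assumes M: "gmodule G M"
  shows "subgroup (adamson_coboundaries G P d M m) (product_group (carrier (P (Suc m))) (\<lambda>_. M))"
proof (rule subgroup_product_groupI)
  interpret M: comm_group M by (rule gmoduleD(1)[OF M])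
  show "group M" by (rule M.is_group)
  show "adamson_coboundaries G P d M m \<subseteq> carrier (P (Suc m)) \<rightarrow>\<^sub>E carrier M"
    by (auto simp: adamson_coboundaries_def PiE_def intro: ghomD)
  have "(\<lambda>x\<in>carrier (P (Suc m)). \<one>\<^bsub>M\<^esub>) \<in> adamson_coboundaries G P d M m"
    using ghom_restrict[OF P ghom_trivial[OF M]] ghom_trivial[OF M]
    by (auto simp: adamson_coboundaries_def intro!: bexI[of _ "\<lambda>_. \<one>\<^bsub>M\<^esub>"])
  then show "adamson_coboundaries G P d M m \<noteq> {}" by blast
  fix f f' assume f: "f \<in> adamson_coboundaries G P d M m" "f' \<in> adamson_coboundaries G P d M m"
  obtain F where F: "F \<in> ghom G (P m) M" "\<And>x. x \<in> carrier (P (Suc m)) \<Longrightarrow> f x = F (d m x)"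
    using f by (auto simp: adamson_coboundaries_def)
  obtain F' where F': "F' \<in> ghom G (P m) M" "\<And>x. x \<in> carrier (P (Suc m)) \<Longrightarrow> f' x = F' (d m x)"
    using f by (auto simp: adamson_coboundaries_def)
  show "(\<lambda>x\<in>carrier (P (Suc m)). f x \<otimes>\<^bsub>M\<^esub> inv\<^bsub>M\<^esub> f' x) \<in> adamson_coboundaries G P d M m"
    using f ghom_restrict[OF P ghom_quotient[OF M]] ghom_quotient[OF M F(1) F'(1)]
    by (auto simp: adamson_coboundaries_def F(2) F'(2) intro!: bexI[of _ "\<lambda>x. F x \<otimes>\<^bsub>M\<^esub> inv\<^bsub>M\<^esub> F' x"])
qed

lemma adamson_cohomology_Suc:
  assumes M: "gmodule G M"
  shows "adamson_cohomology G P d M (Suc m)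
    = (product_group (carrier (P (Suc m))) (\<lambda>_. M))\<lparr>carrier := adamson_cocycles G P d M m\<rparr>
        Mod adamson_coboundaries G P d M m"
proof -
  have 1: "kernel (ghom_group G (P (Suc m)) M) (ghom_group G (P (Suc (Suc m))) M)
      (\<lambda>f. compose (carrier (P (Suc (Suc m)))) f (d (Suc m))) = adamson_cocycles G P d M m"
    by (auto simp: kernel_def adamson_cocycles_def ghom_group_def compose_def restrict_eq_iff)
  have 2: "(\<lambda>f. compose (carrier (P (Suc m))) f (d m)) ` carrier (ghom_group G (P m) M)
      = adamson_coboundaries G P d M m" (is "?L = ?R")
  proof
    show "?L \<subseteq> ?R"
      using ghom_restrict[OF P ghom_comp[OF d]]
      by (auto simp: adamson_coboundaries_def ghom_group_def compose_def)
    show "?R \<subseteq> ?L"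
    proof
      fix f assume f: "f \<in> ?R"
      then obtain F where F: "F \<in> ghom G (P m) M" "\<And>x. x \<in> carrier (P (Suc m)) \<Longrightarrow> f x = F (d m x)"
        by (auto simp: adamson_coboundaries_def)
      \<comment> \<open>\<open>F\<close> itself need not be extensional, as
        \<open>ghom_group\<close> demands. Its restriction is, and since \<open>d m\<close> takes
        values in the carrier the composite is unchanged.\<close>
      have "f = compose (carrier (P (Suc m))) (restrict F (carrier (P m))) (d m)"
      proof (rule extensionalityI)
        show "f \<in> extensional (carrier (P (Suc m)))" using f by (simp add: adamson_coboundaries_def)
      qed (simp_all add: compose_def F(2) ghomD(2)[OF d])
      moreover have "restrict F (carrier (P m)) \<in> carrier (ghom_group G (P m) M)"
        using ghom_restrict[OF P F(1)] by (simp add: ghom_group_def)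
      ultimately show "f \<in> ?L" by (rule image_eqI)
    qed
  qed
  show ?thesis
    unfolding adamson_cohomology_def cohomology_def 1 coboundaries_def
    by (simp add: 2) (simp add: ghom_group_def)
qed

text \<open>Over \<open>H\<close> the image of \<open>d m\<close> has a complement \<open>L\<close>,
  so \<open>F(d y + l) = f(y)\<close> defines an extension that vanishes on \<open>L\<close>. It is
  well defined because \<open>f\<close> kills the image of \<open>d (Suc m)\<close>, which is the
  kernel of \<open>d m\<close>. Over \<open>G\<close> there is in general no complement, and that is
  where the cohomology comes from.\<close>

lemma equivariant_extension:
  fixes M :: "('g, 'm) gmod"
  assumes M: "gmodule Hg M" and f: "f \<in> ghom Hg (P (Suc m)) M"
    and fd: "\<And>x. x \<in> carrier (P (Suc (Suc m))) \<Longrightarrow> f (d (Suc m) x) = \<one>\<^bsub>M\<^esub>"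
  obtains F where "F \<in> ghom Hg (P m) M" "\<And>x. x \<in> carrier (P (Suc m)) \<Longrightarrow> F (d m x) = f x"
proof -
  interpret A: comm_group "P m" by (rule gmoduleD(1)[OF P])
  interpret B: comm_group "P (Suc m)" by (rule gmoduleD(1)[OF P])
  interpret M: comm_group M by (rule gmoduleD(1)[OF M])
  interpret d: group_hom "P (Suc m)" "P m" "d m" by (rule gmodule_group_hom[OF P P d])
  interpret f: group_hom "P (Suc m)" M f by (rule gmodule_group_hom[OF gmodule_subgroup[OF P H] M f])
  let ?I = "d m ` carrier (P (Suc m))"
  obtain L where L: "gsubmodule Hg (P m) L" "?I \<inter> L = {\<one>\<^bsub>P m\<^esub>}" "?I <#>\<^bsub>P m\<^esub> L = carrier (P m)"
    using image_summand[of m] by (auto simp: direct_summand_def)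
  have sL: "subgroup L (P m)" and actL: "\<And>h x. h \<in> H \<Longrightarrow> x \<in> L \<Longrightarrow> act (P m) h x \<in> L"
    using L(1) by (auto simp: gsubmodule_def)
  have LP: "l \<in> carrier (P m)" if "l \<in> L" for l using subgroup.subset[OF sL] that by blast
  have ex: "\<exists>y l. y \<in> carrier (P (Suc m)) \<and> l \<in> L \<and> x = d m y \<otimes>\<^bsub>P m\<^esub> l" if "x \<in> carrier (P m)" for x
    using that unfolding L(3)[symmetric] by (auto simp: set_mult_def)
  have uniq: "f y = f y'"
    if y: "y \<in> carrier (P (Suc m))" "y' \<in> carrier (P (Suc m))" and l: "l \<in> L" "l' \<in> L"
      and eq: "d m y \<otimes>\<^bsub>P m\<^esub> l = d m y' \<otimes>\<^bsub>P m\<^esub> l'" for y y' l l'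
  proof -
    \<comment> \<open>\<open>d m\<close> sends the quotient of \<open>y\<close> and
      \<open>y'\<close> into the image of \<open>d m\<close> and into \<open>L\<close> at once,
      hence to the unit.\<close>
    let ?y = "y \<otimes>\<^bsub>P (Suc m)\<^esub> inv\<^bsub>P (Suc m)\<^esub> y'"
    have "d m y = (l' \<otimes>\<^bsub>P m\<^esub> inv\<^bsub>P m\<^esub> l) \<otimes>\<^bsub>P m\<^esub> d m y'"
      using eq y LP[OF l(1)] LP[OF l(2)]
      by (metis A.m_comm A.inv_solve_right A.m_assoc A.m_closed A.inv_closed d.hom_closed)
    then have "d m ?y = l' \<otimes>\<^bsub>P m\<^esub> inv\<^bsub>P m\<^esub> l"
      using y LP[OF l(1)] LP[OF l(2)] by (simp add: A.quotient_eq_iff)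
    moreover have "l' \<otimes>\<^bsub>P m\<^esub> inv\<^bsub>P m\<^esub> l \<in> L"
      using l sL by (simp add: subgroup.m_closed subgroup.m_inv_closed)
    moreover have "d m ?y \<in> ?I" by (rule imageI[of _ _ "d m"]) (use y in simp)
    ultimately have "d m ?y = \<one>\<^bsub>P m\<^esub>" using L(2) by auto
    then have "?y \<in> d (Suc m) ` carrier (P (Suc (Suc m)))"
      using y unfolding d_exact by (simp add: kernel_def)
    then have "f ?y = \<one>\<^bsub>M\<^esub>" using fd by auto
    then show ?thesis using y by (simp add: M.quotient_eq_iff)
  qed
  \<comment> \<open>The component \<open>y\<close> is determined only up to the kernel of
    \<open>d m\<close>; by \<open>uniq\<close> the choice does not affect the value.\<close>
  define F where "F x = f (SOME y. y \<in> carrier (P (Suc m)) \<and> (\<exists>l\<in>L. x = d m y \<otimes>\<^bsub>P m\<^esub> l))" for x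
  have F: "F (d m y \<otimes>\<^bsub>P m\<^esub> l) = f y" if y: "y \<in> carrier (P (Suc m))" and l: "l \<in> L" for y l
  proof -
    let ?Q = "\<lambda>y'. y' \<in> carrier (P (Suc m)) \<and> (\<exists>l'\<in>L. d m y \<otimes>\<^bsub>P m\<^esub> l = d m y' \<otimes>\<^bsub>P m\<^esub> l')"
    have "?Q (SOME y'. ?Q y')" by (rule someI[of ?Q y]) (use y l in blast)
    then obtain l' where "l' \<in> L" "d m y \<otimes>\<^bsub>P m\<^esub> l = d m (SOME y'. ?Q y') \<otimes>\<^bsub>P m\<^esub> l'"
      and "(SOME y'. ?Q y') \<in> carrier (P (Suc m))" by blast
    then show ?thesis unfolding F_def using uniq[OF y _ l, symmetric] by simp
  qed
  have "F \<in> ghom Hg (P m) M"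
  proof (rule ghomI)
    fix x assume "x \<in> carrier (P m)"
    then obtain y l where x: "y \<in> carrier (P (Suc m))" "l \<in> L" "x = d m y \<otimes>\<^bsub>P m\<^esub> l" using ex by blast
    then show "F x \<in> carrier M" by (simp add: F)
    {
      fix x' assume "x' \<in> carrier (P m)"
      then obtain y' l' where x': "y' \<in> carrier (P (Suc m))" "l' \<in> L" "x' = d m y' \<otimes>\<^bsub>P m\<^esub> l'"
        using ex by blast
      have eq: "x \<otimes>\<^bsub>P m\<^esub> x' = d m (y \<otimes>\<^bsub>P (Suc m)\<^esub> y') \<otimes>\<^bsub>P m\<^esub> (l \<otimes>\<^bsub>P m\<^esub> l')"
        using x x' LP by (simp add: A.m_ac)
      have "F (x \<otimes>\<^bsub>P m\<^esub> x') = f (y \<otimes>\<^bsub>P (Suc m)\<^esub> y')"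
        unfolding eq by (rule F) (use x x' sL in \<open>simp_all add: subgroup.m_closed\<close>)
      then show "F (x \<otimes>\<^bsub>P m\<^esub> x') = F x \<otimes>\<^bsub>M\<^esub> F x'"
        using x x' by (simp add: F)
    }
    fix h assume "h \<in> carrier Hg"
    then have h: "h \<in> H" "h \<in> carrier G" using H_in_G by auto
    have "act (P m) h x = d m (act (P (Suc m)) h y) \<otimes>\<^bsub>P m\<^esub> act (P m) h l"
      using x h LP by (simp add: gmoduleD(5)[OF P] ghomD(4)[OF d])
    then show "F (act (P m) h x) = act M h (F x)"
      using x h actL by (simp add: F gmoduleD(4)[OF P] ghomD(4)[OF f])
  qed
  moreover have "F (d m x) = f x" if "x \<in> carrier (P (Suc m))" for x
    using F[OF that subgroup.one_closed[OF sL]] that by simp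
  ultimately show ?thesis using that by blast
qed

end

section \<open>The first cohomology groups\<close>

lemma tuples_0: "tuples S 0 = {[]}"
  by (auto simp: tuples_def)

lemma tuples_1: "tuples S (Suc 0) = (\<lambda>g. [g]) ` S"
  by (auto simp: tuples_def length_Suc_conv)

lemma tuples_2: "tuples S (Suc (Suc 0)) = (\<lambda>(g, h). [g, h]) ` (S \<times> S)"
  by (auto simp: tuples_def length_Suc_conv image_iff)

text \<open>Arguments are one-element lists, so that these functions are literally the cocycles
  among the 1-cochains.\<close>

definition crossed_homs :: "('g, 'b) monoid_scheme \<Rightarrow> ('g, 'a) gmod \<Rightarrow> ('g list \<Rightarrow> 'a) set" where
  "crossed_homs G A = {c \<in> tuples (carrier G) (Suc 0) \<rightarrow>\<^sub>E carrier A.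
     \<forall>g\<in>carrier G. \<forall>h\<in>carrier G. c [g \<otimes>\<^bsub>G\<^esub> h] = c [g] \<otimes>\<^bsub>A\<^esub> act A g (c [h])}"

definition principal_crossed_homs ::
    "('g, 'b) monoid_scheme \<Rightarrow> ('g, 'a) gmod \<Rightarrow> ('g list \<Rightarrow> 'a) set" where
  "principal_crossed_homs G A = {c \<in> tuples (carrier G) (Suc 0) \<rightarrow>\<^sub>E carrier A.
     \<exists>m\<in>carrier A. \<forall>g\<in>carrier G. c [g] = act A g m \<otimes>\<^bsub>A\<^esub> inv\<^bsub>A\<^esub> m}"

lemma crossed_homsD:
  assumes "c \<in> crossed_homs G A"
  shows "\<And>g. g \<in> carrier G \<Longrightarrow> c [g] \<in> carrier A" "c \<in> extensional (tuples (carrier G) (Suc 0))"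
    "\<And>g h. g \<in> carrier G \<Longrightarrow> h \<in> carrier G \<Longrightarrow> c [g \<otimes>\<^bsub>G\<^esub> h] = c [g] \<otimes>\<^bsub>A\<^esub> act A g (c [h])"
  using assms by (auto simp: crossed_homs_def tuples_1 PiE_iff)

lemma crossed_homs_eq_kernel:
  assumes G: "group G" and A: "gmodule G A"
  shows "kernel (cochains G A (Suc 0)) (cochains G A (Suc (Suc 0))) (cochain_diff G A (Suc 0))
    = crossed_homs G A"
proof -
  interpret G: group G by fact
  interpret A: comm_group A by (rule gmoduleD(1)[OF A])
  have *: "cochain_diff G A (Suc 0) f [g, h] = \<one>\<^bsub>A\<^esub>
      \<longleftrightarrow> f [g \<otimes>\<^bsub>G\<^esub> h] = f [g] \<otimes>\<^bsub>A\<^esub> act A g (f [h])"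
    if f: "f \<in> tuples (carrier G) (Suc 0) \<rightarrow>\<^sub>E carrier A" and g: "g \<in> carrier G" "h \<in> carrier G" for f g h
  proof -
    have c: "f [x] \<in> carrier A" if "x \<in> carrier G" for x
      using f that by (auto simp: tuples_1)
    \<comment> \<open>At \<open>n = 1\<close> the product over \<open>i < 1\<close> has a single
      term, at the product of \<open>g\<close> and \<open>h\<close>, with exponent -1. The last term
      \<open>f [g]\<close> has exponent \<open>(-1)^2 = 1\<close>.\<close>
    have "cochain_diff G A (Suc 0) f [g, h]
        = act A g (f [h]) \<otimes>\<^bsub>A\<^esub> inv\<^bsub>A\<^esub> (f [g \<otimes>\<^bsub>G\<^esub> h]) \<otimes>\<^bsub>A\<^esub> f [g]"
      using g c by (simp add: cochain_diff_def tuples_2 image_iff lessThan_Suc A.int_pow_neg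
        A.int_pow_1 gmoduleD(4)[OF A])
    also have "\<dots> = (f [g] \<otimes>\<^bsub>A\<^esub> act A g (f [h])) \<otimes>\<^bsub>A\<^esub> inv\<^bsub>A\<^esub> (f [g \<otimes>\<^bsub>G\<^esub> h])"
      using g c by (simp add: A.m_ac gmoduleD(4)[OF A])
    finally show ?thesis using g c by (auto simp add: A.quotient_eq_iff gmoduleD(4)[OF A])
  qed
  have ext: "cochain_diff G A (Suc 0) f = (\<lambda>x\<in>tuples (carrier G) (Suc (Suc 0)). \<one>\<^bsub>A\<^esub>)
      \<longleftrightarrow> (\<forall>g\<in>carrier G. \<forall>h\<in>carrier G. cochain_diff G A (Suc 0) f [g, h] = \<one>\<^bsub>A\<^esub>)" for f
  proof
    assume eq: "cochain_diff G A (Suc 0) f = (\<lambda>x\<in>tuples (carrier G) (Suc (Suc 0)). \<one>\<^bsub>A\<^esub>)"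
    show "\<forall>g\<in>carrier G. \<forall>h\<in>carrier G. cochain_diff G A (Suc 0) f [g, h] = \<one>\<^bsub>A\<^esub>"
      unfolding eq by (auto simp: tuples_2)
  next
    assume eq: "\<forall>g\<in>carrier G. \<forall>h\<in>carrier G. cochain_diff G A (Suc 0) f [g, h] = \<one>\<^bsub>A\<^esub>"
    show "cochain_diff G A (Suc 0) f = (\<lambda>x\<in>tuples (carrier G) (Suc (Suc 0)). \<one>\<^bsub>A\<^esub>)"
    proof (rule extensionalityI)
      show "cochain_diff G A (Suc 0) f \<in> extensional (tuples (carrier G) (Suc (Suc 0)))"
        by (simp add: cochain_diff_def)
    qed (use eq in \<open>auto simp: tuples_2\<close>)
  qed
  show ?thesis
    unfolding kernel_def crossed_homs_def using * by (auto simp: cochains_def ext)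
qed

lemma principal_crossed_homs_eq_coboundaries:
  assumes A: "gmodule G A"
  shows "coboundaries (cochains G A) (cochain_diff G A) (Suc 0) = principal_crossed_homs G A"
proof -
  interpret A: comm_group A by (rule gmoduleD(1)[OF A])
  \<comment> \<open>At \<open>n = 0\<close> the middle product is empty, \<open>tl\<close> and
    \<open>butlast\<close> of a one-element list are both \<open>[]\<close>, and the last exponent
    is -1. A 0-cochain amounts to its value at \<open>[]\<close>.\<close>
  have *: "cochain_diff G A 0 f = (\<lambda>xs\<in>tuples (carrier G) (Suc 0). act A (hd xs) (f []) \<otimes>\<^bsub>A\<^esub> inv\<^bsub>A\<^esub> (f []))"
    if f: "f [] \<in> carrier A" for f
    unfolding cochain_diff_def
    by (rule restrict_ext) (use f in \<open>auto simp: tuples_1 A.int_pow_neg A.int_pow_1 gmoduleD(4)[OF A]\<close>)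
  show ?thesis
  proof
    show "coboundaries (cochains G A) (cochain_diff G A) (Suc 0) \<subseteq> principal_crossed_homs G A"
    proof
      fix c assume "c \<in> coboundaries (cochains G A) (cochain_diff G A) (Suc 0)"
      then obtain f where "f \<in> carrier (cochains G A 0)" and f2: "c = cochain_diff G A 0 f"
        by (auto simp: coboundaries_def)
      then have f1: "f [] \<in> carrier A" by (auto simp: cochains_def tuples_0)
      show "c \<in> principal_crossed_homs G A"
        unfolding f2 *[of f, OF f1] principal_crossed_homs_def
        using f1 by (auto simp: tuples_1 gmoduleD(4)[OF A])
    qed
    show "principal_crossed_homs G A \<subseteq> coboundaries (cochains G A) (cochain_diff G A) (Suc 0)"
    proof
      fix c assume c: "c \<in> principal_crossed_homs G A"
      then obtain m where m: "m \<in> carrier A"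
          "\<And>g. g \<in> carrier G \<Longrightarrow> c [g] = act A g m \<otimes>\<^bsub>A\<^esub> inv\<^bsub>A\<^esub> m"
        by (auto simp: principal_crossed_homs_def)
      let ?f = "\<lambda>xs\<in>tuples (carrier G) 0. m"
      have "c = cochain_diff G A 0 ?f"
      proof (rule extensionalityI)
        show "c \<in> extensional (tuples (carrier G) (Suc 0))"
          using c by (auto simp: principal_crossed_homs_def PiE_def)
        show "cochain_diff G A 0 ?f \<in> extensional (tuples (carrier G) (Suc 0))"
          by (simp add: cochain_diff_def)
        fix xs assume xs: "xs \<in> tuples (carrier G) (Suc 0)"
        then show "c xs = cochain_diff G A 0 ?f xs"
          using m(1) by (subst *) (auto simp: tuples_0 tuples_1 m(2))
      qed
      moreover have "?f \<in> carrier (cochains G A 0)" using m by (auto simp: cochains_def)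
      ultimately show "c \<in> coboundaries (cochains G A) (cochain_diff G A) (Suc 0)"
        unfolding coboundaries_def by simp
    qed
  qed
qed

lemma subgroup_principal_crossed_homs:
  assumes A: "gmodule G A"
  shows "subgroup (principal_crossed_homs G A) (product_group (tuples (carrier G) (Suc 0)) (\<lambda>_. A))"
proof (rule subgroup_product_groupI)
  interpret A: comm_group A by (rule gmoduleD(1)[OF A])
  show "group A" by (rule A.is_group)
  show "principal_crossed_homs G A \<subseteq> tuples (carrier G) (Suc 0) \<rightarrow>\<^sub>E carrier A"
    by (auto simp: principal_crossed_homs_def)
  have "(\<lambda>x\<in>tuples (carrier G) (Suc 0). \<one>\<^bsub>A\<^esub>) \<in> principal_crossed_homs G A"
    by (auto simp: principal_crossed_homs_def tuples_1 gmodule_act_one_inv[OF A] intro!: bexI[of _ "\<one>\<^bsub>A\<^esub>"])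
  then show "principal_crossed_homs G A \<noteq> {}" by blast
  fix c c' assume c: "c \<in> principal_crossed_homs G A" "c' \<in> principal_crossed_homs G A"
  obtain m where m: "m \<in> carrier A" "\<And>g. g \<in> carrier G \<Longrightarrow> c [g] = act A g m \<otimes>\<^bsub>A\<^esub> inv\<^bsub>A\<^esub> m"
    using c(1) by (auto simp: principal_crossed_homs_def)
  obtain m' where m': "m' \<in> carrier A" "\<And>g. g \<in> carrier G \<Longrightarrow> c' [g] = act A g m' \<otimes>\<^bsub>A\<^esub> inv\<^bsub>A\<^esub> m'"
    using c(2) by (auto simp: principal_crossed_homs_def)
  show "(\<lambda>x\<in>tuples (carrier G) (Suc 0). c x \<otimes>\<^bsub>A\<^esub> inv\<^bsub>A\<^esub> c' x) \<in> principal_crossed_homs G A"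
    using m(1) m'(1) unfolding principal_crossed_homs_def
    by (auto simp: tuples_1 m(2) m'(2) gmoduleD(4,5)[OF A] gmodule_act_one_inv[OF A] A.inv_mult A.m_ac
        intro!: bexI[of _ "m \<otimes>\<^bsub>A\<^esub> inv\<^bsub>A\<^esub> m'"])
qed

lemma subgroup_crossed_homs:
  assumes G: "group G" and A: "gmodule G A"
  shows "subgroup (crossed_homs G A) (product_group (tuples (carrier G) (Suc 0)) (\<lambda>_. A))"
proof (rule subgroup_product_groupI)
  interpret G: group G by fact
  interpret A: comm_group A by (rule gmoduleD(1)[OF A])
  show "group A" by (rule A.is_group)
  show "crossed_homs G A \<subseteq> tuples (carrier G) (Suc 0) \<rightarrow>\<^sub>E carrier A"
    by (auto simp: crossed_homs_def)
  have "(\<lambda>x\<in>tuples (carrier G) (Suc 0). \<one>\<^bsub>A\<^esub>) \<in> crossed_homs G A"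
    by (auto simp: crossed_homs_def tuples_1 gmodule_act_one_inv[OF A])
  then show "crossed_homs G A \<noteq> {}" by blast
  fix c c' assume c: "c \<in> crossed_homs G A" "c' \<in> crossed_homs G A"
  note cD = crossed_homsD(1,3)[OF c(1)] crossed_homsD(1,3)[OF c(2)]
  show "(\<lambda>x\<in>tuples (carrier G) (Suc 0). c x \<otimes>\<^bsub>A\<^esub> inv\<^bsub>A\<^esub> c' x) \<in> crossed_homs G A"
    by (auto simp: crossed_homs_def tuples_1 cD gmoduleD(4,5)[OF A] gmodule_act_one_inv[OF A]
        A.mult_quotient)
qed

section \<open>Cocycles whose class vanishes on \<open>H\<close>, and the kernel of
  restriction\<close>

definition crossed_homs_principal_on ::
    "'g set \<Rightarrow> ('g, 'b) monoid_scheme \<Rightarrow> ('g, 'a) gmod \<Rightarrow> ('g list \<Rightarrow> 'a) set" where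
  "crossed_homs_principal_on H G A = {c \<in> crossed_homs G A.
     restrict c (tuples H (Suc 0)) \<in> principal_crossed_homs (G\<lparr>carrier := H\<rparr>) A}"

lemma principal_crossed_homs_restrict:
  assumes H: "subgroup H G" and c: "c \<in> principal_crossed_homs G A"
  shows "restrict c (tuples H (Suc 0)) \<in> principal_crossed_homs (G\<lparr>carrier := H\<rparr>) A"
proof -
  have HG: "h \<in> carrier G" if "h \<in> H" for h using subgroup.subset[OF H] that by blast
  obtain m where m: "m \<in> carrier A" "\<And>g. g \<in> carrier G \<Longrightarrow> c [g] = act A g m \<otimes>\<^bsub>A\<^esub> inv\<^bsub>A\<^esub> m"
    using c by (auto simp: principal_crossed_homs_def)
  have "restrict c (tuples H (Suc 0)) [h] = act A h m \<otimes>\<^bsub>A\<^esub> inv\<^bsub>A\<^esub> m" if "h \<in> H" for h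
    using m(2)[OF HG[OF that]] that by (simp add: tuples_1)
  moreover have "restrict c (tuples H (Suc 0)) \<in> tuples H (Suc 0) \<rightarrow>\<^sub>E carrier A"
    using c HG by (auto simp: principal_crossed_homs_def tuples_1)
  ultimately show ?thesis using m(1) by (auto simp: principal_crossed_homs_def)
qed

text \<open>Telescoping: \<open>gm - m\<close> plus \<open>g(hm - m)\<close> is
  \<open>(gh)m - m\<close>.\<close>

lemma principal_crossed_homs_subset:
  assumes G: "group G" and A: "gmodule G A"
  shows "principal_crossed_homs G A \<subseteq> crossed_homs G A"
proof
  interpret G: group G by fact
  interpret A: comm_group A by (rule gmoduleD(1)[OF A])
  fix c assume c: "c \<in> principal_crossed_homs G A"
  then obtain m where m: "m \<in> carrier A" "\<And>g. g \<in> carrier G \<Longrightarrow> c [g] = act A g m \<otimes>\<^bsub>A\<^esub> inv\<^bsub>A\<^esub> m"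
    by (auto simp: principal_crossed_homs_def)
  have "c [g \<otimes>\<^bsub>G\<^esub> h] = c [g] \<otimes>\<^bsub>A\<^esub> act A g (c [h])" if g: "g \<in> carrier G" "h \<in> carrier G" for g h
  proof -
    have "c [g] \<otimes>\<^bsub>A\<^esub> act A g (c [h])
        = act A g (act A h m) \<otimes>\<^bsub>A\<^esub> inv\<^bsub>A\<^esub> m"
      using g m(1) by (simp add: m(2) gmoduleD(4,5)[OF A] gmodule_act_one_inv[OF A] A.m_ac A.cancel_left)
    then show ?thesis using g m(1) by (simp add: m(2) gmoduleD(4,7)[OF A])
  qed
  then show "c \<in> crossed_homs G A"
    using c by (auto simp: principal_crossed_homs_def crossed_homs_def)
qed

lemma principal_crossed_homs_subset_principal_on:
  assumes G: "group G" and H: "subgroup H G" and A: "gmodule G A"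
  shows "principal_crossed_homs G A \<subseteq> crossed_homs_principal_on H G A"
  using principal_crossed_homs_subset[OF G A] principal_crossed_homs_restrict[OF H]
  by (auto simp: crossed_homs_principal_on_def)

lemma subgroup_crossed_homs_principal_on:
  assumes G: "group G" and H: "subgroup H G" and A: "gmodule G A"
  shows "subgroup (crossed_homs_principal_on H G A) (product_group (tuples (carrier G) (Suc 0)) (\<lambda>_. A))"
proof (rule subgroup_product_groupI)
  let ?T = "tuples (carrier G) (Suc 0)" and ?U = "tuples H (Suc 0)"
  interpret A: comm_group A by (rule gmoduleD(1)[OF A])
  interpret U: group "product_group ?U (\<lambda>_. A)" by simp
  show "group A" by (rule A.is_group)
  show "crossed_homs_principal_on H G A \<subseteq> ?T \<rightarrow>\<^sub>E carrier A"
    by (auto simp: crossed_homs_principal_on_def crossed_homs_def)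
  show "crossed_homs_principal_on H G A \<noteq> {}"
    using principal_crossed_homs_subset_principal_on[OF G H A]
      subgroup.one_closed[OF subgroup_principal_crossed_homs[OF A]] by blast
  fix c c' assume c: "c \<in> crossed_homs_principal_on H G A" "c' \<in> crossed_homs_principal_on H G A"
  have HG: "?U \<subseteq> ?T" using subgroup.subset[OF H] by (auto simp: tuples_1)
  note P = subgroup_principal_crossed_homs[OF gmodule_subgroup[OF A H], simplified]
  have 1: "(\<lambda>x\<in>?T. c x \<otimes>\<^bsub>A\<^esub> inv\<^bsub>A\<^esub> c' x) \<in> crossed_homs G A"
    by (rule subgroup_product_groupD[OF A.is_group subgroup_crossed_homs[OF G A]])
      (use c in \<open>simp_all add: crossed_homs_principal_on_def\<close>)
  have 2: "(\<lambda>x\<in>?U. restrict c ?U x \<otimes>\<^bsub>A\<^esub> inv\<^bsub>A\<^esub> restrict c' ?U x)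
      \<in> principal_crossed_homs (G\<lparr>carrier := H\<rparr>) A"
    by (rule subgroup_product_groupD[OF A.is_group P, of "restrict c ?U" "restrict c' ?U"])
      (use c in \<open>simp_all add: crossed_homs_principal_on_def\<close>)
  have "restrict (\<lambda>x\<in>?T. c x \<otimes>\<^bsub>A\<^esub> inv\<^bsub>A\<^esub> c' x) ?U
      = (\<lambda>x\<in>?U. restrict c ?U x \<otimes>\<^bsub>A\<^esub> inv\<^bsub>A\<^esub> restrict c' ?U x)"
    using HG by (auto simp: restrict_def fun_eq_iff)
  then show "(\<lambda>x\<in>?T. c x \<otimes>\<^bsub>A\<^esub> inv\<^bsub>A\<^esub> c' x) \<in> crossed_homs_principal_on H G A"
    using 1 2 by (simp add: crossed_homs_principal_on_def)
qed

text \<open>\<open>the_elem\<close> is meaningful only if all representatives of a class restrict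
  into one coset. They differ by principal crossed homomorphisms, whose restrictions are principal
  over \<open>H\<close>.\<close>

lemma restriction_map_coset:
  assumes G: "group G" and H: "subgroup H G" and A: "gmodule G A" and c: "c \<in> crossed_homs G A"
  shows "restriction_map G H A (Suc 0) (principal_crossed_homs G A #>\<^bsub>cochains G A (Suc 0)\<^esub> c)
    = principal_crossed_homs (G\<lparr>carrier := H\<rparr>) A
        #>\<^bsub>cochains (G\<lparr>carrier := H\<rparr>) A (Suc 0)\<^esub> restrict c (tuples H (Suc 0))"
    (is "_ = ?B #>\<^bsub>?K\<^esub> ?r c")
proof -
  let ?T = "tuples (carrier G) (Suc 0)" and ?U = "tuples H (Suc 0)"
  interpret A: comm_group A by (rule gmoduleD(1)[OF A])
  interpret K: group ?K by (simp add: cochains_def)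
  have HG: "?U \<subseteq> ?T" using subgroup.subset[OF H] by (auto simp: tuples_1)
  have B: "subgroup ?B ?K"
    using subgroup_principal_crossed_homs[OF gmodule_subgroup[OF A H]] by (simp add: cochains_def)
  have rc: "?r c \<in> carrier ?K"
    using crossed_homsD(1)[OF c] subgroup.subset[OF H] by (auto simp: cochains_def tuples_1)
  have "?B #>\<^bsub>?K\<^esub> ?r f = ?B #>\<^bsub>?K\<^esub> ?r c"
    if f: "f \<in> principal_crossed_homs G A #>\<^bsub>cochains G A (Suc 0)\<^esub> c" for f
  proof -
    obtain b where b: "b \<in> principal_crossed_homs G A" "f = b \<otimes>\<^bsub>cochains G A (Suc 0)\<^esub> c"
      using f unfolding r_coset_def by blast
    have rb: "?r b \<in> ?B" by (rule principal_crossed_homs_restrict[OF H b(1)])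
    then have rb': "?r b \<in> carrier ?K" using subgroup.subset[OF B] by blast
    have "?r f = ?r b \<otimes>\<^bsub>?K\<^esub> ?r c"
      using HG by (auto simp: b(2) cochains_def restrict_def fun_eq_iff)
    then show ?thesis
      using K.coset_mult_assoc[OF subgroup.subset[OF B] rb' rc] K.coset_join2[OF rb' B rb] by simp
  qed
  \<comment> \<open>The class is nonempty, so the set of restricted cosets is a singleton and not
    empty.\<close>
  moreover have "c \<in> principal_crossed_homs G A #>\<^bsub>cochains G A (Suc 0)\<^esub> c"
  proof -
    have "c \<in> carrier (cochains G A (Suc 0))"
      using c by (auto simp: crossed_homs_def cochains_def)
    then show ?thesis
      by (intro group.rcos_self) (simp_all add: cochains_def subgroup_principal_crossed_homs[OF A])
  qed
  ultimately have "(\<lambda>f. ?B #>\<^bsub>?K\<^esub> ?r f) ` (principal_crossed_homs G A #>\<^bsub>cochains G A (Suc 0)\<^esub> c)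
      = {?B #>\<^bsub>?K\<^esub> ?r c}" by blast
  then show ?thesis
    unfolding restriction_map_def Let_def
      principal_crossed_homs_eq_coboundaries[OF gmodule_subgroup[OF A H]] by (simp only: the_elem_eq)
qed

lemma group_cohomology_1:
  assumes "group G" "gmodule G A"
  shows "group_cohomology G A (Suc 0)
    = (cochains G A (Suc 0))\<lparr>carrier := crossed_homs G A\<rparr> Mod principal_crossed_homs G A"
  unfolding group_cohomology_def cohomology_def crossed_homs_eq_kernel[OF assms]
    principal_crossed_homs_eq_coboundaries[OF assms(2)] ..

text \<open>An equality of groups and not only an isomorphism: the kernel consists of the cosets of
  the cocycles that become principal on \<open>H\<close>, and multiplication of cosets does not look
  at the carrier of the ambient group.\<close>

lemma restriction_kernel_1:
  fixes A :: "('g, 'a) gmod"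
  assumes G: "group G" and H: "subgroup H G" and A: "gmodule G A"
  shows "restriction_kernel G H A (Suc 0)
    = (product_group (tuples (carrier G) (Suc 0)) (\<lambda>_. A))\<lparr>carrier := crossed_homs_principal_on H G A\<rparr>
        Mod principal_crossed_homs G A"
proof -
  let ?K = "G\<lparr>carrier := H\<rparr>" and ?N = "principal_crossed_homs G A"
  let ?B = "principal_crossed_homs ?K A"
  interpret A: comm_group A by (rule gmoduleD(1)[OF A])
  interpret K: group "cochains ?K A (Suc 0)" by (simp add: cochains_def)
  have B: "subgroup ?B (cochains ?K A (Suc 0))"
    using subgroup_principal_crossed_homs[OF gmodule_subgroup[OF A H]] by (simp add: cochains_def)
  have r: "restrict c (tuples H (Suc 0)) \<in> carrier (cochains ?K A (Suc 0))"
    if "c \<in> crossed_homs G A" for c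
    using crossed_homsD(1)[OF that] subgroup.subset[OF H] by (auto simp: cochains_def tuples_1)
  have one: "\<one>\<^bsub>group_cohomology ?K A (Suc 0)\<^esub> = ?B"
    by (simp add: group_cohomology_1[OF subgroup.subgroup_is_group[OF H G] gmodule_subgroup[OF A H]])
  have "kernel (group_cohomology G A (Suc 0)) (group_cohomology ?K A (Suc 0)) (restriction_map G H A (Suc 0))
    = (\<lambda>c. ?N #>\<^bsub>cochains G A (Suc 0)\<^esub> c) ` crossed_homs_principal_on H G A"
  proof -
    have "restriction_map G H A (Suc 0) (?N #>\<^bsub>cochains G A (Suc 0)\<^esub> c) = ?B
        \<longleftrightarrow> restrict c (tuples H (Suc 0)) \<in> ?B" if c: "c \<in> crossed_homs G A" for c
      unfolding restriction_map_coset[OF G H A c]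
      using K.coset_join1[OF _ r[OF c] B] K.coset_join2[OF r[OF c] B] subgroup.subset[OF B] by blast
    then show ?thesis
      unfolding kernel_def one by (auto simp: group_cohomology_1[OF G A] carrier_FactGroup
          crossed_homs_principal_on_def)
  qed
  moreover have "(<#>\<^bsub>K\<lparr>carrier := S\<rparr>\<^esub>) = (<#>\<^bsub>K\<^esub>)" for K :: "('g list \<Rightarrow> 'a) monoid" and S
    by (simp add: set_mult_def fun_eq_iff)
  ultimately show ?thesis
    by (simp add: restriction_kernel_def FactGroup_def group_cohomology_1[OF G A] RCOSETS_def cochains_def
        UNION_singleton_eq_range)
qed

text \<open>The extension of the integers by \<open>M\<close> with class \<open>c\<close>; it splits over \<open>H\<close> when \<open>c\<close> is
  principal on \<open>H\<close>.\<close>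

definition twisted_sum ::
    "('g, 'm) gmod \<Rightarrow> ('g list \<Rightarrow> 'm) \<Rightarrow> ('g, 'm \<times> int) gmod" where
  "twisted_sum M c = with_act (M \<times>\<times> integer_group)
     (\<lambda>g (m, k). (act M g m \<otimes>\<^bsub>M\<^esub> c [g] [^]\<^bsub>M\<^esub> k, k))"

lemma twisted_sum_simps:
  "carrier (twisted_sum M c) = carrier M \<times> UNIV"
  "(m, k) \<otimes>\<^bsub>twisted_sum M c\<^esub> (m', k') = (m \<otimes>\<^bsub>M\<^esub> m', k + k')"
  "\<one>\<^bsub>twisted_sum M c\<^esub> = (\<one>\<^bsub>M\<^esub>, 0)"
  "act (twisted_sum M c) g (m, k) = (act M g m \<otimes>\<^bsub>M\<^esub> c [g] [^]\<^bsub>M\<^esub> k, k)"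
  by (simp_all add: twisted_sum_def with_act_def)

lemma trivial_int_module_simps:
  "carrier trivial_int_module = UNIV" "x \<otimes>\<^bsub>trivial_int_module\<^esub> y = x + y"
  "\<one>\<^bsub>trivial_int_module\<^esub> = 0" "act trivial_int_module g x = x"
  by (simp_all add: trivial_int_module_def with_act_def)

lemma gmodule_act_int_pow:
  assumes M: "gmodule G M" and "g \<in> carrier G" "x \<in> carrier M"
  shows "act M g (x [^]\<^bsub>M\<^esub> (k::int)) = act M g x [^]\<^bsub>M\<^esub> k"
  using hom_int_pow[OF gmoduleD(3)[OF M assms(2)] assms(3) gmoduleD(2,2)[OF M]] .

lemma crossed_homs_one:
  assumes G: "group G" and A: "gmodule G A" and c: "c \<in> crossed_homs G A"
  shows "c [\<one>\<^bsub>G\<^esub>] = \<one>\<^bsub>A\<^esub>"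
proof -
  interpret G: group G by fact
  interpret A: comm_group A by (rule gmoduleD(1)[OF A])
  have "c [\<one>\<^bsub>G\<^esub>] \<otimes>\<^bsub>A\<^esub> c [\<one>\<^bsub>G\<^esub>] = c [\<one>\<^bsub>G\<^esub>]"
    using crossed_homsD(3)[OF c G.one_closed G.one_closed] crossed_homsD(1)[OF c G.one_closed]
    by (simp add: gmoduleD(6)[OF A])
  then show ?thesis using crossed_homsD(1)[OF c G.one_closed] A.l_cancel_one by blast
qed

text \<open>Compatibility of the action with products is the cocycle identity:
  \<open>g(h(m, k))\<close> and \<open>(gh)(m, k)\<close> have first components
  \<open>ghm + k g c(h) + k c(g)\<close> and \<open>ghm + k c(gh)\<close>. The unit acts trivially
  because \<open>c\<close> vanishes at it.\<close>

lemma gmodule_twisted_sum: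
  assumes G: "group G" and M: "gmodule G M" and c: "c \<in> crossed_homs G M"
  shows "gmodule G (twisted_sum M c)"
proof -
  interpret G: group G by fact
  interpret M: comm_group M by (rule gmoduleD(1)[OF M])
  note cD = crossed_homsD(1,3)[OF c]
  show ?thesis
    unfolding gmodule_def
  proof (intro conjI ballI)
    show "comm_group (twisted_sum M c)"
    proof (rule comm_groupI)
      fix x assume "x \<in> carrier (twisted_sum M c)"
      then show "\<exists>y\<in>carrier (twisted_sum M c). y \<otimes>\<^bsub>twisted_sum M c\<^esub> x = \<one>\<^bsub>twisted_sum M c\<^esub>"
        by (intro bexI[of _ "(inv\<^bsub>M\<^esub> (fst x), - snd x)"]) (auto simp: twisted_sum_simps)
    qed (auto simp: twisted_sum_simps M.m_ac)
  next
    fix g assume g: "g \<in> carrier G"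
    show "act (twisted_sum M c) g \<in> hom (twisted_sum M c) (twisted_sum M c)"
      using g by (auto simp: hom_def twisted_sum_simps cD gmoduleD(4,5)[OF M] M.int_pow_mult M.m_ac)
  next
    fix x assume "x \<in> carrier (twisted_sum M c)"
    then show "act (twisted_sum M c) \<one>\<^bsub>G\<^esub> x = x"
      by (auto simp: twisted_sum_simps gmoduleD(6)[OF M] crossed_homs_one[OF G M c])
  next
    fix g h x assume "g \<in> carrier G" "h \<in> carrier G" "x \<in> carrier (twisted_sum M c)"
    then show "act (twisted_sum M c) (g \<otimes>\<^bsub>G\<^esub> h) x
        = act (twisted_sum M c) g (act (twisted_sum M c) h x)"
      by (auto simp: twisted_sum_simps cD gmoduleD(4,5,7)[OF M] gmodule_act_int_pow[OF M]
          M.int_pow_distrib M.m_ac)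
  qed
qed

section \<open>Crossed extensions and the case \<open>n = 1\<close>\<close>

context adamson_resolution
begin

lemma \<epsilon>_simps:
  "x \<in> carrier (P 0) \<Longrightarrow> y \<in> carrier (P 0) \<Longrightarrow> \<epsilon> (x \<otimes>\<^bsub>P 0\<^esub> y) = \<epsilon> x + \<epsilon> y"
  "g \<in> carrier G \<Longrightarrow> x \<in> carrier (P 0) \<Longrightarrow> \<epsilon> (act (P 0) g x) = \<epsilon> x"
  "y \<in> carrier (P (Suc 0)) \<Longrightarrow> \<epsilon> (d 0 y) = 0"
proof -
  show "y \<in> carrier (P (Suc 0)) \<Longrightarrow> \<epsilon> (d 0 y) = 0"
    using \<epsilon>_exact by (auto simp: kernel_def trivial_int_module_simps)
qed (simp_all add: ghomD(3,4)[OF \<epsilon>] trivial_int_module_simps)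

text \<open>A base point: an additive map killing the image of \<open>d 0\<close> will be determined
  by its value there.\<close>

lemma unit_vector:
  obtains p where "p \<in> carrier (P 0)" "\<epsilon> p = 1"
proof -
  have "1 \<in> \<epsilon> ` carrier (P 0)" unfolding \<epsilon>_onto by (simp add: trivial_int_module_simps)
  then show ?thesis using that by (metis imageE)
qed

text \<open>\<open>D\<close> kills the kernel of \<epsilon>, and
  \<open>p - \<epsilon>(p) p\<^sub>0\<close> lies in that kernel. \<open>D\<close> is merely
  additive, since it will be the failure of equivariance of another map, or the difference of two
  extensions of one cocycle.\<close>

lemma hom_factors_through_\<epsilon>:
  assumes M: "group M" and D: "D \<in> hom (P 0) M"
    and Dd: "\<And>y. y \<in> carrier (P (Suc 0)) \<Longrightarrow> D (d 0 y) = \<one>\<^bsub>M\<^esub>"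
    and p\<^sub>0: "p\<^sub>0 \<in> carrier (P 0)" "\<epsilon> p\<^sub>0 = 1" and p: "p \<in> carrier (P 0)"
  shows "D p = D p\<^sub>0 [^]\<^bsub>M\<^esub> \<epsilon> p"
proof -
  interpret P: comm_group "P 0" by (rule gmoduleD(1)[OF P])
  interpret M: group M by fact
  interpret D: group_hom "P 0" M D using D by unfold_locales
  interpret \<epsilon>: group_hom "P 0" integer_group \<epsilon>
    by (simp add: group_hom_def group_hom_axioms_def P.is_group hom_def \<epsilon>_simps)
  let ?k = "p \<otimes>\<^bsub>P 0\<^esub> inv\<^bsub>P 0\<^esub> (p\<^sub>0 [^]\<^bsub>P 0\<^esub> \<epsilon> p)"
  have "\<epsilon> (p\<^sub>0 [^]\<^bsub>P 0\<^esub> \<epsilon> p) = \<epsilon> p" using \<epsilon>.hom_int_pow[OF p\<^sub>0(1)] p\<^sub>0(2) by simp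
  then have "\<epsilon> (inv\<^bsub>P 0\<^esub> (p\<^sub>0 [^]\<^bsub>P 0\<^esub> \<epsilon> p)) = - \<epsilon> p" using \<epsilon>.hom_inv[OF P.int_pow_closed[OF p\<^sub>0(1)]] by simp
  then have "?k \<in> d 0 ` carrier (P (Suc 0))"
    using p p\<^sub>0 unfolding \<epsilon>_exact by (simp add: kernel_def trivial_int_module_simps \<epsilon>_simps)
  then have "D ?k = \<one>\<^bsub>M\<^esub>" using Dd by auto
  then have "D p = D (p\<^sub>0 [^]\<^bsub>P 0\<^esub> \<epsilon> p)" using p p\<^sub>0 by (simp add: M.quotient_eq_iff)
  then show ?thesis using D.hom_int_pow[OF p\<^sub>0(1)] by simp
qed

text \<open>The crossed homomorphism of a \<open>1\<close>-cocycle measures the failure of equivariance of an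
  extension of the cocycle to the projective module in degree \<open>0\<close>.\<close>

definition crossed_extension :: "('g, 'm) gmod \<Rightarrow> ('p \<Rightarrow> 'm) \<Rightarrow> ('g list \<Rightarrow> 'm) \<Rightarrow> bool" where
  "crossed_extension M F c \<longleftrightarrow> F \<in> hom (P 0) M
     \<and> (\<forall>g\<in>carrier G. \<forall>p\<in>carrier (P 0).
          F (act (P 0) g p) = act M g (F p) \<otimes>\<^bsub>M\<^esub> c [g] [^]\<^bsub>M\<^esub> \<epsilon> p)"

lemma crossed_extensionD:
  assumes "crossed_extension M F c"
  shows "F \<in> hom (P 0) M" "\<And>p. p \<in> carrier (P 0) \<Longrightarrow> F p \<in> carrier M"
    "\<And>p q. p \<in> carrier (P 0) \<Longrightarrow> q \<in> carrier (P 0) \<Longrightarrow> F (p \<otimes>\<^bsub>P 0\<^esub> q) = F p \<otimes>\<^bsub>M\<^esub> F q"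
    "\<And>g p. g \<in> carrier G \<Longrightarrow> p \<in> carrier (P 0)
       \<Longrightarrow> F (act (P 0) g p) = act M g (F p) \<otimes>\<^bsub>M\<^esub> c [g] [^]\<^bsub>M\<^esub> \<epsilon> p"
  using assms by (auto simp: crossed_extension_def hom_def)

text \<open>The correction term has exponent \<open>\<epsilon> p\<close>, which is 0 on the image of
  \<open>d 0\<close>. Composing with \<open>d 0\<close> therefore restores equivariance.\<close>

lemma cocycle_of_crossed_extension:
  assumes M: "gmodule G M" and F: "crossed_extension M F c" and c: "c \<in> crossed_homs G M"
  shows "(\<lambda>x\<in>carrier (P (Suc 0)). F (d 0 x)) \<in> adamson_cocycles G P d M 0"
proof -
  interpret M: comm_group M by (rule gmoduleD(1)[OF M])
  interpret F: group_hom "P 0" M F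
    using crossed_extensionD(1)[OF F] gmoduleD(2)[OF P] by (simp add: group_hom_def group_hom_axioms_def)
  have "(\<lambda>x. F (d 0 x)) \<in> ghom G (P (Suc 0)) M"
    by (rule ghomI) (simp_all add: ghomD[OF d] crossed_extensionD[OF F] \<epsilon>_simps gmoduleD(4)[OF M])
  then show ?thesis
    using ghom_restrict[OF P] by (auto simp: adamson_cocycles_def ghomD(2)[OF d] d_d)
qed

lemma crossed_extension_of_cocycle:
  assumes M: "gmodule G M" and f: "f \<in> adamson_cocycles G P d M 0"
  obtains F c where "crossed_extension M F c" "c \<in> crossed_homs_principal_on H G M"
    "\<And>x. x \<in> carrier (P (Suc 0)) \<Longrightarrow> f x = F (d 0 x)"
proof -
  interpret M: comm_group M by (rule gmoduleD(1)[OF M])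
  have f': "f \<in> ghom G (P (Suc 0)) M" "\<And>x. x \<in> carrier (P (Suc (Suc 0))) \<Longrightarrow> f (d (Suc 0) x) = \<one>\<^bsub>M\<^esub>"
    using f by (auto simp: adamson_cocycles_def)
  obtain F where F: "F \<in> ghom Hg (P 0) M" "\<And>x. x \<in> carrier (P (Suc 0)) \<Longrightarrow> F (d 0 x) = f x"
    using equivariant_extension[OF gmodule_subgroup[OF M H] ghom_subgroup[OF f'(1) H] f'(2)] by blast
  obtain p\<^sub>0 where p\<^sub>0: "p\<^sub>0 \<in> carrier (P 0)" "\<epsilon> p\<^sub>0 = 1" by (rule unit_vector)
  \<comment> \<open>The failure of equivariance at \<open>p\<^sub>0\<close>, where \<epsilon> has
    the value 1, is the only candidate for \<open>c\<close>.\<close>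
  define c where "c = (\<lambda>xs\<in>tuples (carrier G) (Suc 0).
    F (act (P 0) (hd xs) p\<^sub>0) \<otimes>\<^bsub>M\<^esub> inv\<^bsub>M\<^esub> (act M (hd xs) (F p\<^sub>0)))"
  have c: "c [g] = F (act (P 0) g p\<^sub>0) \<otimes>\<^bsub>M\<^esub> inv\<^bsub>M\<^esub> (act M g (F p\<^sub>0))" if "g \<in> carrier G" for g
    using that by (auto simp: c_def tuples_1)
  note Fc = ghomD(2)[OF F(1)]
  have c_closed: "c [g] \<in> carrier M" if "g \<in> carrier G" for g
    using that p\<^sub>0 by (simp add: c Fc gmoduleD(4)[OF M] gmoduleD(4)[OF P])
  have ext: "F (act (P 0) g p) = act M g (F p) \<otimes>\<^bsub>M\<^esub> c [g] [^]\<^bsub>M\<^esub> \<epsilon> p"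
    if g: "g \<in> carrier G" and p: "p \<in> carrier (P 0)" for g p
  proof -
    \<comment> \<open>For fixed \<open>g\<close> this map is additive, and it vanishes on the image
      of \<open>d 0\<close> because \<open>f\<close> is equivariant over \<open>G\<close>. Hence it
      is \<epsilon> times its value at \<open>p\<^sub>0\<close>.\<close>
    let ?D = "\<lambda>p. F (act (P 0) g p) \<otimes>\<^bsub>M\<^esub> inv\<^bsub>M\<^esub> (act M g (F p))"
    have "?D \<in> hom (P 0) M"
      using g by (auto simp: hom_def ghomD(2,3)[OF F(1)] gmoduleD(4,5)[OF M] gmoduleD(4,5)[OF P] M.mult_quotient)
    moreover have "?D (d 0 y) = \<one>\<^bsub>M\<^esub>" if "y \<in> carrier (P (Suc 0))" for y
      using ghomD(4)[OF d g that, symmetric] ghomD(4)[OF f'(1) g that] g that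
      by (simp add: F(2) gmoduleD(4)[OF P] gmoduleD(4)[OF M] ghomD(2)[OF f'(1)])
    ultimately have "?D p = ?D p\<^sub>0 [^]\<^bsub>M\<^esub> \<epsilon> p"
      by (rule hom_factors_through_\<epsilon>[OF M.is_group _ _ p\<^sub>0 p])
    then have "?D p = c [g] [^]\<^bsub>M\<^esub> \<epsilon> p" using c[OF g] by simp
    then show ?thesis
      using g p c_closed[OF g]
      by (simp add: M.quotient_eq_iff Fc gmoduleD(4)[OF M] gmoduleD(4)[OF P] M.m_comm)
  qed
  have "F \<in> hom (P 0) M" by (rule ghomD(1)[OF F(1)])
  then have 1: "crossed_extension M F c" using ext by (simp add: crossed_extension_def)
  \<comment> \<open>The cocycle identity compares two computations of \<open>F\<close> at
    \<open>(gh) p\<^sub>0\<close>: once directly, and once by moving \<open>g\<close> and then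
    \<open>h\<close> out of \<open>F\<close>.\<close>
  have "c [g \<otimes>\<^bsub>G\<^esub> h] = c [g] \<otimes>\<^bsub>M\<^esub> act M g (c [h])" if gh: "g \<in> carrier G" "h \<in> carrier G" for g h
  proof -
    have "F (act (P 0) (g \<otimes>\<^bsub>G\<^esub> h) p\<^sub>0) = act M g (act M h (F p\<^sub>0) \<otimes>\<^bsub>M\<^esub> c [h]) \<otimes>\<^bsub>M\<^esub> c [g]"
      using gh p\<^sub>0 c_closed by (simp add: gmoduleD(4,7)[OF P] ext \<epsilon>_simps Fc gmoduleD(4)[OF M])
    also have "\<dots> = (c [g] \<otimes>\<^bsub>M\<^esub> act M g (c [h])) \<otimes>\<^bsub>M\<^esub> act M (g \<otimes>\<^bsub>G\<^esub> h) (F p\<^sub>0)"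
      using gh p\<^sub>0 c_closed Fc by (simp add: gmoduleD(4,5,7)[OF M] M.m_ac)
    finally show ?thesis
      using gh p\<^sub>0 c_closed c[OF G.m_closed[OF gh]]
      by (simp add: M.quotient_eq_iff gmoduleD(4)[OF M] gmoduleD(4)[OF P] Fc)
  qed
  then have 2: "c \<in> crossed_homs G M"
    using c_closed by (auto simp: crossed_homs_def tuples_1 c_def[unfolded tuples_1])
  have "restrict c (tuples H (Suc 0)) \<in> principal_crossed_homs Hg M"
  proof -
    \<comment> \<open>\<open>F\<close> is equivariant over \<open>H\<close>, so \<open>c\<close> is
      not only principal but trivial there, and the unit is the witness.\<close>
    have "c [h] = \<one>\<^bsub>M\<^esub>" if "h \<in> H" for h
      using c[OF H_in_G[OF that]] ghomD(4)[OF F(1), of h p\<^sub>0] that p\<^sub>0 H_in_G[OF that]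
      by (simp add: gmoduleD(4)[OF M] Fc)
    then show ?thesis
      by (auto simp: principal_crossed_homs_def tuples_1 gmodule_act_one_inv[OF M] H_in_G
          intro!: bexI[of _ "\<one>\<^bsub>M\<^esub>"])
  qed
  then have "c \<in> crossed_homs_principal_on H G M"
    using 2 by (simp add: crossed_homs_principal_on_def)
  then show ?thesis using that[OF 1] F(2) by metis
qed

text \<open>Write a lift of \<epsilon> to the twisted sum as the pair
  \<open>(F, \<epsilon>)\<close>. Its equivariance for the twisted action is then the equation in
  \<open>crossed_extension M F c\<close>.\<close>

lemma crossed_extension_of_crossed_hom:
  assumes M: "gmodule G M" and c: "c \<in> crossed_homs_principal_on H G M"
  obtains F where "crossed_extension M F c"
proof -
  interpret M: comm_group M by (rule gmoduleD(1)[OF M])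
  have c': "c \<in> crossed_homs G M" using c by (simp add: crossed_homs_principal_on_def)
  let ?E = "twisted_sum M c"
  obtain m where m: "m \<in> carrier M" and "\<forall>h\<in>H. restrict c (tuples H (Suc 0)) [h] = act M h m \<otimes>\<^bsub>M\<^esub> inv\<^bsub>M\<^esub> m"
    using c by (auto simp: crossed_homs_principal_on_def principal_crossed_homs_def)
  then have cH: "c [h] = act M h m \<otimes>\<^bsub>M\<^esub> inv\<^bsub>M\<^esub> m" if "h \<in> H" for h
    using that by (simp add: tuples_1)
  have E: "gmodule G ?E" by (rule gmodule_twisted_sum[OF G M c'])
  have snd: "snd \<in> ghom G ?E trivial_int_module"
    by (rule ghomI) (auto simp: twisted_sum_simps trivial_int_module_simps)
  \<comment> \<open>With \<open>c(h) = hm - m\<close> on \<open>H\<close>, every \<open>h\<close>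
    fixes \<open>(-m, 1)\<close>, because \<open>-hm + c(h) = -m\<close>. The section sends
    \<open>k\<close> to the \<open>k\<close>-th multiple of this element.\<close>
  have s: "(\<lambda>k. (inv\<^bsub>M\<^esub> m [^]\<^bsub>M\<^esub> k, k)) \<in> ghom Hg trivial_int_module ?E"
  proof (rule ghomI)
    fix h and k :: int assume "h \<in> carrier Hg"
    then have h: "h \<in> H" "h \<in> carrier G" using H_in_G by auto
    have "act M h (inv\<^bsub>M\<^esub> m [^]\<^bsub>M\<^esub> k) \<otimes>\<^bsub>M\<^esub> c [h] [^]\<^bsub>M\<^esub> k
        = (inv\<^bsub>M\<^esub> (act M h m) \<otimes>\<^bsub>M\<^esub> (act M h m \<otimes>\<^bsub>M\<^esub> inv\<^bsub>M\<^esub> m)) [^]\<^bsub>M\<^esub> k"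
      using h m by (simp add: gmodule_act_int_pow[OF M] gmodule_act_one_inv[OF M] cH gmoduleD(4)[OF M]
          M.int_pow_distrib)
    then show "(inv\<^bsub>M\<^esub> m [^]\<^bsub>M\<^esub> act trivial_int_module h k, act trivial_int_module h k)
        = act ?E h (inv\<^bsub>M\<^esub> m [^]\<^bsub>M\<^esub> k, k)"
      using h m by (simp add: twisted_sum_simps trivial_int_module_simps M.cancel_left gmoduleD(4)[OF M])
  qed (simp_all add: twisted_sum_simps trivial_int_module_simps m M.int_pow_mult)
  have "direct_summand Hg ?E (kernel ?E (trivial_int_module :: ('g, int) gmod) snd)"
    by (rule direct_summand_of_section[OF gmodule_subgroup[OF E H] gmodule_subgroup[OF int_module H]
          ghom_subgroup[OF snd H] s]) simp
  moreover have "snd ` carrier ?E = carrier (trivial_int_module :: ('g, int) gmod)"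
    using m by (auto simp: twisted_sum_simps trivial_int_module_simps image_iff)
  ultimately have "rel_epi G H ?E snd trivial_int_module"
    using E int_module snd by (simp add: rel_epi_def)
  \<comment> \<open>The twisted sum lives on a type of pairs, in general not a type of the test
    modules in \<open>rel_projective\<close>; hence the lifting lemma in place of the
    definition.\<close>
  then obtain h where h: "h \<in> ghom G (P 0) ?E" "\<And>x. x \<in> carrier (P 0) \<Longrightarrow> snd (h x) = \<epsilon> x"
    using rel_projective_lift[OF G H proj _ \<epsilon>] by blast
  have h_eq: "h p = (fst (h p), \<epsilon> p)" if "p \<in> carrier (P 0)" for p
    using h(2)[OF that] by (metis prod.collapse)
  have "crossed_extension M (\<lambda>p. fst (h p)) c"
    unfolding crossed_extension_def
  proof (intro conjI ballI)
    show "(\<lambda>p. fst (h p)) \<in> hom (P 0) M"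
    proof (rule homI)
      fix p q assume p: "p \<in> carrier (P 0)" "q \<in> carrier (P 0)"
      show "fst (h p) \<in> carrier M" using ghomD(2)[OF h(1) p(1)] by (auto simp: twisted_sum_simps)
      show "fst (h (p \<otimes>\<^bsub>P 0\<^esub> q)) = fst (h p) \<otimes>\<^bsub>M\<^esub> fst (h q)"
        using ghomD(3)[OF h(1) p] h_eq[OF p(1)] h_eq[OF p(2)] by (metis fst_conv twisted_sum_simps(2))
    qed
    fix g p assume g: "g \<in> carrier G" and p: "p \<in> carrier (P 0)"
    show "fst (h (act (P 0) g p)) = act M g (fst (h p)) \<otimes>\<^bsub>M\<^esub> c [g] [^]\<^bsub>M\<^esub> \<epsilon> p"
      using ghomD(4)[OF h(1) g p] h_eq[OF p] by (metis fst_conv twisted_sum_simps(4))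
  qed
  then show ?thesis by (rule that)
qed

text \<open>An equivariant \<open>F'\<close> with the same composite with \<open>d 0\<close> differs
  from \<open>F\<close> by a map killing the image of \<open>d 0\<close>, that is by \<epsilon>
  times a constant \<open>m\<close>. Equivariance of \<open>F + \<epsilon> m\<close> then says
  \<open>c(g) = gm - m\<close>.\<close>

lemma coboundary_iff_principal:
  assumes M: "gmodule G M" and F: "crossed_extension M F c" and c: "c \<in> crossed_homs G M"
    and f: "f \<in> adamson_cocycles G P d M 0" "\<And>x. x \<in> carrier (P (Suc 0)) \<Longrightarrow> f x = F (d 0 x)"
  shows "f \<in> adamson_coboundaries G P d M 0 \<longleftrightarrow> c \<in> principal_crossed_homs G M"
proof
  interpret M: comm_group M by (rule gmoduleD(1)[OF M])
  note FD = crossed_extensionD[OF F]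
  note cD = crossed_homsD(1)[OF c]
  {
    assume "f \<in> adamson_coboundaries G P d M 0"
    then obtain F' where F': "F' \<in> ghom G (P 0) M"
        and fF': "\<And>x. x \<in> carrier (P (Suc 0)) \<Longrightarrow> f x = F' (d 0 x)"
      by (auto simp: adamson_coboundaries_def)
    obtain p\<^sub>0 where p\<^sub>0: "p\<^sub>0 \<in> carrier (P 0)" "\<epsilon> p\<^sub>0 = 1" by (rule unit_vector)
    \<comment> \<open>The value of this difference at \<open>p\<^sub>0\<close> is the witness
      \<open>m\<close> for principality.\<close>
    let ?D = "\<lambda>p. F' p \<otimes>\<^bsub>M\<^esub> inv\<^bsub>M\<^esub> F p"
    have D: "?D \<in> hom (P 0) M"
      by (auto simp: hom_def FD ghomD(2,3)[OF F'] M.mult_quotient)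
    have D0: "?D (d 0 y) = \<one>\<^bsub>M\<^esub>" if "y \<in> carrier (P (Suc 0))" for y
      using that fF'[OF that] f(2)[OF that] ghomD(2)[OF d that] by (simp add: FD ghomD(2)[OF F'])
    have "c [g] = act M g (?D p\<^sub>0) \<otimes>\<^bsub>M\<^esub> inv\<^bsub>M\<^esub> (?D p\<^sub>0)" if g: "g \<in> carrier G" for g
    proof -
      \<comment> \<open>\<epsilon> is 1 at \<open>g p\<^sub>0\<close> as well, so the difference
        takes the same value there. Expanding it with the equivariance of \<open>F'\<close> and the
        rule for \<open>F\<close> brings in \<open>c(g)\<close>.\<close>
      have "?D (act (P 0) g p\<^sub>0) = ?D p\<^sub>0 [^]\<^bsub>M\<^esub> \<epsilon> (act (P 0) g p\<^sub>0)"
        by (rule hom_factors_through_\<epsilon>[OF M.is_group D D0 p\<^sub>0]) (simp_all add: g p\<^sub>0 gmoduleD(4)[OF P])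
      then have "?D p\<^sub>0 = act M g (F' p\<^sub>0) \<otimes>\<^bsub>M\<^esub> inv\<^bsub>M\<^esub> (act M g (F p\<^sub>0) \<otimes>\<^bsub>M\<^esub> c [g])"
        using g p\<^sub>0 cD[OF g] by (simp add: \<epsilon>_simps FD ghomD(2,4)[OF F'])
      also have "\<dots> = act M g (?D p\<^sub>0) \<otimes>\<^bsub>M\<^esub> inv\<^bsub>M\<^esub> c [g]"
        using g p\<^sub>0 cD[OF g] by (simp add: FD ghomD(2)[OF F'] gmoduleD(4,5)[OF M] gmodule_act_one_inv[OF M]
            M.inv_mult M.m_ac)
      finally have eq: "?D p\<^sub>0 = act M g (?D p\<^sub>0) \<otimes>\<^bsub>M\<^esub> inv\<^bsub>M\<^esub> c [g]" .
      show ?thesis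
        by (rule M.quotient_swap[OF _ _ eq])
          (use g p\<^sub>0 cD[OF g] in \<open>simp_all add: FD(2) ghomD(2)[OF F'] gmoduleD(4)[OF M]\<close>)
    qed
    then show "c \<in> principal_crossed_homs G M"
      using c p\<^sub>0 unfolding principal_crossed_homs_def crossed_homs_def
      by (auto intro!: bexI[of _ "?D p\<^sub>0"] simp: FD(2) ghomD(2)[OF F'])
  }
  {
    assume "c \<in> principal_crossed_homs G M"
    then obtain m where m: "m \<in> carrier M" and cm: "\<And>g. g \<in> carrier G \<Longrightarrow> c [g] = act M g m \<otimes>\<^bsub>M\<^esub> inv\<^bsub>M\<^esub> m"
      by (auto simp: principal_crossed_homs_def)
    have "(\<lambda>p. F p \<otimes>\<^bsub>M\<^esub> m [^]\<^bsub>M\<^esub> \<epsilon> p) \<in> ghom G (P 0) M"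
    proof (rule ghomI)
      fix g p assume "g \<in> carrier G" "p \<in> carrier (P 0)"
      then show "F (act (P 0) g p) \<otimes>\<^bsub>M\<^esub> m [^]\<^bsub>M\<^esub> \<epsilon> (act (P 0) g p)
          = act M g (F p \<otimes>\<^bsub>M\<^esub> m [^]\<^bsub>M\<^esub> \<epsilon> p)"
        using m by (simp add: FD(2,4) \<epsilon>_simps cm gmoduleD(4,5)[OF M] gmodule_act_int_pow[OF M]
            M.int_pow_distrib M.int_pow_inv M.m_assoc)
    qed (simp_all add: FD(2,3) m \<epsilon>_simps M.int_pow_mult M.m_ac)
    then show "f \<in> adamson_coboundaries G P d M 0"
      using f FD(2) m by (auto simp: adamson_coboundaries_def adamson_cocycles_def ghomD(2)[OF d] \<epsilon>_simps
          intro!: bexI[of _ "\<lambda>p. F p \<otimes>\<^bsub>M\<^esub> m [^]\<^bsub>M\<^esub> \<epsilon> p"])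
  }
qed

theorem adamson_cohomology_1_iso:
  assumes M: "gmodule G M"
  shows "adamson_cohomology G P d M (Suc 0) \<cong> restriction_kernel G H M (Suc 0)"
proof -
  interpret M: comm_group M by (rule gmoduleD(1)[OF M])
  let ?Z = "adamson_cocycles G P d M 0" and ?Z' = "crossed_homs_principal_on H G M"
  let ?T = "carrier (P (Suc 0))" and ?T' = "tuples (carrier G) (Suc 0)"
  \<comment> \<open>\<open>F\<close> stays under the quantifier: whichever crossed extension links
    \<open>f\<close> and \<open>c\<close> will do.\<close>
  let ?R = "\<lambda>f c. f \<in> ?Z \<and> c \<in> ?Z' \<and> (\<exists>F. crossed_extension M F c \<and> (\<forall>x\<in>?T. f x = F (d 0 x)))"
  show ?thesis
    unfolding adamson_cohomology_Suc[OF M] restriction_kernel_1[OF G H M]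
  proof (rule function_quotient_iso[where R = ?R, OF M.comm_group_axioms M.comm_group_axioms
        subgroup_cocycles[OF M] subgroup_crossed_homs_principal_on[OF G H M]
        subgroup_coboundaries[OF M] subgroup_principal_crossed_homs[OF M]
        coboundaries_subset_cocycles[OF M] principal_crossed_homs_subset_principal_on[OF G H M]])
    fix f c assume "?R f c"
    then show "f \<in> ?Z \<and> c \<in> ?Z'" by blast
  next
    fix f c f' c' assume R: "?R f c" "?R f' c'"
    obtain F F' where F: "crossed_extension M F c" "\<And>x. x \<in> ?T \<Longrightarrow> f x = F (d 0 x)"
        "crossed_extension M F' c'" "\<And>x. x \<in> ?T \<Longrightarrow> f' x = F' (d 0 x)" using R by blast
    note FD = crossed_extensionD[OF F(1)] crossed_extensionD[OF F(3)]
    have c: "c [g] \<in> carrier M" "c' [g] \<in> carrier M" if "g \<in> carrier G" for g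
      using crossed_homsD(1) R that by (auto simp: crossed_homs_principal_on_def)
    have "crossed_extension M (\<lambda>p. F p \<otimes>\<^bsub>M\<^esub> inv\<^bsub>M\<^esub> F' p) (\<lambda>x\<in>?T'. c x \<otimes>\<^bsub>M\<^esub> inv\<^bsub>M\<^esub> c' x)"
      unfolding crossed_extension_def
      by (auto simp: hom_def FD M.mult_quotient tuples_1 c gmoduleD(4,5)[OF M] gmodule_act_one_inv[OF M]
          M.int_pow_distrib M.int_pow_inv)
    then show "?R (\<lambda>x\<in>?T. f x \<otimes>\<^bsub>M\<^esub> inv\<^bsub>M\<^esub> f' x) (\<lambda>x\<in>?T'. c x \<otimes>\<^bsub>M\<^esub> inv\<^bsub>M\<^esub> c' x)"
      using R subgroup_product_groupD[OF M.is_group subgroup_cocycles[OF M]]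
        subgroup_product_groupD[OF M.is_group subgroup_crossed_homs_principal_on[OF G H M]]
      by (auto simp: F(2,4) intro!: exI[of _ "\<lambda>p. F p \<otimes>\<^bsub>M\<^esub> inv\<^bsub>M\<^esub> F' p"])
  next
    fix f assume f: "f \<in> ?Z"
    then show "\<exists>c. ?R f c" by (metis crossed_extension_of_cocycle[OF M])
  next
    fix c assume c: "c \<in> ?Z'"
    then obtain F where F: "crossed_extension M F c" by (rule crossed_extension_of_crossed_hom[OF M])
    have "?R (\<lambda>x\<in>?T. F (d 0 x)) c"
      using cocycle_of_crossed_extension[OF M F] c F by (auto simp: crossed_homs_principal_on_def)
    then show "\<exists>f. ?R f c" by blast
  next
    fix f c assume R: "?R f c"
    then obtain F where F: "crossed_extension M F c" "\<And>x. x \<in> ?T \<Longrightarrow> f x = F (d 0 x)" by blast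
    show "f \<in> adamson_coboundaries G P d M 0 \<longleftrightarrow> c \<in> principal_crossed_homs G M"
      by (rule coboundary_iff_principal[OF M F(1) _ _ F(2)])
        (use R in \<open>auto simp: crossed_homs_principal_on_def\<close>)
  qed
qed

end

section \<open>Dimension shifting\<close>

text \<open>Injectivity of \<iota> reflects the additivity and equivariance of \<open>k\<close> back
  to \<open>a\<close>. The result is made extensional so that it can serve as a cocycle.\<close>

lemma ghom_factor:
  assumes A: "gmodule G A" and Q: "gmodule G Q" and \<iota>: "\<iota> \<in> ghom G A C" "inj_on \<iota> (carrier A)"
    and k: "k \<in> ghom G Q C" "k ` carrier Q \<subseteq> \<iota> ` carrier A"
  obtains a where "a \<in> ghom G Q A" "a \<in> extensional (carrier Q)" "\<And>x. x \<in> carrier Q \<Longrightarrow> \<iota> (a x) = k x"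
proof -
  interpret A: comm_group A by (rule gmoduleD(1)[OF A])
  interpret Q: comm_group Q by (rule gmoduleD(1)[OF Q])
  define a where "a x = inv_into (carrier A) \<iota> (k x)" for x
  have a: "a x \<in> carrier A" "\<iota> (a x) = k x" if "x \<in> carrier Q" for x
  proof -
    have "k x \<in> \<iota> ` carrier A" using k(2) that by blast
    then show "a x \<in> carrier A" "\<iota> (a x) = k x"
      unfolding a_def by (rule inv_into_into, rule f_inv_into_f)
  qed
  have "a \<in> ghom G Q A"
  proof (rule ghomI)
    fix x y assume "x \<in> carrier Q" "y \<in> carrier Q"
    then show "a (x \<otimes>\<^bsub>Q\<^esub> y) = a x \<otimes>\<^bsub>A\<^esub> a y"
      by (intro inj_onD[OF \<iota>(2)]) (simp_all add: a ghomD(3)[OF \<iota>(1)] ghomD(3)[OF k(1)])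
  next
    fix g x assume "g \<in> carrier G" "x \<in> carrier Q"
    then show "a (act Q g x) = act A g (a x)"
      by (intro inj_onD[OF \<iota>(2)])
        (simp_all add: a ghomD(4)[OF \<iota>(1)] ghomD(4)[OF k(1)] gmoduleD(4)[OF Q] gmoduleD(4)[OF A])
  qed (rule a)
  then show ?thesis
    by (intro that[of "restrict a (carrier Q)"] ghom_restrict[OF Q]) (simp_all add: a)
qed

context adamson_resolution
begin

lemma cocyclesD:
  assumes "f \<in> adamson_cocycles G P d M m"
  shows "f \<in> ghom G (P (Suc m)) M" "\<And>x. x \<in> carrier (P (Suc (Suc m))) \<Longrightarrow> f (d (Suc m) x) = \<one>\<^bsub>M\<^esub>"
    "f \<in> extensional (carrier (P (Suc m)))"
  using assms by (auto simp: adamson_cocycles_def)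

lemma cocyclesI:
  assumes "f \<in> ghom G (P (Suc m)) M" "\<And>x. x \<in> carrier (P (Suc (Suc m))) \<Longrightarrow> f (d (Suc m) x) = \<one>\<^bsub>M\<^esub>"
  shows "restrict f (carrier (P (Suc m))) \<in> adamson_cocycles G P d M m"
  using ghom_restrict[OF P assms(1)] assms(2) by (auto simp: adamson_cocycles_def ghomD(2)[OF d])

lemma coboundaries_iff:
  assumes "f \<in> adamson_cocycles G P d M m"
  shows "f \<in> adamson_coboundaries G P d M m
    \<longleftrightarrow> (\<exists>F\<in>ghom G (P m) M. \<forall>x\<in>carrier (P (Suc m)). f x = F (d m x))"
  using assms by (auto simp: adamson_cocycles_def adamson_coboundaries_def)

text \<open>Elements of \<open>M\<close>, multilinear maps and homomorphisms on tensor powers live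
  on different types, so coefficients have to be exchanged along bijections. Values are pulled back
  by \<open>ghom_factor\<close>, without constructing an inverse homomorphism.\<close>

lemma adamson_cohomology_iso:
  assumes A: "gmodule G A" and B: "gmodule G B"
    and \<theta>: "\<theta> \<in> ghom G A B" "bij_betw \<theta> (carrier A) (carrier B)"
  shows "adamson_cohomology G P d A (Suc m) \<cong> adamson_cohomology G P d B (Suc m)"
proof -
  interpret A: comm_group A by (rule gmoduleD(1)[OF A])
  interpret B: comm_group B by (rule gmoduleD(1)[OF B])
  let ?T = "carrier (P (Suc m))"
  let ?R = "\<lambda>f f'. f \<in> adamson_cocycles G P d A m \<and> f' \<in> adamson_cocycles G P d B m
    \<and> (\<forall>x\<in>?T. f' x = \<theta> (f x))"
  have inj: "inj_on \<theta> (carrier A)" and onto: "\<theta> ` carrier A = carrier B"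
    using \<theta>(2) by (auto simp: bij_betw_def)
  note \<theta>1 = ghom_one_inv[OF A B \<theta>(1)]
  show ?thesis
    unfolding adamson_cohomology_Suc[OF A] adamson_cohomology_Suc[OF B]
  proof (rule function_quotient_iso[where R = ?R, OF A.comm_group_axioms B.comm_group_axioms
        subgroup_cocycles[OF A] subgroup_cocycles[OF B]
        subgroup_coboundaries[OF A] subgroup_coboundaries[OF B]
        coboundaries_subset_cocycles[OF A] coboundaries_subset_cocycles[OF B]])
    fix f f' assume "?R f f'"
    then show "f \<in> adamson_cocycles G P d A m \<and> f' \<in> adamson_cocycles G P d B m" by blast
  next
    fix f f' k k' assume R: "?R f f'" "?R k k'"
    note fZ = conjunct1[OF R(1)] conjunct1[OF R(2)]
    note f'Z = conjunct1[OF conjunct2[OF R(1)]] conjunct1[OF conjunct2[OF R(2)]]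
    have "\<forall>x\<in>?T. (\<lambda>x\<in>?T. f' x \<otimes>\<^bsub>B\<^esub> inv\<^bsub>B\<^esub> k' x) x = \<theta> ((\<lambda>x\<in>?T. f x \<otimes>\<^bsub>A\<^esub> inv\<^bsub>A\<^esub> k x) x)"
      using R ghomD(2)[OF cocyclesD(1)[OF fZ(1)]] ghomD(2)[OF cocyclesD(1)[OF fZ(2)]]
      by (simp add: ghomD(3)[OF \<theta>(1)] \<theta>1)
    then show "?R (\<lambda>x\<in>?T. f x \<otimes>\<^bsub>A\<^esub> inv\<^bsub>A\<^esub> k x) (\<lambda>x\<in>?T. f' x \<otimes>\<^bsub>B\<^esub> inv\<^bsub>B\<^esub> k' x)"
      using subgroup_product_groupD[OF A.is_group subgroup_cocycles[OF A] fZ]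
        subgroup_product_groupD[OF B.is_group subgroup_cocycles[OF B] f'Z] by blast
  next
    fix f assume f: "f \<in> adamson_cocycles G P d A m"
    have "(\<lambda>x\<in>?T. \<theta> (f x)) \<in> adamson_cocycles G P d B m"
      by (rule cocyclesI[OF ghom_comp[OF cocyclesD(1)[OF f] \<theta>(1)]]) (simp add: cocyclesD(2)[OF f] \<theta>1)
    then show "\<exists>f'. ?R f f'" using f by (intro exI[of _ "\<lambda>x\<in>?T. \<theta> (f x)"]) simp
  next
    fix f' assume f': "f' \<in> adamson_cocycles G P d B m"
    note f'D = cocyclesD[OF f']
    have "f' ` ?T \<subseteq> \<theta> ` carrier A" using ghomD(2)[OF f'D(1)] onto by blast
    then obtain f where f: "f \<in> ghom G (P (Suc m)) A" "f \<in> extensional ?T" "\<And>x. x \<in> ?T \<Longrightarrow> \<theta> (f x) = f' x"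
      using ghom_factor[OF A P \<theta>(1) inj f'D(1)] by metis
    have "f (d (Suc m) x) = \<one>\<^bsub>A\<^esub>" if "x \<in> carrier (P (Suc (Suc m)))" for x
      by (rule inj_onD[OF inj])
        (simp_all add: f(3) \<theta>1 f'D(2) that ghomD(2)[OF d] ghomD(2)[OF f(1)])
    then show "\<exists>f. ?R f f'" using f f' by (intro exI[of _ f]) (simp add: adamson_cocycles_def)
  next
    fix f f' assume R: "?R f f'"
    show "f \<in> adamson_coboundaries G P d A m \<longleftrightarrow> f' \<in> adamson_coboundaries G P d B m"
      unfolding coboundaries_iff[OF conjunct1[OF R]] coboundaries_iff[OF conjunct1[OF conjunct2[OF R]]]
    proof
      assume "\<exists>F\<in>ghom G (P m) A. \<forall>x\<in>?T. f x = F (d m x)"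
      then obtain F where F: "F \<in> ghom G (P m) A" "\<forall>x\<in>?T. f x = F (d m x)" by blast
      then have "\<forall>x\<in>?T. f' x = \<theta> (F (d m x))" using R by simp
      then show "\<exists>F\<in>ghom G (P m) B. \<forall>x\<in>?T. f' x = F (d m x)"
        by (rule bexI[OF _ ghom_comp[OF F(1) \<theta>(1)]])
    next
      assume "\<exists>F\<in>ghom G (P m) B. \<forall>x\<in>?T. f' x = F (d m x)"
      then obtain F' where F': "F' \<in> ghom G (P m) B" "\<And>x. x \<in> ?T \<Longrightarrow> f' x = F' (d m x)" by blast
      have "F' ` carrier (P m) \<subseteq> \<theta> ` carrier A" using ghomD(2)[OF F'(1)] onto by blast
      then obtain F where F: "F \<in> ghom G (P m) A" "\<And>x. x \<in> carrier (P m) \<Longrightarrow> \<theta> (F x) = F' x"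
        using ghom_factor[OF A P \<theta>(1) inj F'(1)] by metis
      have "f x = F (d m x)" if x: "x \<in> ?T" for x
      proof (rule inj_onD[OF inj])
        show "\<theta> (f x) = \<theta> (F (d m x))"
          using R x F'(2)[OF x] by (simp add: F(2) ghomD(2)[OF d])
        show "f x \<in> carrier A" by (rule ghomD(2)[OF cocyclesD(1)[OF conjunct1[OF R]] x])
        show "F (d m x) \<in> carrier A" by (rule ghomD(2)[OF F(1) ghomD(2)[OF d x]])
      qed
      then show "\<exists>F\<in>ghom G (P m) A. \<forall>x\<in>?T. f x = F (d m x)" using F(1) by blast
    qed
  qed
qed

text \<open>The connecting homomorphism of a relatively exact sequence, as a relation.\<close>

lemma dimension_shift:
  assumes A: "gmodule G A" and \<iota>: "\<iota> \<in> ghom G A C" "inj_on \<iota> (carrier A)"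
    and \<pi>: "rel_epi G H C \<pi> B" and exact: "kernel C B \<pi> = \<iota> ` carrier A"
    and acyclic: "\<And>m F. F \<in> ghom G (P (Suc m)) C
      \<Longrightarrow> (\<And>x. x \<in> carrier (P (Suc (Suc m))) \<Longrightarrow> F (d (Suc m) x) = \<one>\<^bsub>C\<^esub>)
      \<Longrightarrow> \<exists>F'\<in>ghom G (P m) C. \<forall>x\<in>carrier (P (Suc m)). F x = F' (d m x)"
  shows "adamson_cohomology G P d A (Suc (Suc m)) \<cong> adamson_cohomology G P d B (Suc m)"
proof -
  have C: "gmodule G C" and B: "gmodule G B" and \<pi>': "\<pi> \<in> ghom G C B"
    using \<pi> by (simp_all add: rel_epi_def)
  interpret A: comm_group A by (rule gmoduleD(1)[OF A])
  interpret B: comm_group B by (rule gmoduleD(1)[OF B])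
  interpret C: comm_group C by (rule gmoduleD(1)[OF C])
  note \<iota>1 = ghom_one_inv[OF A C \<iota>(1)] and \<pi>1 = ghom_one_inv[OF C B \<pi>']
  have \<pi>\<iota>: "\<pi> (\<iota> a) = \<one>\<^bsub>B\<^esub>" if "a \<in> carrier A" for a
  proof -
    have "\<iota> a \<in> kernel C B \<pi>" unfolding exact using that by (rule imageI)
    then show ?thesis by (simp add: kernel_def)
  qed
  let ?T = "carrier (P (Suc m))" and ?T' = "carrier (P (Suc (Suc m)))"
  let ?Z = "adamson_cocycles G P d A (Suc m)" and ?Z' = "adamson_cocycles G P d B m"
  \<comment> \<open>The snake construction with all choices left open: \<open>F\<close> lifts the
    cocycle \<open>f\<close> along \<pi>, and \<open>a\<close> is what \<open>F \<circ> d\<close>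
    becomes in \<open>A\<close>.\<close>
  let ?S = "\<lambda>a f F. F \<in> ghom G (P (Suc m)) C \<and> (\<forall>x\<in>?T. f x = \<pi> (F x)) \<and> (\<forall>x\<in>?T'. \<iota> (a x) = F (d (Suc m) x))"
  let ?R = "\<lambda>a f. a \<in> ?Z \<and> f \<in> ?Z' \<and> (\<exists>F. ?S a f F)"
  have lift: "\<exists>F\<in>ghom G (P n) C. \<forall>x\<in>carrier (P n). \<pi> (F x) = f x" if "f \<in> ghom G (P n) B" for f n
    by (rule rel_projective_lift[OF G H proj \<pi> that])
  have in_A: "\<exists>b\<in>ghom G (P n) A. b \<in> extensional (carrier (P n)) \<and> (\<forall>x\<in>carrier (P n). \<iota> (b x) = K x)"
    if K: "K \<in> ghom G (P n) C" and \<pi>K: "\<And>x. x \<in> carrier (P n) \<Longrightarrow> \<pi> (K x) = \<one>\<^bsub>B\<^esub>" for K n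
  proof -
    have "K ` carrier (P n) \<subseteq> kernel C B \<pi>" using ghomD(2)[OF K] \<pi>K by (auto simp: kernel_def)
    then show ?thesis unfolding exact using ghom_factor[OF A P \<iota> K] by metis
  qed
  show ?thesis
    unfolding adamson_cohomology_Suc[OF A] adamson_cohomology_Suc[OF B]
  proof (rule function_quotient_iso[where R = ?R, OF A.comm_group_axioms B.comm_group_axioms
        subgroup_cocycles[OF A] subgroup_cocycles[OF B]
        subgroup_coboundaries[OF A] subgroup_coboundaries[OF B]
        coboundaries_subset_cocycles[OF A] coboundaries_subset_cocycles[OF B]])
    fix a f assume "?R a f"
    then show "a \<in> ?Z \<and> f \<in> ?Z'" by blast
  next
    fix a f a' f' assume R: "?R a f" "?R a' f'"
    then obtain F F' where F: "?S a f F" "?S a' f' F'" by blast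
    note F1 = conjunct1[OF F(1)] conjunct1[OF F(2)]
    note aZ = conjunct1[OF R(1)] conjunct1[OF R(2)]
    note fZ = conjunct1[OF conjunct2[OF R(1)]] conjunct1[OF conjunct2[OF R(2)]]
    note closed = ghomD(2)[OF cocyclesD(1)[OF aZ(1)]] ghomD(2)[OF cocyclesD(1)[OF aZ(2)]]
      ghomD(2)[OF F1(1)] ghomD(2)[OF F1(2)]
    have "?S (\<lambda>x\<in>?T'. a x \<otimes>\<^bsub>A\<^esub> inv\<^bsub>A\<^esub> a' x) (\<lambda>x\<in>?T. f x \<otimes>\<^bsub>B\<^esub> inv\<^bsub>B\<^esub> f' x)
        (\<lambda>x. F x \<otimes>\<^bsub>C\<^esub> inv\<^bsub>C\<^esub> F' x)"
      using F ghom_quotient[OF C F1] closed by (simp add: ghomD(3)[OF \<pi>'] ghomD(3)[OF \<iota>(1)] \<pi>1 \<iota>1)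
    moreover have "(\<lambda>x\<in>?T'. a x \<otimes>\<^bsub>A\<^esub> inv\<^bsub>A\<^esub> a' x) \<in> ?Z"
      by (rule subgroup_product_groupD[OF A.is_group subgroup_cocycles[OF A] aZ])
    moreover have "(\<lambda>x\<in>?T. f x \<otimes>\<^bsub>B\<^esub> inv\<^bsub>B\<^esub> f' x) \<in> ?Z'"
      by (rule subgroup_product_groupD[OF B.is_group subgroup_cocycles[OF B] fZ])
    ultimately show "?R (\<lambda>x\<in>?T'. a x \<otimes>\<^bsub>A\<^esub> inv\<^bsub>A\<^esub> a' x) (\<lambda>x\<in>?T. f x \<otimes>\<^bsub>B\<^esub> inv\<^bsub>B\<^esub> f' x)"
      by blast
  next
    fix a assume a: "a \<in> ?Z"
    note aD = cocyclesD[OF a]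
    \<comment> \<open>Every class in \<open>A\<close> is hit: in \<open>C\<close> the cocycle
      \<open>\<iota> \<circ> a\<close> of degree \<open>m + 2\<close> is the coboundary of some
      \<open>F\<close> by acyclicity, and \<open>\<pi> \<circ> F\<close> is the cocycle sought in
      \<open>B\<close>.\<close>
    obtain F where F: "F \<in> ghom G (P (Suc m)) C" "\<forall>x\<in>?T'. \<iota> (a x) = F (d (Suc m) x)"
      using acyclic[OF ghom_comp[OF aD(1) \<iota>(1)]] by (auto simp: aD(2) \<iota>1)
    let ?f = "\<lambda>x\<in>?T. \<pi> (F x)"
    have "\<pi> (F (d (Suc m) x)) = \<one>\<^bsub>B\<^esub>" if "x \<in> ?T'" for x
      using F(2) \<pi>\<iota>[OF ghomD(2)[OF aD(1) that]] that by simp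
    then have "?f \<in> ?Z'" by (intro cocyclesI ghom_comp[OF F(1) \<pi>'])
    then have "?R a ?f" using a F by auto
    then show "\<exists>f. ?R a f" by blast
  next
    fix f assume f: "f \<in> ?Z'"
    note fD = cocyclesD[OF f]
    \<comment> \<open>Relative projectivity lifts \<open>f\<close>, because the sequence of
      coefficients splits over \<open>H\<close>.\<close>
    obtain F where F: "F \<in> ghom G (P (Suc m)) C" "\<forall>x\<in>?T. \<pi> (F x) = f x"
      using lift[OF fD(1)] by blast
    have "\<pi> (F (d (Suc m) x)) = \<one>\<^bsub>B\<^esub>" if "x \<in> ?T'" for x
      using F(2) fD(2)[OF that] ghomD(2)[OF d that] by simp
    then obtain a where a: "a \<in> ghom G (P (Suc (Suc m))) A" "a \<in> extensional ?T'"
        "\<forall>x\<in>?T'. \<iota> (a x) = F (d (Suc m) x)"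
      using in_A[OF ghom_comp[OF d F(1)]] by blast
    have "a (d (Suc (Suc m)) x) = \<one>\<^bsub>A\<^esub>" if "x \<in> carrier (P (Suc (Suc (Suc m))))" for x
    proof (rule inj_onD[OF \<iota>(2)])
      show "\<iota> (a (d (Suc (Suc m)) x)) = \<iota> \<one>\<^bsub>A\<^esub>"
        using a(3) ghomD(2)[OF d that] d_d[OF that] ghom_one_inv(1)[OF P C F(1)] \<iota>1 by simp
    qed (use that ghomD(2)[OF d] ghomD(2)[OF a(1)] in simp_all)
    then have "?R a f" using a f F by (auto simp: adamson_cocycles_def)
    then show "\<exists>a. ?R a f" by blast
  next
    fix a f assume R: "?R a f"
    then obtain F where F: "?S a f F" by blast
    have aZ: "a \<in> ?Z" and fZ: "f \<in> ?Z'" using R by blast+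
    note Fc = ghomD(2)[OF conjunct1[OF F]]
    show "a \<in> adamson_coboundaries G P d A (Suc m) \<longleftrightarrow> f \<in> adamson_coboundaries G P d B m"
      unfolding coboundaries_iff[OF aZ] coboundaries_iff[OF fZ]
    proof
      assume "\<exists>b\<in>ghom G (P (Suc m)) A. \<forall>x\<in>?T'. a x = b (d (Suc m) x)"
      then obtain b where b: "b \<in> ghom G (P (Suc m)) A" "\<forall>x\<in>?T'. a x = b (d (Suc m) x)" by blast
      \<comment> \<open>If \<open>a\<close> is the coboundary of \<open>b\<close>, then
        \<open>F - \<iota> b\<close> still lifts \<open>f\<close> and is a cocycle in
        \<open>C\<close>. By acyclicity in degree \<open>m + 1\<close> it is a coboundary, and \<pi>
        carries this over to \<open>f\<close>.\<close>
      let ?K = "\<lambda>x. F x \<otimes>\<^bsub>C\<^esub> inv\<^bsub>C\<^esub> \<iota> (b x)"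
      have \<iota>b: "(\<lambda>x. \<iota> (b x)) \<in> ghom G (P (Suc m)) C" by (rule ghom_comp[OF b(1) \<iota>(1)])
      have "?K (d (Suc m) x) = \<one>\<^bsub>C\<^esub>" if "x \<in> ?T'" for x
        using F b(2) that ghomD(2)[OF d that] ghomD(2)[OF \<iota>b] by (metis C.r_inv)
      then obtain F' where F': "F' \<in> ghom G (P m) C" "\<forall>x\<in>?T. ?K x = F' (d m x)"
        using acyclic[OF ghom_quotient[OF C conjunct1[OF F] \<iota>b]] by blast
      have "f x = \<pi> (F' (d m x))" if "x \<in> ?T" for x
      proof -
        have "F' (d m x) = ?K x" using F'(2) that by simp
        then show ?thesis
          using F that Fc[OF that] ghomD(2)[OF \<iota>b that] ghomD(2)[OF b(1) that] ghomD(2)[OF \<pi>']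
          by (simp add: ghomD(3)[OF \<pi>'] \<pi>1 \<pi>\<iota>)
      qed
      then show "\<exists>f'\<in>ghom G (P m) B. \<forall>x\<in>?T. f x = f' (d m x)"
        by (intro bexI[OF _ ghom_comp[OF F'(1) \<pi>']] ballI)
    next
      assume "\<exists>f'\<in>ghom G (P m) B. \<forall>x\<in>?T. f x = f' (d m x)"
      then obtain f' where f': "f' \<in> ghom G (P m) B" "\<forall>x\<in>?T. f x = f' (d m x)" by blast
      obtain F' where F': "F' \<in> ghom G (P m) C" "\<forall>x\<in>carrier (P m). \<pi> (F' x) = f' x"
        using lift[OF f'(1)] by blast
      \<comment> \<open>Subtracting the coboundary of a lift of \<open>f'\<close> moves
        \<open>F\<close> into the image of \<open>A\<close> and does not change
        \<open>F \<circ> d\<close>, as two successive differentials compose to the trivial map. So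
        \<open>a\<close> is the coboundary of the resulting \<open>b\<close>.\<close>
      let ?K = "\<lambda>x. F x \<otimes>\<^bsub>C\<^esub> inv\<^bsub>C\<^esub> F' (d m x)"
      have F'd: "(\<lambda>x. F' (d m x)) \<in> ghom G (P (Suc m)) C" by (rule ghom_comp[OF d F'(1)])
      have "\<pi> (?K x) = \<one>\<^bsub>B\<^esub>" if "x \<in> ?T" for x
      proof -
        have "\<pi> (F x) = \<pi> (F' (d m x))" using F f'(2) F'(2) that ghomD(2)[OF d that] by simp
        then show ?thesis
          using Fc[OF that] ghomD(2)[OF F'd that] ghomD(2)[OF \<pi>'] by (simp add: ghomD(3)[OF \<pi>'] \<pi>1)
      qed
      then obtain b where b: "b \<in> ghom G (P (Suc m)) A" "\<forall>x\<in>?T. \<iota> (b x) = ?K x"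
        using in_A[OF ghom_quotient[OF C conjunct1[OF F] F'd]] by blast
      have "a x = b (d (Suc m) x)" if x: "x \<in> ?T'" for x
      proof (rule inj_onD[OF \<iota>(2)])
        show "\<iota> (a x) = \<iota> (b (d (Suc m) x))"
          using F b(2) x Fc ghomD(2)[OF d x] d_d[OF x] ghom_one_inv(1)[OF P C F'(1)] by simp
        show "a x \<in> carrier A" by (rule ghomD(2)[OF cocyclesD(1)[OF aZ] x])
        show "b (d (Suc m) x) \<in> carrier A" by (rule ghomD(2)[OF b(1) ghomD(2)[OF d x]])
      qed
      then show "\<exists>b\<in>ghom G (P (Suc m)) A. \<forall>x\<in>?T'. a x = b (d (Suc m) x)" using b(1) by blast
    qed
  qed
qed

end

section \<open>Modules of functions\<close>

definition function_module ::
    "('g, 'b) monoid_scheme \<Rightarrow> ('x \<Rightarrow> 'a) set \<Rightarrow> 'x set \<Rightarrow> ('g, 'a) gmod \<Rightarrow> ('g \<Rightarrow> 'x \<Rightarrow> 'x)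
      \<Rightarrow> ('g, 'x \<Rightarrow> 'a) gmod" where
  "function_module G S T M \<tau> = with_act ((product_group T (\<lambda>_. M))\<lparr>carrier := S\<rparr>)
     (\<lambda>g f. \<lambda>x\<in>T. act M g (f (\<tau> (inv\<^bsub>G\<^esub> g) x)))"

lemma function_module_simps:
  "carrier (function_module G S T M \<tau>) = S"
  "f \<otimes>\<^bsub>function_module G S T M \<tau>\<^esub> f' = (\<lambda>x\<in>T. f x \<otimes>\<^bsub>M\<^esub> f' x)"
  "\<one>\<^bsub>function_module G S T M \<tau>\<^esub> = (\<lambda>x\<in>T. \<one>\<^bsub>M\<^esub>)"
  "act (function_module G S T M \<tau>) g f = (\<lambda>x\<in>T. act M g (f (\<tau> (inv\<^bsub>G\<^esub> g) x)))"
  by (simp_all add: function_module_def with_act_def)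

lemma hom_module_eq_function_module:
  "hom_module G A B = function_module G (hom A B \<inter> extensional (carrier A)) (carrier A) B (act A)"
  by (simp add: hom_module_def function_module_def)

lemma comm_group_with_act:
  assumes "comm_group K"
  shows "comm_group (with_act K \<phi>)"
proof -
  interpret comm_group K by fact
  show ?thesis
    by (rule comm_groupI) (auto simp: with_act_def m_ac intro: l_inv_ex)
qed

lemma gmodule_function_module:
  assumes G: "group G" and M: "gmodule G M" and S: "subgroup S (product_group T (\<lambda>_. M))"
    and \<tau>: "\<And>g x. g \<in> carrier G \<Longrightarrow> x \<in> T \<Longrightarrow> \<tau> g x \<in> T" "\<And>x. x \<in> T \<Longrightarrow> \<tau> \<one>\<^bsub>G\<^esub> x = x"
      "\<And>g h x. g \<in> carrier G \<Longrightarrow> h \<in> carrier G \<Longrightarrow> x \<in> T \<Longrightarrow> \<tau> (g \<otimes>\<^bsub>G\<^esub> h) x = \<tau> g (\<tau> h x)"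
    and act: "\<And>g f. g \<in> carrier G \<Longrightarrow> f \<in> S \<Longrightarrow> (\<lambda>x\<in>T. act M g (f (\<tau> (inv\<^bsub>G\<^esub> g) x))) \<in> S"
  shows "gmodule G (function_module G S T M \<tau>)"
proof -
  interpret G: group G by fact
  interpret M: comm_group M by (rule gmoduleD(1)[OF M])
  have c: "f x \<in> carrier M" if "f \<in> S" "x \<in> T" for f x
    using subgroup.subset[OF S] that by auto
  have ext: "f \<in> extensional T" if "f \<in> S" for f
    using subgroup.subset[OF S] that by (auto simp: PiE_def)
  show ?thesis
    unfolding gmodule_def
  proof (intro conjI ballI)
    show "comm_group (function_module G S T M \<tau>)"
      unfolding function_module_def
      by (intro comm_group_with_act comm_group_subgroup comm_group_product_group S M.comm_group_axioms)
  next
    fix g assume g: "g \<in> carrier G"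
    have "(\<lambda>x\<in>T. act M g ((\<lambda>x\<in>T. f x \<otimes>\<^bsub>M\<^esub> f' x) (\<tau> (inv\<^bsub>G\<^esub> g) x)))
        = (\<lambda>x\<in>T. (\<lambda>x\<in>T. act M g (f (\<tau> (inv\<^bsub>G\<^esub> g) x))) x \<otimes>\<^bsub>M\<^esub> (\<lambda>x\<in>T. act M g (f' (\<tau> (inv\<^bsub>G\<^esub> g) x))) x)"
      if "f \<in> S" "f' \<in> S" for f f'
      by (rule restrict_ext) (use g that in \<open>simp add: \<tau>(1) c gmoduleD(5)[OF M]\<close>)
    then show "act (function_module G S T M \<tau>) g
        \<in> hom (function_module G S T M \<tau>) (function_module G S T M \<tau>)"
      unfolding hom_def function_module_simps using act[OF g] by blast
  next
    fix f assume "f \<in> carrier (function_module G S T M \<tau>)"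
    then have f: "f \<in> S" by (simp add: function_module_simps)
    have "(\<lambda>x\<in>T. act M \<one>\<^bsub>G\<^esub> (f (\<tau> (inv\<^bsub>G\<^esub> \<one>\<^bsub>G\<^esub>) x))) = f"
      by (rule extensionalityI[OF _ ext[OF f]]) (simp_all add: c[OF f] \<tau>(2) gmoduleD(6)[OF M])
    then show "act (function_module G S T M \<tau>) \<one>\<^bsub>G\<^esub> f = f" by (simp add: function_module_simps)
  next
    fix g h f assume g: "g \<in> carrier G" and h: "h \<in> carrier G"
      and "f \<in> carrier (function_module G S T M \<tau>)"
    then have f: "f \<in> S" by (simp add: function_module_simps)
    have "(\<lambda>x\<in>T. act M (g \<otimes>\<^bsub>G\<^esub> h) (f (\<tau> (inv\<^bsub>G\<^esub> (g \<otimes>\<^bsub>G\<^esub> h)) x)))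
      = (\<lambda>x\<in>T. act M g ((\<lambda>x\<in>T. act M h (f (\<tau> (inv\<^bsub>G\<^esub> h) x))) (\<tau> (inv\<^bsub>G\<^esub> g) x)))"
      by (rule restrict_ext) (simp add: g h c[OF f] G.inv_mult_group \<tau>(1,3) gmoduleD(7)[OF M])
    then show "act (function_module G S T M \<tau>) (g \<otimes>\<^bsub>G\<^esub> h) f
        = act (function_module G S T M \<tau>) g (act (function_module G S T M \<tau>) h f)"
      by (simp add: function_module_simps)
  qed
qed

section \<open>Functions on cosets as coinduced modules\<close>

lemma lcosets_cases:
  assumes "c \<in> lcosets\<^bsub>G\<^esub> H"
  obtains g where "g \<in> carrier G" "c = g <#\<^bsub>G\<^esub> H"
  using assms by (auto simp: LCOSETS_def)

lemma lcosetsI: "g \<in> carrier G \<Longrightarrow> g <#\<^bsub>G\<^esub> H \<in> lcosets\<^bsub>G\<^esub> H"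
  by (auto simp: LCOSETS_def)

lemma (in group) lcosets_act:
  assumes H: "subgroup H G"
  shows "\<And>g c. g \<in> carrier G \<Longrightarrow> c \<in> lcosets H \<Longrightarrow> g <# c \<in> lcosets H"
    "\<And>c. c \<in> lcosets H \<Longrightarrow> \<one> <# c = c"
    "\<And>g h c. g \<in> carrier G \<Longrightarrow> h \<in> carrier G \<Longrightarrow> c \<in> lcosets H \<Longrightarrow> (g \<otimes> h) <# c = g <# (h <# c)"
    "\<And>h. h \<in> H \<Longrightarrow> h <# H = H" "H \<in> lcosets H"
proof -
  have sub: "c \<subseteq> carrier G" if "c \<in> lcosets H" for c
    using subgroup.lcosets_carrier[OF H group_axioms that] .
  show 3: "(g \<otimes> h) <# c = g <# (h <# c)" if "g \<in> carrier G" "h \<in> carrier G" "c \<in> lcosets H" for g h c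
    using lcos_m_assoc[OF sub[OF that(3)] that(1,2)] by simp
  show 2: "\<one> <# c = c" if "c \<in> lcosets H" for c
    by (rule lcos_mult_one[OF sub[OF that]])
  show "H \<in> lcosets H"
    using lcosetsI[of \<one> G H] lcos_mult_one[OF subgroup.subset[OF H]] by simp
  show "g <# c \<in> lcosets H" if g: "g \<in> carrier G" and c: "c \<in> lcosets H" for g c
  proof -
    obtain k where k: "k \<in> carrier G" "c = k <# H" using c by (rule lcosets_cases)
    have "g <# c = (g \<otimes> k) <# H"
      unfolding k(2) by (rule lcos_m_assoc[OF subgroup.subset[OF H] g k(1)])
    then show ?thesis using lcosetsI[of "g \<otimes> k" G H] g k(1) by simp
  qed
  show "h <# H = H" if "h \<in> H" for h
    using coset_join3[OF _ H that] subgroup.subset[OF H] that by blast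
qed

text \<open>This is \<open>Hom(Z[G/H], A)\<close>: an additive map on the free group amounts to
  arbitrary values on the cosets.\<close>

definition coset_functions ::
    "('g, 'b) monoid_scheme \<Rightarrow> 'g set \<Rightarrow> ('g, 'a) gmod \<Rightarrow> ('g, 'g set \<Rightarrow> 'a) gmod" where
  "coset_functions G H A = function_module G (lcosets\<^bsub>G\<^esub> H \<rightarrow>\<^sub>E carrier A) (lcosets\<^bsub>G\<^esub> H) A
     (\<lambda>g c. g <#\<^bsub>G\<^esub> c)"

lemma gmodule_coset_functions:
  assumes G: "group G" and H: "subgroup H G" and A: "gmodule G A"
  shows "gmodule G (coset_functions G H A)"
proof -
  interpret G: group G by fact
  interpret A: comm_group A by (rule gmoduleD(1)[OF A])
  note L = G.lcosets_act[OF H]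
  show ?thesis
    unfolding coset_functions_def
  proof (rule gmodule_function_module[OF G A])
    show "subgroup (lcosets\<^bsub>G\<^esub> H \<rightarrow>\<^sub>E carrier A) (product_group (lcosets\<^bsub>G\<^esub> H) (\<lambda>_. A))"
      by (simp add: PiE_subgroup_product_group A.subgroup_self)
    fix g f assume "g \<in> carrier G" "f \<in> lcosets\<^bsub>G\<^esub> H \<rightarrow>\<^sub>E carrier A"
    then show "(\<lambda>x\<in>lcosets\<^bsub>G\<^esub> H. act A g (f (inv\<^bsub>G\<^esub> g <#\<^bsub>G\<^esub> x))) \<in> lcosets\<^bsub>G\<^esub> H \<rightarrow>\<^sub>E carrier A"
      by (auto simp: L gmoduleD(4)[OF A] PiE_iff)
  qed (simp_all add: L)
qed

text \<open>Frobenius reciprocity: evaluation at the coset \<open>H\<close> identifies the \<open>G\<close>-homomorphisms to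
  functions on cosets with the \<open>H\<close>-homomorphisms to \<open>A\<close>.\<close>

lemma coset_functions_eval:
  assumes G: "group G" and H: "subgroup H G" and A: "gmodule G A" and Q: "gmodule G Q"
    and F: "F \<in> ghom G Q (coset_functions G H A)"
  shows "\<And>g p. g \<in> carrier G \<Longrightarrow> p \<in> carrier Q \<Longrightarrow> F p (g <#\<^bsub>G\<^esub> H) = act A g (F (act Q (inv\<^bsub>G\<^esub> g) p) H)"
    "(\<lambda>p. F p H) \<in> ghom (G\<lparr>carrier := H\<rparr>) Q A"
    "\<And>p. p \<in> carrier Q \<Longrightarrow> F p \<in> extensional (lcosets\<^bsub>G\<^esub> H)"
proof -
  interpret G: group G by fact
  note L = G.lcosets_act[OF H]
  have HG: "h \<in> carrier G" if "h \<in> H" for h using subgroup.subset[OF H] that by blast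
  have F_closed: "F p c \<in> carrier A" if "p \<in> carrier Q" "c \<in> lcosets\<^bsub>G\<^esub> H" for p c
    using ghomD(2)[OF F that(1)] that(2) by (auto simp: coset_functions_def function_module_simps)
  show "F p \<in> extensional (lcosets\<^bsub>G\<^esub> H)" if "p \<in> carrier Q" for p
    using ghomD(2)[OF F that] by (auto simp: coset_functions_def function_module_simps PiE_def)
  have eq: "F (act Q g p) c = act A g (F p (inv\<^bsub>G\<^esub> g <#\<^bsub>G\<^esub> c))"
    if "g \<in> carrier G" "p \<in> carrier Q" "c \<in> lcosets\<^bsub>G\<^esub> H" for g p c
    using ghomD(4)[OF F that(1,2)] that(3) by (simp add: coset_functions_def function_module_simps)
  show "F p (g <#\<^bsub>G\<^esub> H) = act A g (F (act Q (inv\<^bsub>G\<^esub> g) p) H)"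
    if g: "g \<in> carrier G" and p: "p \<in> carrier Q" for g p
    using eq[OF G.inv_closed[OF g] p L(5)] g p
    by (simp add: gmodule_act_inverse[OF G A] F_closed L(1) lcosetsI)
  show "(\<lambda>p. F p H) \<in> ghom (G\<lparr>carrier := H\<rparr>) Q A"
  proof (rule ghomI)
    fix x y assume "x \<in> carrier Q" "y \<in> carrier Q"
    then show "F (x \<otimes>\<^bsub>Q\<^esub> y) H = F x H \<otimes>\<^bsub>A\<^esub> F y H"
      using L(5) by (simp add: ghomD(3)[OF F] coset_functions_def function_module_simps)
  next
    fix h x assume "h \<in> carrier (G\<lparr>carrier := H\<rparr>)" "x \<in> carrier Q"
    then show "F (act Q h x) H = act A h (F x H)"
      using L(5) by (simp add: eq HG L(4) subgroup.m_inv_closed[OF H])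
  qed (simp add: F_closed L(5))
qed

text \<open>Equivariance forces the value of \<open>F p\<close> at \<open>gH\<close> to be
  \<open>g u(g^-1 p)\<close>. Replacing \<open>g\<close> by \<open>gh\<close> puts
  \<open>h^-1\<close> inside \<open>u\<close> and \<open>h\<close> outside, and the two cancel
  because \<open>u\<close> is equivariant over \<open>H\<close>.\<close>

lemma coset_functions_coind:
  assumes G: "group G" and H: "subgroup H G" and A: "gmodule G A" and Q: "gmodule G Q"
    and u: "u \<in> ghom (G\<lparr>carrier := H\<rparr>) Q A"
  obtains F where "F \<in> ghom G Q (coset_functions G H A)"
    "\<And>g p. g \<in> carrier G \<Longrightarrow> p \<in> carrier Q \<Longrightarrow> F p (g <#\<^bsub>G\<^esub> H) = act A g (u (act Q (inv\<^bsub>G\<^esub> g) p))"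
proof -
  interpret G: group G by fact
  interpret Q: comm_group Q by (rule gmoduleD(1)[OF Q])
  note L = G.lcosets_act[OF H]
  have HG: "h \<in> carrier G" if "h \<in> H" for h using subgroup.subset[OF H] that by blast
  have uniq: "act A g (u (act Q (inv\<^bsub>G\<^esub> g) p)) = act A g' (u (act Q (inv\<^bsub>G\<^esub> g') p))"
    if g: "g \<in> carrier G" "g' \<in> carrier G" and eq: "g <#\<^bsub>G\<^esub> H = g' <#\<^bsub>G\<^esub> H" and p: "p \<in> carrier Q" for g g' p
  proof -
    have "g' \<in> g <#\<^bsub>G\<^esub> H" unfolding eq by (rule G.lcos_self[OF g(2) H])
    then obtain h where h: "h \<in> H" "g' = g \<otimes>\<^bsub>G\<^esub> h" by (auto simp: l_coset_def)
    have "u (act Q (inv\<^bsub>G\<^esub> h) (act Q (inv\<^bsub>G\<^esub> g) p)) = act A (inv\<^bsub>G\<^esub> h) (u (act Q (inv\<^bsub>G\<^esub> g) p))"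
      using ghomD(4)[OF u, of "inv\<^bsub>G\<^esub> h"] subgroup.m_inv_closed[OF H h(1)] g p by (simp add: gmoduleD(4)[OF Q])
    then show ?thesis
      using g p HG[OF h(1)]
      by (simp add: h(2) G.inv_mult_group gmoduleD(4,7)[OF Q] gmoduleD(4,7)[OF A] ghomD(2)[OF u]
          gmodule_act_inverse[OF G A])
  qed
  define r where "r c = (SOME g. g \<in> carrier G \<and> c = g <#\<^bsub>G\<^esub> H)" for c
  have r: "r c \<in> carrier G" "c = r c <#\<^bsub>G\<^esub> H" if "c \<in> lcosets\<^bsub>G\<^esub> H" for c
  proof -
    have "\<exists>g. g \<in> carrier G \<and> c = g <#\<^bsub>G\<^esub> H" using that by (auto simp: LCOSETS_def)
    from someI_ex[OF this] show "r c \<in> carrier G" "c = r c <#\<^bsub>G\<^esub> H" by (simp_all add: r_def)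
  qed
  define F where "F p = (\<lambda>c\<in>lcosets\<^bsub>G\<^esub> H. act A (r c) (u (act Q (inv\<^bsub>G\<^esub> r c) p)))" for p
  have F: "F p (g <#\<^bsub>G\<^esub> H) = act A g (u (act Q (inv\<^bsub>G\<^esub> g) p))"
    if g: "g \<in> carrier G" and p: "p \<in> carrier Q" for g p
    using uniq[OF r(1) g _ p] r[OF lcosetsI[OF g]] lcosetsI[OF g, of H] by (simp add: F_def)
  have uc: "act A g (u (act Q k p)) \<in> carrier A"
    if "g \<in> carrier G" "k \<in> carrier G" "p \<in> carrier Q" for g k p
    using that by (simp add: gmoduleD(4)[OF Q] gmoduleD(4)[OF A] ghomD(2)[OF u])
  have "F \<in> ghom G Q (coset_functions G H A)"
  proof (rule ghomI)
    fix p assume p: "p \<in> carrier Q"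
    then show "F p \<in> carrier (coset_functions G H A)"
      by (auto simp: coset_functions_def function_module_simps F_def uc r(1))
    {
      fix q assume "q \<in> carrier Q"
      then show "F (p \<otimes>\<^bsub>Q\<^esub> q) = F p \<otimes>\<^bsub>coset_functions G H A\<^esub> F q"
        unfolding coset_functions_def function_module_simps using p
        by (auto simp: F_def r(1) gmoduleD(4,5)[OF Q] gmoduleD(5)[OF A] ghomD(2,3)[OF u] intro!: restrict_ext)
    }
    fix g assume g: "g \<in> carrier G"
    show "F (act Q g p) = act (coset_functions G H A) g (F p)"
      unfolding coset_functions_def function_module_simps
    proof (rule extensionalityI)
      fix c assume c: "c \<in> lcosets\<^bsub>G\<^esub> H"
      then obtain k where k: "k \<in> carrier G" "c = k <#\<^bsub>G\<^esub> H" by (rule lcosets_cases)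
      have "inv\<^bsub>G\<^esub> g <#\<^bsub>G\<^esub> c = (inv\<^bsub>G\<^esub> g \<otimes>\<^bsub>G\<^esub> k) <#\<^bsub>G\<^esub> H"
        using L(3)[OF G.inv_closed[OF g] k(1) L(5)] k(2) by simp
      then show "F (act Q g p) c = (\<lambda>x\<in>lcosets\<^bsub>G\<^esub> H. act A g (F p (inv\<^bsub>G\<^esub> g <#\<^bsub>G\<^esub> x))) c"
        using c g k p
        by (simp add: F gmoduleD(4)[OF Q] G.inv_mult_group gmoduleD(7)[OF Q, symmetric]
            gmoduleD(7)[OF A, symmetric] ghomD(2)[OF u] G.m_assoc[symmetric])
    qed (auto simp: F_def)
  qed
  then show ?thesis using F by (rule that)
qed

context adamson_resolution
begin

text \<open>By Frobenius reciprocity such a cocycle is an \<open>H\<close>-equivariant cocycle with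
  values in \<open>A\<close>. Over \<open>H\<close> it extends along the resolution, which splits
  there, and the extension is transposed back to \<open>G\<close>.\<close>

lemma coset_functions_acyclic:
  assumes A: "gmodule G A" and F: "F \<in> ghom G (P (Suc m)) (coset_functions G H A)"
    and Fd: "\<And>x. x \<in> carrier (P (Suc (Suc m))) \<Longrightarrow> F (d (Suc m) x) = \<one>\<^bsub>coset_functions G H A\<^esub>"
  shows "\<exists>F'\<in>ghom G (P m) (coset_functions G H A). \<forall>x\<in>carrier (P (Suc m)). F x = F' (d m x)"
proof -
  note ev = coset_functions_eval[OF G H A P F]
  have "F (d (Suc m) x) H = \<one>\<^bsub>A\<^esub>" if "x \<in> carrier (P (Suc (Suc m)))" for x
    using Fd[OF that] G.lcosets_act(5)[OF H] by (simp add: coset_functions_def function_module_simps)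
  then obtain u where u: "u \<in> ghom Hg (P m) A" "\<And>x. x \<in> carrier (P (Suc m)) \<Longrightarrow> u (d m x) = F x H"
    using equivariant_extension[OF gmodule_subgroup[OF A H] ev(2)] by metis
  obtain F' where F': "F' \<in> ghom G (P m) (coset_functions G H A)"
    "\<And>g p. g \<in> carrier G \<Longrightarrow> p \<in> carrier (P m)
       \<Longrightarrow> F' p (g <#\<^bsub>G\<^esub> H) = act A g (u (act (P m) (inv\<^bsub>G\<^esub> g) p))"
    using coset_functions_coind[OF G H A P u(1)] by blast
  \<comment> \<open>Both sides are equivariant over \<open>G\<close> in \<open>x\<close>, so
    agreement at the coset \<open>H\<close> propagates to every coset.\<close>
  have "F x = F' (d m x)" if x: "x \<in> carrier (P (Suc m))" for x
  proof (rule extensionalityI)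
    show "F x \<in> extensional (lcosets\<^bsub>G\<^esub> H)" by (rule ev(3)[OF x])
    show "F' (d m x) \<in> extensional (lcosets\<^bsub>G\<^esub> H)"
      by (rule coset_functions_eval(3)[OF G H A P F'(1) ghomD(2)[OF d x]])
    fix c assume "c \<in> lcosets\<^bsub>G\<^esub> H"
    then obtain g where g: "g \<in> carrier G" "c = g <#\<^bsub>G\<^esub> H" by (rule lcosets_cases)
    then show "F x c = F' (d m x) c"
      using x ghomD(4)[OF d G.inv_closed[OF g(1)] x, symmetric]
      by (simp add: ev(1)[OF g(1) x] F'(2) ghomD(2)[OF d] u(2) gmoduleD(4)[OF P])
  qed
  then show ?thesis using F'(1) by blast
qed

end

section \<open>Evaluation of formal integer combinations\<close>

lemma hom_free_Abelian_group_eq: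
  fixes T :: "'c set"
  assumes M: "group M" and h: "h \<in> hom (free_Abelian_group T) M" "h' \<in> hom (free_Abelian_group T) M"
    and eq: "\<And>c. c \<in> T \<Longrightarrow> h (frag_of c) = h' (frag_of c)" and x: "Poly_Mapping.keys x \<subseteq> T"
  shows "h x = h' x"
proof -
  interpret M: group M by fact
  interpret h: group_hom "free_Abelian_group T" M h
    using h(1) by (simp add: group_hom_def group_hom_axioms_def M)
  interpret h': group_hom "free_Abelian_group T" M h'
    using h(2) by (simp add: group_hom_def group_hom_axioms_def M)
  show ?thesis
  proof (rule free_Abelian_group_induct[OF x, where P = "\<lambda>x. h x = h' x"])
    show "h 0 = h' 0" using h.hom_one h'.hom_one by simp
    fix x y :: "'c \<Rightarrow>\<^sub>0 int"
    assume xy: "Poly_Mapping.keys x \<subseteq> T" "Poly_Mapping.keys y \<subseteq> T" "h x = h' x" "h y = h' y"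
    \<comment> \<open>The induction rule builds formal sums by differences, hence the detour through
      inverses.\<close>
    have diff: "k (x - y) = k x \<otimes>\<^bsub>M\<^esub> inv\<^bsub>M\<^esub> k y" if "group_hom (free_Abelian_group T) M k" for k
    proof -
      interpret k: group_hom "free_Abelian_group T" M k by fact
      show ?thesis using k.hom_mult[of x "- y"] k.hom_inv[of y] xy by simp
    qed
    then show "h (x - y) = h' (x - y)"
      using diff[OF h.group_hom_axioms] diff[OF h'.group_hom_axioms] xy by simp
  qed (rule eq)
qed

text \<open>The sum of \<open>n_c w(c)\<close> over a formal combination of labels. The universal
  property asserts only existence, hence the choice; on combinations supported in \<open>T\<close>
  the result is determined by \<open>w\<close>.\<close>

definition frag_eval :: "('a, 'b) monoid_scheme \<Rightarrow> 'c set \<Rightarrow> ('c \<Rightarrow> 'a) \<Rightarrow> ('c \<Rightarrow>\<^sub>0 int) \<Rightarrow> 'a" where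
  "frag_eval M T w = (SOME h. h \<in> hom (free_Abelian_group T) M \<and> (\<forall>c\<in>T. h (frag_of c) = w c))"

lemma frag_eval:
  assumes M: "comm_group M" and w: "\<And>c. c \<in> T \<Longrightarrow> w c \<in> carrier M"
  shows "frag_eval M T w \<in> hom (free_Abelian_group T) M"
    "\<And>c. c \<in> T \<Longrightarrow> frag_eval M T w (frag_of c) = w c"
    "\<And>x. Poly_Mapping.keys x \<subseteq> T \<Longrightarrow> frag_eval M T w x \<in> carrier M"
proof -
  have "\<exists>h. h \<in> hom (free_Abelian_group T) M \<and> (\<forall>c\<in>T. h (frag_of c) = w c)"
  proof (rule comm_group.free_Abelian_group_universal[OF M, of w T])
    show "w ` T \<subseteq> carrier M" using w by (rule image_subsetI)
  qed blast
  from someI_ex[OF this]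
  show 1: "frag_eval M T w \<in> hom (free_Abelian_group T) M"
    and "\<And>c. c \<in> T \<Longrightarrow> frag_eval M T w (frag_of c) = w c"
    by (auto simp: frag_eval_def)
  show "frag_eval M T w x \<in> carrier M" if "Poly_Mapping.keys x \<subseteq> T" for x
    using hom_in_carrier[OF 1] that by simp
qed

lemma frag_eval_unique:
  assumes M: "comm_group M" and w: "\<And>c. c \<in> T \<Longrightarrow> w c \<in> carrier M"
    and h: "h \<in> hom (free_Abelian_group T) M" "\<And>c. c \<in> T \<Longrightarrow> h (frag_of c) = w c"
    and x: "Poly_Mapping.keys x \<subseteq> T"
  shows "frag_eval M T w x = h x"
  by (rule hom_free_Abelian_group_eq[OF _ frag_eval(1)[OF M w] h(1) _ x])
    (use M in \<open>simp_all add: frag_eval(2)[OF M w] h(2) w comm_group.axioms(2)\<close>)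

lemma frag_eval_add:
  assumes M: "comm_group M" and w: "\<And>c. c \<in> T \<Longrightarrow> w c \<in> carrier M"
    and x: "Poly_Mapping.keys x \<subseteq> T" "Poly_Mapping.keys y \<subseteq> T"
  shows "frag_eval M T w (x + y) = frag_eval M T w x \<otimes>\<^bsub>M\<^esub> frag_eval M T w y"
proof -
  have "frag_eval M T w \<in> hom (free_Abelian_group T) M" by (rule frag_eval(1)[OF M w])
  from hom_mult[OF this, of x y] show ?thesis using x by simp
qed

lemma frag_eval_mult:
  assumes M: "comm_group M" and w: "\<And>c. c \<in> T \<Longrightarrow> w c \<in> carrier M" "\<And>c. c \<in> T \<Longrightarrow> w' c \<in> carrier M"
    and x: "Poly_Mapping.keys x \<subseteq> T"
  shows "frag_eval M T (\<lambda>c. w c \<otimes>\<^bsub>M\<^esub> w' c) x = frag_eval M T w x \<otimes>\<^bsub>M\<^esub> frag_eval M T w' x"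
proof -
  interpret M: comm_group M by fact
  have keys: "Poly_Mapping.keys (x + y) \<subseteq> T"
    if "Poly_Mapping.keys x \<subseteq> T" "Poly_Mapping.keys y \<subseteq> T" for x y :: "'c \<Rightarrow>\<^sub>0 int"
    using that keys_add[of x y] by blast
  show ?thesis
    by (rule frag_eval_unique[OF M _ _ _ x])
      (auto simp: w hom_def frag_eval(2,3)[OF M] frag_eval_add[OF M] M.m_ac)
qed

text \<open>The predicates under the choice operator are the same, so the chosen maps are equal as
  functions, also off the free group on \<open>T\<close>.\<close>

lemma frag_eval_cong:
  assumes "\<And>c. c \<in> T \<Longrightarrow> w c = w' c"
  shows "frag_eval M T w = frag_eval M T w'"
  using assms by (simp add: frag_eval_def)

text \<open>A larger finite set only adds zeros. This gives two formal sums and their total a common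
  index set, although the support of the total may be smaller.\<close>

lemma augmentation_eq_sum:
  assumes "finite S" "Poly_Mapping.keys x \<subseteq> S"
  shows "augmentation x = (\<Sum>c\<in>S. Poly_Mapping.lookup x c)"
  unfolding augmentation_def
  by (rule sum.mono_neutral_left) (use assms in \<open>auto simp: in_keys_iff\<close>)

lemma augmentation_add: "augmentation (x + y) = augmentation x + augmentation y"
proof -
  let ?S = "Poly_Mapping.keys x \<union> Poly_Mapping.keys y"
  have "augmentation (x + y) = (\<Sum>c\<in>?S. Poly_Mapping.lookup (x + y) c)"
    by (rule augmentation_eq_sum) (simp_all add: keys_add)
  also have "\<dots> = (\<Sum>c\<in>?S. Poly_Mapping.lookup x c) + (\<Sum>c\<in>?S. Poly_Mapping.lookup y c)"
    by (simp add: lookup_add sum.distrib)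
  finally show ?thesis by (simp add: augmentation_eq_sum[of ?S])
qed

lemma augmentation_frag_of [simp]: "augmentation (frag_of c) = 1"
  by (simp add: augmentation_def)

lemma augmentation_zero [simp]: "augmentation 0 = 0"
  by (simp add: augmentation_def)

lemma augmentation_minus: "augmentation (- x) = - augmentation x"
  using augmentation_add[of x "- x"] by simp

lemma augmentation_diff: "augmentation (x - y) = augmentation x - augmentation y"
  using augmentation_add[of x "- y"] by (simp add: augmentation_minus)

lemma augmentation_cmul: "augmentation (frag_cmul k x) = k * augmentation x"
proof -
  have "augmentation (frag_cmul k x) = (\<Sum>c\<in>Poly_Mapping.keys x. Poly_Mapping.lookup (frag_cmul k x) c)"
    by (rule augmentation_eq_sum[OF finite_keys keys_cmul])
  then show ?thesis by (simp add: augmentation_def sum_distrib_left)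
qed

text \<open>Labels that \<phi> identifies have their coefficients added, which leaves the total
  unchanged. In particular the action of \<open>G\<close> preserves the augmentation kernel.\<close>

lemma augmentation_extend_frag_of:
  "augmentation (frag_extend (\<lambda>c. frag_of (\<phi> c)) x) = augmentation x"
proof -
  have "Poly_Mapping.keys x \<subseteq> UNIV" by simp
  then show ?thesis
    by (rule free_Abelian_group_induct[of x UNIV]) (simp_all add: frag_extend_diff augmentation_diff)
qed

section \<open>Multilinear maps\<close>

text \<open>Additivity in slot \<open>i\<close> is expressed by overwriting that slot, matching the
  generators of \<open>multilinear_relations\<close>. For \<open>k = 0\<close> no condition remains
  and the map is a single value, at the empty tuple.\<close>

definition multilinear_maps :: "('g, 'a) gmod \<Rightarrow> ('g, 'm) gmod \<Rightarrow> nat \<Rightarrow> ('a list \<Rightarrow> 'm) set" where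
  "multilinear_maps A M k = {v \<in> tuples (carrier A) k \<rightarrow>\<^sub>E carrier M.
     \<forall>xs\<in>tuples (carrier A) k. \<forall>i<k. \<forall>x\<in>carrier A. \<forall>y\<in>carrier A.
       v (xs[i := x \<otimes>\<^bsub>A\<^esub> y]) = v (xs[i := x]) \<otimes>\<^bsub>M\<^esub> v (xs[i := y])}"

definition multilinear_module ::
    "('g, 'b) monoid_scheme \<Rightarrow> ('g, 'a) gmod \<Rightarrow> ('g, 'm) gmod \<Rightarrow> nat \<Rightarrow> ('g, 'a list \<Rightarrow> 'm) gmod" where
  "multilinear_module G A M k =
     function_module G (multilinear_maps A M k) (tuples (carrier A) k) M (\<lambda>g. map (act A g))"

lemma tuples_update:
  assumes "xs \<in> tuples S k" "x \<in> S"
  shows "xs[i := x] \<in> tuples S k"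
  using assms set_update_subset_insert[of xs i x] by (auto simp: tuples_def)

lemma tuples_Suc: "xs \<in> tuples S (Suc k) \<longleftrightarrow> (\<exists>y ys. xs = y # ys \<and> y \<in> S \<and> ys \<in> tuples S k)"
  by (auto simp: tuples_def length_Suc_conv)

lemma tuples_map:
  assumes "xs \<in> tuples S k" "\<And>x. x \<in> S \<Longrightarrow> \<phi> x \<in> S'"
  shows "map \<phi> xs \<in> tuples S' k"
  using assms by (auto simp: tuples_def)

lemma multilinear_mapsD:
  assumes "v \<in> multilinear_maps A M k"
  shows "\<And>xs. xs \<in> tuples (carrier A) k \<Longrightarrow> v xs \<in> carrier M" "v \<in> extensional (tuples (carrier A) k)"
    "\<And>xs i x y. xs \<in> tuples (carrier A) k \<Longrightarrow> i < k \<Longrightarrow> x \<in> carrier A \<Longrightarrow> y \<in> carrier A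
      \<Longrightarrow> v (xs[i := x \<otimes>\<^bsub>A\<^esub> y]) = v (xs[i := x]) \<otimes>\<^bsub>M\<^esub> v (xs[i := y])"
  using assms by (auto simp: multilinear_maps_def PiE_def)

lemma multilinear_mapsI:
  assumes "\<And>xs. xs \<in> tuples (carrier A) k \<Longrightarrow> v xs \<in> carrier M"
    "\<And>xs i x y. xs \<in> tuples (carrier A) k \<Longrightarrow> i < k \<Longrightarrow> x \<in> carrier A \<Longrightarrow> y \<in> carrier A
      \<Longrightarrow> v (xs[i := x \<otimes>\<^bsub>A\<^esub> y]) = v (xs[i := x]) \<otimes>\<^bsub>M\<^esub> v (xs[i := y])"
    and A: "comm_group A"
  shows "restrict v (tuples (carrier A) k) \<in> multilinear_maps A M k"
proof -
  interpret comm_group A by fact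
  show ?thesis using assms(1,2) by (auto simp: multilinear_maps_def tuples_update)
qed

lemma gmodule_multilinear_module:
  assumes G: "group G" and A: "gmodule G A" and M: "gmodule G M"
  shows "gmodule G (multilinear_module G A M k)"
proof -
  interpret G: group G by fact
  interpret A: comm_group A by (rule gmoduleD(1)[OF A])
  interpret M: comm_group M by (rule gmoduleD(1)[OF M])
  let ?T = "tuples (carrier A) k"
  have \<tau>: "map (act A g) xs \<in> ?T" if "g \<in> carrier G" "xs \<in> ?T" for g xs
    using tuples_map[OF that(2)] gmoduleD(4)[OF A that(1)] by blast
  show ?thesis
    unfolding multilinear_module_def
  proof (rule gmodule_function_module[OF G M])
    show "subgroup (multilinear_maps A M k) (product_group ?T (\<lambda>_. M))"
    proof (rule subgroup_product_groupI)
      show "multilinear_maps A M k \<subseteq> ?T \<rightarrow>\<^sub>E carrier M" by (auto simp: multilinear_maps_def)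
      have "(\<lambda>xs\<in>?T. \<one>\<^bsub>M\<^esub>) \<in> multilinear_maps A M k"
        by (rule multilinear_mapsI) (simp_all add: A.comm_group_axioms)
      then show "multilinear_maps A M k \<noteq> {}" by blast
      fix v w assume v: "v \<in> multilinear_maps A M k" and w: "w \<in> multilinear_maps A M k"
      show "(\<lambda>xs\<in>?T. v xs \<otimes>\<^bsub>M\<^esub> inv\<^bsub>M\<^esub> w xs) \<in> multilinear_maps A M k"
        by (rule multilinear_mapsI)
          (simp_all add: A.comm_group_axioms multilinear_mapsD[OF v] multilinear_mapsD[OF w] tuples_update
            M.mult_quotient)
    qed (rule M.is_group)
  next
    fix g v assume g: "g \<in> carrier G" and v: "v \<in> multilinear_maps A M k"
    show "(\<lambda>xs\<in>?T. act M g (v (map (act A (inv\<^bsub>G\<^esub> g)) xs))) \<in> multilinear_maps A M k"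
      by (rule multilinear_mapsI)
        (simp_all add: A.comm_group_axioms g \<tau> multilinear_mapsD[OF v] map_update tuples_update
          gmoduleD(4,5)[OF A] gmoduleD(4,5)[OF M])
  next
    fix xs assume xs: "xs \<in> ?T"
    then show "map (act A \<one>\<^bsub>G\<^esub>) xs = xs"
      by (intro map_idI) (auto simp: tuples_def gmoduleD(6)[OF A])
    fix g h assume "g \<in> carrier G" "h \<in> carrier G"
    then show "map (act A (g \<otimes>\<^bsub>G\<^esub> h)) xs = map (act A g) (map (act A h) xs)"
      using xs by (auto simp: tuples_def gmoduleD(7)[OF A])
  qed (rule \<tau>)
qed

section \<open>The augmentation kernel and the shift of multilinear maps\<close>

abbreviation frag_relabel :: "('a \<Rightarrow> 'c) \<Rightarrow> ('a \<Rightarrow>\<^sub>0 int) \<Rightarrow> 'c \<Rightarrow>\<^sub>0 int" where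
  "frag_relabel \<phi> \<equiv> frag_extend (\<lambda>c. frag_of (\<phi> c))"

lemma keys_frag_relabel:
  assumes "Poly_Mapping.keys x \<subseteq> T" "\<And>c. c \<in> T \<Longrightarrow> \<phi> c \<in> T'"
  shows "Poly_Mapping.keys (frag_relabel \<phi> x) \<subseteq> T'"
  using keys_frag_extend[of "\<lambda>c. frag_of (\<phi> c)" x] assms by auto

lemma frag_relabel_id:
  assumes "Poly_Mapping.keys x \<subseteq> T" "\<And>c. c \<in> T \<Longrightarrow> \<phi> c = c"
  shows "frag_relabel \<phi> x = x"
proof -
  have "frag_relabel \<phi> x = frag_extend frag_of x"
    by (rule frag_extend_eq) (use assms in auto)
  then show ?thesis using frag_expansion[of x] by simp
qed

lemma frag_relabel_comp:
  assumes "Poly_Mapping.keys x \<subseteq> T" "\<And>c. c \<in> T \<Longrightarrow> \<phi> c = \<phi>\<^sub>1 (\<phi>\<^sub>2 c)"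
  shows "frag_relabel \<phi> x = frag_relabel \<phi>\<^sub>1 (frag_relabel \<phi>\<^sub>2 x)"
proof -
  have "frag_relabel \<phi> x = frag_extend ((\<lambda>c. frag_of (\<phi>\<^sub>1 c)) \<circ> \<phi>\<^sub>2) x"
    by (rule frag_extend_eq) (use assms in auto)
  also have "\<dots> = frag_relabel \<phi>\<^sub>1 (frag_extend (frag_of \<circ> \<phi>\<^sub>2) x)"
    by (rule frag_extend_compose[symmetric])
  finally show ?thesis by (simp add: comp_def)
qed

text \<open>The shift sequence depends on the pair and on the coefficients alone; resolutions meet
  it later through a sublocale.\<close>

locale group_with_subgroup =
  fixes G :: "('g, 'b) monoid_scheme" and H :: "'g set"
  assumes G: "group G" and H: "subgroup H G"
begin

sublocale G: group G by (rule G)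

abbreviation "I \<equiv> augmentation_kernel G H"
abbreviation "Q \<equiv> lcosets\<^bsub>G\<^esub> H"

lemmas coset_act = G.lcosets_act[OF H]

lemma I_simps:
  "x \<in> carrier I \<longleftrightarrow> Poly_Mapping.keys x \<subseteq> Q \<and> augmentation x = 0"
  "x \<otimes>\<^bsub>I\<^esub> y = x + y" "\<one>\<^bsub>I\<^esub> = 0" "act I g x = frag_relabel (\<lambda>c. g <#\<^bsub>G\<^esub> c) x"
  by (auto simp: augmentation_kernel_def coset_module_def with_act_def kernel_def)

lemma gmodule_I: "gmodule G I"
  unfolding gmodule_def
proof (intro conjI ballI)
  have keys: "Poly_Mapping.keys (x + y) \<subseteq> Q" if "Poly_Mapping.keys x \<subseteq> Q" "Poly_Mapping.keys y \<subseteq> Q"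
    for x y :: "'g set \<Rightarrow>\<^sub>0 int"
    using that by (intro order_trans[OF keys_add Un_least])
  show "comm_group I"
  proof (rule comm_groupI)
    fix x assume "x \<in> carrier I"
    then show "\<exists>y\<in>carrier I. y \<otimes>\<^bsub>I\<^esub> x = \<one>\<^bsub>I\<^esub>"
      by (intro bexI[of _ "- x"]) (auto simp: I_simps augmentation_minus)
  qed (simp_all add: I_simps augmentation_add keys add_ac)
  fix g assume g: "g \<in> carrier G"
  show "act I g \<in> hom I I"
  proof (rule homI)
    fix x assume "x \<in> carrier I"
    then show "act I g x \<in> carrier I"
      using keys_frag_relabel[of x Q "\<lambda>c. g <#\<^bsub>G\<^esub> c" Q] coset_act(1)[OF g]
      by (simp add: I_simps augmentation_extend_frag_of)
  qed (simp add: I_simps frag_extend_add)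
next
  fix x assume "x \<in> carrier I"
  then have x: "Poly_Mapping.keys x \<subseteq> Q" by (simp add: I_simps)
  show "act I \<one>\<^bsub>G\<^esub> x = x"
    unfolding I_simps by (rule frag_relabel_id[OF x coset_act(2)])
  fix g h assume "g \<in> carrier G" "h \<in> carrier G"
  then show "act I (g \<otimes>\<^bsub>G\<^esub> h) x = act I g (act I h x)"
    unfolding I_simps by (intro frag_relabel_comp[OF x] coset_act(3))
qed

sublocale I: comm_group I by (rule gmoduleD(1)[OF gmodule_I])

lemma keys_I: "x \<in> carrier I \<Longrightarrow> Poly_Mapping.keys x \<subseteq> Q"
  by (simp add: I_simps)

lemma frag_diff_in_I: "c \<in> Q \<Longrightarrow> frag_of c - frag_of H \<in> carrier I"
  using keys_diff[of "frag_of c" "frag_of H"] coset_act(5) by (auto simp: I_simps augmentation_diff)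

text \<open>Restriction of homomorphisms from \<open>\<int>[G/H] \<otimes> I\<^sup>\<otimes>\<^sup>k\<close>, encoded as functions on cosets, to
  \<open>I \<otimes> I\<^sup>\<otimes>\<^sup>k\<close>.  Its kernel consists of the constant functions, and \<open>\<int>[G/H] = I \<oplus> \<int>H\<close> over \<open>H\<close>
  gives the section \<open>coset_section\<close> below.\<close>

definition coset_sum :: "('g, 'm) gmod \<Rightarrow> nat \<Rightarrow> ('g set \<Rightarrow> ('g set \<Rightarrow>\<^sub>0 int) list \<Rightarrow> 'm)
    \<Rightarrow> ('g set \<Rightarrow>\<^sub>0 int) list \<Rightarrow> 'm" where
  "coset_sum M k u = (\<lambda>xs\<in>tuples (carrier I) (Suc k). frag_eval M Q (\<lambda>c. u c (tl xs)) (hd xs))"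

lemma coset_sum_Cons:
  assumes "z \<in> carrier I" "ys \<in> tuples (carrier I) k"
  shows "coset_sum M k u (z # ys) = frag_eval M Q (\<lambda>c. u c ys) z"
  using assms by (simp add: coset_sum_def tuples_Suc)

text \<open>The new first slot is additive because evaluation is additive in the formal sum. The
  other slots are additive because evaluation at a fixed formal sum is additive in the
  weights.\<close>

lemma coset_sum_multilinear:
  assumes M: "gmodule G M" and u: "\<And>c. c \<in> Q \<Longrightarrow> u c \<in> multilinear_maps I M k"
  shows "coset_sum M k u \<in> multilinear_maps I M (Suc k)"
proof -
  note Mc = gmoduleD(1)[OF M]
  note uD = multilinear_mapsD[OF u]
  have "restrict (coset_sum M k u) (tuples (carrier I) (Suc k)) \<in> multilinear_maps I M (Suc k)"
  proof (rule multilinear_mapsI[OF _ _ I.comm_group_axioms])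
    fix xs assume "xs \<in> tuples (carrier I) (Suc k)"
    then obtain z ys where xs: "xs = z # ys" "z \<in> carrier I" "ys \<in> tuples (carrier I) k"
      by (auto simp: tuples_Suc)
    show "coset_sum M k u xs \<in> carrier M"
      unfolding xs(1) coset_sum_Cons[OF xs(2,3)]
      by (rule frag_eval(3)[OF Mc uD(1)[OF _ xs(3)] keys_I[OF xs(2)]])
    fix i x y assume i: "i < Suc k" and x: "x \<in> carrier I" and y: "y \<in> carrier I"
    show "coset_sum M k u (xs[i := x \<otimes>\<^bsub>I\<^esub> y])
        = coset_sum M k u (xs[i := x]) \<otimes>\<^bsub>M\<^esub> coset_sum M k u (xs[i := y])"
    proof (cases i)
      case 0
      have "frag_eval M Q (\<lambda>c. u c ys) (x + y)
          = frag_eval M Q (\<lambda>c. u c ys) x \<otimes>\<^bsub>M\<^esub> frag_eval M Q (\<lambda>c. u c ys) y"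
        by (rule frag_eval_add[OF Mc uD(1)[OF _ xs(3)] keys_I[OF x] keys_I[OF y]])
      then show ?thesis
        using coset_sum_Cons[OF I.m_closed[OF x y] xs(3), of M u] coset_sum_Cons[OF x xs(3), of M u]
          coset_sum_Cons[OF y xs(3), of M u]
        by (simp add: 0 xs(1) I_simps(2))
    next
      case (Suc j)
      have j: "j < k" using i Suc by simp
      note t = tuples_update[OF xs(3) x, of j] tuples_update[OF xs(3) y, of j]
        tuples_update[OF xs(3) I.m_closed[OF x y], of j]
      have "frag_eval M Q (\<lambda>c. u c (ys[j := x \<otimes>\<^bsub>I\<^esub> y])) z
          = frag_eval M Q (\<lambda>c. u c (ys[j := x]) \<otimes>\<^bsub>M\<^esub> u c (ys[j := y])) z"
        by (rule fun_cong[OF frag_eval_cong]) (rule uD(3)[OF _ xs(3) j x y])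
      also have "\<dots> = frag_eval M Q (\<lambda>c. u c (ys[j := x])) z \<otimes>\<^bsub>M\<^esub> frag_eval M Q (\<lambda>c. u c (ys[j := y])) z"
        by (rule frag_eval_mult[OF Mc uD(1)[OF _ t(1)] uD(1)[OF _ t(2)] keys_I[OF xs(2)]])
      finally show ?thesis
        by (simp add: Suc xs(1) coset_sum_Cons[OF xs(2)] t)
    qed
  qed
  then show ?thesis by (simp add: coset_sum_def)
qed

lemma coset_functions_multilinear_simps:
  "u \<in> carrier (coset_functions G H (multilinear_module G I M k))
    \<longleftrightarrow> u \<in> extensional Q \<and> (\<forall>c\<in>Q. u c \<in> multilinear_maps I M k)"
  "c \<in> Q \<Longrightarrow> ys \<in> tuples (carrier I) k \<Longrightarrow> (u \<otimes>\<^bsub>coset_functions G H (multilinear_module G I M k)\<^esub> u') c ys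
    = u c ys \<otimes>\<^bsub>M\<^esub> u' c ys"
  "c \<in> Q \<Longrightarrow> ys \<in> tuples (carrier I) k \<Longrightarrow> act (coset_functions G H (multilinear_module G I M k)) g u c ys
    = act M g (u (inv\<^bsub>G\<^esub> g <#\<^bsub>G\<^esub> c) (map (act I (inv\<^bsub>G\<^esub> g)) ys))"
  by (auto simp: coset_functions_def multilinear_module_def function_module_simps PiE_def)

lemma tuples_I_act: "g \<in> carrier G \<Longrightarrow> xs \<in> tuples (carrier I) k \<Longrightarrow> map (act I g) xs \<in> tuples (carrier I) k"
  using tuples_map[of xs _ k "act I g"] gmoduleD(4)[OF gmodule_I] by blast

text \<open>Equivariance is a reindexing: weighting \<open>z\<close> by \<open>g u(g^-1 c)\<close>
  gives \<open>g\<close> applied to the evaluation of \<open>u\<close> at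
  \<open>g^-1 z\<close>.\<close>

lemma coset_sum_ghom:
  assumes M: "gmodule G M"
  shows "coset_sum M k \<in> ghom G (coset_functions G H (multilinear_module G I M k))
    (multilinear_module G I M (Suc k))"
proof (rule ghomI)
  let ?C = "coset_functions G H (multilinear_module G I M k)"
  let ?T = "tuples (carrier I) (Suc k)"
  note Mc = gmoduleD(1)[OF M]
  note simps = coset_functions_multilinear_simps
  fix u assume u: "u \<in> carrier ?C"
  then have um: "u c \<in> multilinear_maps I M k" if "c \<in> Q" for c using that by (simp add: simps)
  note uD = multilinear_mapsD(1)[OF um]
  show "coset_sum M k u \<in> carrier (multilinear_module G I M (Suc k))"
    using coset_sum_multilinear[OF M um] by (simp add: multilinear_module_def function_module_simps)
  {
    fix u' assume "u' \<in> carrier ?C"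
    then have u'm: "u' c \<in> multilinear_maps I M k" if "c \<in> Q" for c using that by (simp add: simps)
    note u'D = multilinear_mapsD(1)[OF u'm]
    show "coset_sum M k (u \<otimes>\<^bsub>?C\<^esub> u') = coset_sum M k u \<otimes>\<^bsub>multilinear_module G I M (Suc k)\<^esub> coset_sum M k u'"
      unfolding multilinear_module_def[of _ _ _ "Suc k"] function_module_simps
    proof (rule extensionalityI)
      fix xs assume xsT: "xs \<in> ?T"
      then obtain z ys where xs: "xs = z # ys" "z \<in> carrier I" "ys \<in> tuples (carrier I) k"
        by (auto simp: tuples_Suc)
      have "frag_eval M Q (\<lambda>c. (u \<otimes>\<^bsub>?C\<^esub> u') c ys) z = frag_eval M Q (\<lambda>c. u c ys \<otimes>\<^bsub>M\<^esub> u' c ys) z"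
        by (rule fun_cong[OF frag_eval_cong]) (rule simps(2)[OF _ xs(3)])
      also have "\<dots> = frag_eval M Q (\<lambda>c. u c ys) z \<otimes>\<^bsub>M\<^esub> frag_eval M Q (\<lambda>c. u' c ys) z"
        by (rule frag_eval_mult[OF Mc uD[OF _ xs(3)] u'D[OF _ xs(3)] keys_I[OF xs(2)]])
      finally show "coset_sum M k (u \<otimes>\<^bsub>?C\<^esub> u') xs = (\<lambda>xs\<in>?T. coset_sum M k u xs \<otimes>\<^bsub>M\<^esub> coset_sum M k u' xs) xs"
        using xsT by (simp add: xs(1) coset_sum_Cons[OF xs(2,3)])
    qed (simp_all add: coset_sum_def)
  }
  fix g assume g: "g \<in> carrier G"
  note ginv = G.inv_closed[OF g]
  show "coset_sum M k (act ?C g u) = act (multilinear_module G I M (Suc k)) g (coset_sum M k u)"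
    unfolding multilinear_module_def[of _ _ _ "Suc k"] function_module_simps
  proof (rule extensionalityI)
    fix xs assume xsT: "xs \<in> ?T"
    then obtain z ys where xs: "xs = z # ys" "z \<in> carrier I" "ys \<in> tuples (carrier I) k"
      by (auto simp: tuples_Suc)
    let ?ys = "map (act I (inv\<^bsub>G\<^esub> g)) ys" and ?r = "frag_relabel (\<lambda>c. inv\<^bsub>G\<^esub> g <#\<^bsub>G\<^esub> c)"
    have ys: "?ys \<in> tuples (carrier I) k" by (rule tuples_I_act[OF ginv xs(3)])
    note E = frag_eval[OF Mc uD[OF _ ys]]
    have keys_r: "Poly_Mapping.keys (?r x) \<subseteq> Q" if "Poly_Mapping.keys x \<subseteq> Q" for x
      by (rule keys_frag_relabel[OF that coset_act(1)[OF ginv]])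
    \<comment> \<open>Both sides are additive in the formal sum, so it is enough to compare them at
      single cosets.\<close>
    have "frag_eval M Q (\<lambda>c. act M g (u (inv\<^bsub>G\<^esub> g <#\<^bsub>G\<^esub> c) ?ys)) z
        = act M g (frag_eval M Q (\<lambda>c. u c ?ys) (?r z))"
    proof (rule frag_eval_unique[OF Mc _ _ _ keys_I[OF xs(2)]])
      show "(\<lambda>x. act M g (frag_eval M Q (\<lambda>c. u c ?ys) (?r x))) \<in> hom (free_Abelian_group Q) M"
        by (rule homI) (simp_all add: keys_r E(3) gmoduleD(4,5)[OF M] g frag_extend_add
            frag_eval_add[OF Mc uD[OF _ ys]])
    qed (simp_all add: E(2) coset_act(1)[OF ginv] uD[OF _ ys] g gmoduleD(4)[OF M])
    moreover have "frag_eval M Q (\<lambda>c. act ?C g u c ys) = frag_eval M Q (\<lambda>c. act M g (u (inv\<^bsub>G\<^esub> g <#\<^bsub>G\<^esub> c) ?ys))"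
      by (rule frag_eval_cong) (rule simps(3)[OF _ xs(3)])
    ultimately show "coset_sum M k (act ?C g u) xs
        = (\<lambda>xs\<in>?T. act M g (coset_sum M k u (map (act I (inv\<^bsub>G\<^esub> g)) xs))) xs"
      using xsT coset_sum_Cons[OF gmoduleD(4)[OF gmodule_I ginv xs(2)] ys, of M u]
      by (simp add: xs(1) coset_sum_Cons[OF xs(2,3)] I_simps(4))
  qed (simp_all add: coset_sum_def)
qed

definition coset_section :: "nat \<Rightarrow> (('g set \<Rightarrow>\<^sub>0 int) list \<Rightarrow> 'm) \<Rightarrow> 'g set \<Rightarrow> ('g set \<Rightarrow>\<^sub>0 int) list \<Rightarrow> 'm" where
  "coset_section k v = (\<lambda>c\<in>Q. \<lambda>ys\<in>tuples (carrier I) k. v ((frag_of c - frag_of H) # ys))"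

text \<open>An element \<open>h\<close> of \<open>H\<close> carries \<open>c - H\<close> to
  \<open>hc - H\<close>, because it fixes the coset \<open>H\<close>. A general element of
  \<open>G\<close> moves that coset, so the section is equivariant only over
  \<open>H\<close>.\<close>

lemma coset_section_ghom:
  assumes M: "gmodule G M"
  shows "coset_section k \<in> ghom (G\<lparr>carrier := H\<rparr>) (multilinear_module G I M (Suc k))
    (coset_functions G H (multilinear_module G I M k))"
proof (rule ghomI)
  let ?C = "coset_functions G H (multilinear_module G I M k)"
  let ?B = "multilinear_module G I M (Suc k)"
  let ?T = "tuples (carrier I) k"
  fix v assume v': "v \<in> carrier ?B"
  then have v: "v \<in> multilinear_maps I M (Suc k)" by (simp add: multilinear_module_def function_module_simps)
  note vD = multilinear_mapsD[OF v]
  have Cons: "(frag_of c - frag_of H) # ys \<in> tuples (carrier I) (Suc k)" if "c \<in> Q" "ys \<in> ?T" for c ys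
    using frag_diff_in_I that by (simp add: tuples_Suc)
  have "(\<lambda>ys\<in>?T. v ((frag_of c - frag_of H) # ys)) \<in> multilinear_maps I M k" if c: "c \<in> Q" for c
  proof (rule multilinear_mapsI[OF _ _ I.comm_group_axioms])
    fix ys assume ys: "ys \<in> ?T"
    show "v ((frag_of c - frag_of H) # ys) \<in> carrier M" by (rule vD(1)[OF Cons[OF c ys]])
    fix i x y assume "i < k" "x \<in> carrier I" "y \<in> carrier I"
    then show "v ((frag_of c - frag_of H) # ys[i := x \<otimes>\<^bsub>I\<^esub> y])
        = v ((frag_of c - frag_of H) # ys[i := x]) \<otimes>\<^bsub>M\<^esub> v ((frag_of c - frag_of H) # ys[i := y])"
      using vD(3)[OF Cons[OF c ys], of "Suc i" x y] by simp
  qed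
  then show "coset_section k v \<in> carrier ?C"
    by (simp add: coset_functions_multilinear_simps coset_section_def)
  {
    fix w assume "w \<in> carrier ?B"
    show "coset_section k (v \<otimes>\<^bsub>?B\<^esub> w) = coset_section k v \<otimes>\<^bsub>?C\<^esub> coset_section k w"
      unfolding coset_section_def coset_functions_def multilinear_module_def function_module_simps
      using Cons by (auto intro!: restrict_ext)
  }
  fix h assume "h \<in> carrier (G\<lparr>carrier := H\<rparr>)"
  then have h: "h \<in> H" "h \<in> carrier G" using subgroup.subset[OF H] by auto
  note hinv = G.inv_closed[OF h(2)]
  have "act I (inv\<^bsub>G\<^esub> h) (frag_of c - frag_of H) = frag_of (inv\<^bsub>G\<^esub> h <#\<^bsub>G\<^esub> c) - frag_of H" for c
    using coset_act(4)[OF subgroup.m_inv_closed[OF H h(1)]] by (simp add: I_simps frag_extend_diff)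
  then show "coset_section k (act ?B h v) = act ?C h (coset_section k v)"
    unfolding coset_section_def coset_functions_def multilinear_module_def function_module_simps
    using Cons coset_act(1)[OF hinv] tuples_I_act[OF hinv] by (auto intro!: restrict_ext)
qed

lemma coset_sum_section:
  assumes M: "gmodule G M" and v: "v \<in> multilinear_maps I M (Suc k)"
  shows "coset_sum M k (coset_section k v) = v"
proof (rule extensionalityI)
  note Mc = gmoduleD(1)[OF M]
  note vD = multilinear_mapsD[OF v]
  show "v \<in> extensional (tuples (carrier I) (Suc k))" by (rule vD(2))
  fix xs assume "xs \<in> tuples (carrier I) (Suc k)"
  then obtain z ys where xs: "xs = z # ys" "z \<in> carrier I" "ys \<in> tuples (carrier I) k"
    by (auto simp: tuples_Suc)
  \<comment> \<open>The projection of \<open>Z[G/H]\<close> onto \<open>I\<close> along the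
    multiples of the coset \<open>H\<close>. It sends \<open>c\<close> to \<open>c - H\<close>, so
    \<open>v\<close> composed with it is the additive map with the weights of
    \<open>coset_section\<close>; on \<open>I\<close> it is the identity, which recovers
    \<open>v\<close>.\<close>
  let ?n = "\<lambda>x. x - frag_cmul (augmentation x) (frag_of H)"
  have n: "?n x \<in> carrier I" if "Poly_Mapping.keys x \<subseteq> Q" for x
    using that keys_diff[of x "frag_cmul (augmentation x) (frag_of H)"] coset_act(5)
      keys_cmul[of "augmentation x" "frag_of H"]
    by (auto simp: I_simps augmentation_diff augmentation_cmul)
  have Cons: "x # ys \<in> tuples (carrier I) (Suc k)" if "x \<in> carrier I" for x
    using that xs(3) by (simp add: tuples_Suc)
  have "frag_eval M Q (\<lambda>c. v ((frag_of c - frag_of H) # ys)) z = v (?n z # ys)"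
  proof (rule frag_eval_unique[OF Mc _ _ _ keys_I[OF xs(2)]])
    show "(\<lambda>x. v (?n x # ys)) \<in> hom (free_Abelian_group Q) M"
    proof (rule homI)
      fix x y assume "x \<in> carrier (free_Abelian_group Q)" "y \<in> carrier (free_Abelian_group Q)"
      then have x: "Poly_Mapping.keys x \<subseteq> Q" "Poly_Mapping.keys y \<subseteq> Q" by simp_all
      show "v (?n x # ys) \<in> carrier M" by (rule vD(1)[OF Cons[OF n[OF x(1)]]])
      have "?n (x + y) = ?n x \<otimes>\<^bsub>I\<^esub> ?n y"
        by (simp add: I_simps augmentation_add frag_cmul_distrib)
      then show "v (?n (x \<otimes>\<^bsub>free_Abelian_group Q\<^esub> y) # ys) = v (?n x # ys) \<otimes>\<^bsub>M\<^esub> v (?n y # ys)"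
        using vD(3)[OF Cons[OF n[OF x(1)]], of 0, OF _ n[OF x(1)] n[OF x(2)]] by simp
    qed
  qed (simp_all add: vD(1) Cons frag_diff_in_I)
  moreover have "frag_eval M Q (\<lambda>c. coset_section k v c ys) = frag_eval M Q (\<lambda>c. v ((frag_of c - frag_of H) # ys))"
    by (rule frag_eval_cong) (simp add: coset_section_def xs(3))
  ultimately show "coset_sum M k (coset_section k v) xs = v xs"
    using xs(2) by (simp add: xs(1) coset_sum_Cons[OF xs(2,3)] I_simps(1))
qed (simp add: coset_sum_def)

text \<open>Pullback along the augmentation of \<open>Z[G/H]\<close>, which takes the value 1 on
  every coset.\<close>

definition coset_const :: "'a \<Rightarrow> 'g set \<Rightarrow> 'a" where
  "coset_const a = (\<lambda>c\<in>Q. a)"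

lemma coset_const_inj: "inj_on coset_const S"
proof (rule inj_onI)
  fix a b :: 'a assume "coset_const a = coset_const b"
  then have "coset_const a H = coset_const b H" by simp
  then show "a = b" using coset_act(5) by (simp add: coset_const_def)
qed

lemma coset_const_ghom:
  assumes A: "gmodule G A"
  shows "coset_const \<in> ghom G A (coset_functions G H A)"
  by (rule ghomI)
    (auto simp: coset_const_def coset_functions_def function_module_simps coset_act(1) intro!: restrict_ext)

text \<open>Evaluation at \<open>c - H\<close>, an element of \<open>I\<close>, compares
  \<open>u c\<close> with \<open>u H\<close>. Conversely a constant weight evaluates at
  \<open>z\<close> to its multiple by the augmentation of \<open>z\<close>, which is 0 on
  \<open>I\<close>.\<close>

lemma kernel_coset_sum:
  assumes M: "gmodule G M"
  shows "kernel (coset_functions G H (multilinear_module G I M k)) (multilinear_module G I M (Suc k))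
    (coset_sum M k) = coset_const ` carrier (multilinear_module G I M k)" (is "kernel ?C ?B _ = _ ` carrier ?A")
proof
  note Mc = gmoduleD(1)[OF M]
  interpret M: comm_group M by (rule Mc)
  note simps = coset_functions_multilinear_simps
  let ?T = "tuples (carrier I) (Suc k)"
  have one: "\<one>\<^bsub>?B\<^esub> = (\<lambda>xs\<in>?T. \<one>\<^bsub>M\<^esub>)" and A: "carrier ?A = multilinear_maps I M k"
    by (simp_all add: multilinear_module_def function_module_simps)
  show "kernel ?C ?B (coset_sum M k) \<subseteq> coset_const ` carrier ?A"
  proof
    fix u assume "u \<in> kernel ?C ?B (coset_sum M k)"
    then have u: "u \<in> carrier ?C" and u0: "coset_sum M k u = (\<lambda>xs\<in>?T. \<one>\<^bsub>M\<^esub>)"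
      by (auto simp: kernel_def one)
    have um: "u c \<in> multilinear_maps I M k" if "c \<in> Q" for c using u that by (simp add: simps)
    have "u c = u H" if c: "c \<in> Q" for c
    proof (rule extensionalityI)
      fix ys assume ys: "ys \<in> tuples (carrier I) k"
      note uD = multilinear_mapsD(1)[OF um ys]
      note E = frag_eval[OF Mc, of Q "\<lambda>c. u c ys", OF uD]
      have z: "frag_of c - frag_of H \<in> carrier I" by (rule frag_diff_in_I[OF c])
      have "frag_eval M Q (\<lambda>c. u c ys) (frag_of c - frag_of H) = \<one>\<^bsub>M\<^esub>"
        using coset_sum_Cons[OF z ys, of M u] u0 z ys by (simp add: tuples_Suc)
      moreover have "frag_eval M Q (\<lambda>c. u c ys) (frag_of c - frag_of H + frag_of H)
          = frag_eval M Q (\<lambda>c. u c ys) (frag_of c - frag_of H) \<otimes>\<^bsub>M\<^esub> frag_eval M Q (\<lambda>c. u c ys) (frag_of H)"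
        using coset_act(5) by (intro frag_eval_add[OF Mc uD keys_I[OF z]]) simp_all
      ultimately show "u c ys = u H ys"
        using c coset_act(5) by (simp add: E(2) uD)
    qed (use multilinear_mapsD(2)[OF um] c coset_act(5) in blast)+
    moreover have "u \<in> extensional Q" using u by (simp add: simps)
    ultimately have "u = coset_const (u H)"
      by (intro extensionalityI[of _ Q]) (auto simp: coset_const_def)
    then show "u \<in> coset_const ` carrier ?A" using um[OF coset_act(5)] A by blast
  qed
  show "coset_const ` carrier ?A \<subseteq> kernel ?C ?B (coset_sum M k)"
  proof
    fix u assume "u \<in> coset_const ` carrier ?A"
    then obtain a where a: "a \<in> multilinear_maps I M k" "u = coset_const a" by (auto simp: A)
    have "coset_sum M k u = (\<lambda>xs\<in>?T. \<one>\<^bsub>M\<^esub>)"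
    proof (rule extensionalityI)
      fix xs assume xsT: "xs \<in> ?T"
      then obtain z ys where xs: "xs = z # ys" "z \<in> carrier I" "ys \<in> tuples (carrier I) k"
        by (auto simp: tuples_Suc)
      have ac: "a ys \<in> carrier M" by (rule multilinear_mapsD(1)[OF a(1) xs(3)])
      have "frag_eval M Q (\<lambda>c. u c ys) z = a ys [^]\<^bsub>M\<^esub> augmentation z"
      proof (rule frag_eval_unique[OF Mc _ _ _ keys_I[OF xs(2)]])
        show "(\<lambda>z. a ys [^]\<^bsub>M\<^esub> augmentation z) \<in> hom (free_Abelian_group Q) M"
          by (auto simp: hom_def ac augmentation_add M.int_pow_mult)
      qed (simp_all add: a(2) coset_const_def ac)
      then show "coset_sum M k u xs = (\<lambda>xs\<in>?T. \<one>\<^bsub>M\<^esub>) xs"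
        using xsT xs(2) by (simp add: xs(1) coset_sum_Cons[OF xs(2,3)] I_simps(1))
    qed (simp_all add: coset_sum_def)
    then show "u \<in> kernel ?C ?B (coset_sum M k)"
      using a by (simp add: kernel_def one simps coset_const_def)
  qed
qed

lemma coset_sum_rel_epi:
  assumes M: "gmodule G M"
  shows "rel_epi G H (coset_functions G H (multilinear_module G I M k)) (coset_sum M k)
    (multilinear_module G I M (Suc k))" (is "rel_epi G H ?C ?\<pi> ?B")
proof -
  have C: "gmodule G ?C"
    by (rule gmodule_coset_functions[OF G H gmodule_multilinear_module[OF G gmodule_I M]])
  have B: "gmodule G ?B" by (rule gmodule_multilinear_module[OF G gmodule_I M])
  have \<pi>: "?\<pi> \<in> ghom G ?C ?B" by (rule coset_sum_ghom[OF M])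
  note s = coset_section_ghom[OF M, of k]
  have \<pi>s: "?\<pi> (coset_section k v) = v" if "v \<in> carrier ?B" for v
    using coset_sum_section[OF M] that by (simp add: multilinear_module_def function_module_simps)
  have "?\<pi> ` carrier ?C = carrier ?B"
  proof
    show "?\<pi> ` carrier ?C \<subseteq> carrier ?B" using ghomD(2)[OF \<pi>] by blast
    show "carrier ?B \<subseteq> ?\<pi> ` carrier ?C" using ghomD(2)[OF s] \<pi>s by (metis image_eqI subsetI)
  qed
  then show ?thesis
    using direct_summand_of_section[OF gmodule_subgroup[OF C H] gmodule_subgroup[OF B H] ghom_subgroup[OF \<pi> H] s]
      \<pi>s C B \<pi> by (simp add: rel_epi_def)
qed

end

sublocale adamson_resolution \<subseteq> pair: group_with_subgroup G H
  by (rule group_with_subgroup.intro[OF G H])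

text \<open>Constants embed multilinear maps in \<open>k\<close> arguments into functions on cosets,
  with multilinear maps in \<open>k + 1\<close> arguments as quotient: one degree is exchanged for
  one more argument from \<open>I\<close>.\<close>

lemma (in adamson_resolution) multilinear_shift:
  assumes M: "gmodule G M"
  shows "adamson_cohomology G P d (multilinear_module G (augmentation_kernel G H) M k) (Suc (Suc m))
    \<cong> adamson_cohomology G P d (multilinear_module G (augmentation_kernel G H) M (Suc k)) (Suc m)"
proof -
  have A: "gmodule G (multilinear_module G (augmentation_kernel G H) M k)"
    by (rule gmodule_multilinear_module[OF G pair.gmodule_I M])
  show ?thesis
    by (rule dimension_shift[OF A pair.coset_const_ghom[OF A] pair.coset_const_inj
          pair.coset_sum_rel_epi[OF M] pair.kernel_coset_sum[OF M]])
      (rule coset_functions_acyclic[OF A])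
qed

section \<open>Homomorphisms out of tensor powers\<close>

lemma gmodule_hom_module:
  assumes G: "group G" and A: "gmodule G A" and B: "gmodule G B"
  shows "gmodule G (hom_module G A B)"
proof -
  interpret G: group G by fact
  interpret A: comm_group A by (rule gmoduleD(1)[OF A])
  interpret B: comm_group B by (rule gmoduleD(1)[OF B])
  show ?thesis
    unfolding hom_module_eq_function_module
  proof (rule gmodule_function_module[OF G B])
    show "subgroup (hom A B \<inter> extensional (carrier A)) (product_group (carrier A) (\<lambda>_. B))"
    proof (rule subgroup_product_groupI)
      show "hom A B \<inter> extensional (carrier A) \<subseteq> carrier A \<rightarrow>\<^sub>E carrier B"
        by (auto simp: hom_def PiE_def)
      have "(\<lambda>x\<in>carrier A. \<one>\<^bsub>B\<^esub>) \<in> hom A B \<inter> extensional (carrier A)" by (auto simp: hom_def)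
      then show "hom A B \<inter> extensional (carrier A) \<noteq> {}" by blast
      fix f f' assume "f \<in> hom A B \<inter> extensional (carrier A)" "f' \<in> hom A B \<inter> extensional (carrier A)"
      then show "(\<lambda>x\<in>carrier A. f x \<otimes>\<^bsub>B\<^esub> inv\<^bsub>B\<^esub> f' x) \<in> hom A B \<inter> extensional (carrier A)"
        by (auto simp: hom_def Pi_iff B.mult_quotient)
    qed (rule B.is_group)
  next
    fix g f assume "g \<in> carrier G" "f \<in> hom A B \<inter> extensional (carrier A)"
    then show "(\<lambda>x\<in>carrier A. act B g (f (act A (inv\<^bsub>G\<^esub> g) x))) \<in> hom A B \<inter> extensional (carrier A)"
      by (auto simp: hom_def Pi_iff gmoduleD(4,5)[OF A] gmoduleD(4,5)[OF B])
  qed (simp_all add: gmoduleD[OF A])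
qed

locale tensor_module =
  fixes G :: "('g, 'b) monoid_scheme" and A :: "('g, 'a) gmod" and k :: nat
  assumes G: "group G" and A: "gmodule G A"
begin

sublocale G: group G by (rule G)
sublocale A: comm_group A by (rule gmoduleD(1)[OF A])

abbreviation "T \<equiv> tuples (carrier A) k"
abbreviation "F \<equiv> free_Abelian_group T"
abbreviation "R \<equiv> multilinear_relations A k"

sublocale F: comm_group F by (rule abelian_free_Abelian_group)

definition relators :: "('a list \<Rightarrow>\<^sub>0 int) set" where
  "relators = {frag_of (xs[i := x \<otimes>\<^bsub>A\<^esub> y]) - frag_of (xs[i := x]) - frag_of (xs[i := y]) | xs i x y.
     xs \<in> T \<and> i < k \<and> x \<in> carrier A \<and> y \<in> carrier A}"

lemma R_eq: "R = generate F relators"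
  by (simp add: multilinear_relations_def relators_def)

lemma relators_subset: "relators \<subseteq> carrier F"
proof
  fix r assume "r \<in> relators"
  then obtain xs i x y where r: "r = frag_of (xs[i := x \<otimes>\<^bsub>A\<^esub> y]) - frag_of (xs[i := x]) - frag_of (xs[i := y])"
    "xs \<in> T" "x \<in> carrier A" "y \<in> carrier A"
    by (auto simp: relators_def)
  have "xs[i := x \<otimes>\<^bsub>A\<^esub> y] \<in> T" "xs[i := x] \<in> T" "xs[i := y] \<in> T"
    using r by (simp_all add: tuples_update)
  then show "r \<in> carrier F"
    unfolding r(1) carrier_free_Abelian_group_iff
    by (intro order_trans[OF keys_diff Un_least]) simp_all
qed

lemma subgroup_R: "subgroup R F"
  unfolding R_eq by (rule F.generate_is_subgroup[OF relators_subset])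

sublocale R: normal R F by (rule F.subgroup_imp_normal[OF subgroup_R])

lemma tuples_act: "g \<in> carrier G \<Longrightarrow> xs \<in> T \<Longrightarrow> map (act A g) xs \<in> T"
  using tuples_map[of xs "carrier A" k "act A g" "carrier A"] gmoduleD(4)[OF A] by blast

lemma relabel_closed: "g \<in> carrier G \<Longrightarrow> x \<in> carrier F \<Longrightarrow> frag_relabel (map (act A g)) x \<in> carrier F"
  unfolding carrier_free_Abelian_group_iff by (rule keys_frag_relabel[OF _ tuples_act])

lemma relabel_R:
  assumes g: "g \<in> carrier G" and r: "r \<in> R"
  shows "frag_relabel (map (act A g)) r \<in> R"
proof -
  interpret t: group_hom F F "frag_relabel (map (act A g))"
    using relabel_closed[OF g]
    by (simp add: group_hom_def group_hom_axioms_def F.is_group hom_def frag_extend_add)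
  have "frag_relabel (map (act A g)) ` relators \<subseteq> relators"
  proof
    fix s assume "s \<in> frag_relabel (map (act A g)) ` relators"
    then obtain xs i x y where s: "xs \<in> T" "i < k" "x \<in> carrier A" "y \<in> carrier A"
      "s = frag_relabel (map (act A g)) (frag_of (xs[i := x \<otimes>\<^bsub>A\<^esub> y]) - frag_of (xs[i := x]) - frag_of (xs[i := y]))"
      by (auto simp: relators_def)
    let ?xs = "map (act A g) xs" and ?x = "act A g x" and ?y = "act A g y"
    have "s = frag_of (?xs[i := ?x \<otimes>\<^bsub>A\<^esub> ?y]) - frag_of (?xs[i := ?x]) - frag_of (?xs[i := ?y])"
      using s(3,4) g by (simp add: s(5) frag_extend_diff map_update gmoduleD(5)[OF A])
    then show "s \<in> relators"
      using s(2) tuples_act[OF g s(1)] gmoduleD(4)[OF A g s(3)] gmoduleD(4)[OF A g s(4)]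
      unfolding relators_def by blast
  qed
  then have "generate F (frag_relabel (map (act A g)) ` relators) \<subseteq> generate F relators"
    by (rule F.mono_generate)
  then show ?thesis using r unfolding R_eq t.generate_img[OF relators_subset] by blast
qed

lemma relabel_inverse:
  assumes g: "g \<in> carrier G" and x: "x \<in> carrier F"
  shows "frag_relabel (map (act A g)) (frag_relabel (map (act A (inv\<^bsub>G\<^esub> g))) x) = x"
proof -
  have x': "Poly_Mapping.keys x \<subseteq> T" using x by simp
  have *: "map (act A g) (map (act A (inv\<^bsub>G\<^esub> g)) xs) = xs" if "xs \<in> T" for xs
    using that g unfolding map_map
    by (intro map_idI) (auto simp: tuples_def gmodule_act_inverse[OF G A])
  have "frag_relabel (\<lambda>xs. map (act A g) (map (act A (inv\<^bsub>G\<^esub> g)) xs)) x = x"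
    by (rule frag_relabel_id[OF x' *])
  then show ?thesis
    using frag_relabel_comp[OF x', of "\<lambda>xs. map (act A g) (map (act A (inv\<^bsub>G\<^esub> g)) xs)"
        "map (act A g)" "map (act A (inv\<^bsub>G\<^esub> g))"] by simp
qed

text \<open>The action on the quotient is an image of sets. For this to be a coset again,
  \<open>R\<close> has to be mapped onto itself and not only into itself; the inclusion for the
  inverse of \<open>g\<close> supplies the preimages.\<close>

lemma relabel_coset:
  assumes g: "g \<in> carrier G" and x: "x \<in> carrier F"
  shows "frag_relabel (map (act A g)) ` (R #>\<^bsub>F\<^esub> x) = R #>\<^bsub>F\<^esub> frag_relabel (map (act A g)) x"
proof -
  have "frag_relabel (map (act A g)) ` R = R"
  proof
    show "frag_relabel (map (act A g)) ` R \<subseteq> R" using relabel_R[OF g] by blast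
    show "R \<subseteq> frag_relabel (map (act A g)) ` R"
    proof
      fix r assume r: "r \<in> R"
      then have "r \<in> carrier F" using R.subset by blast
      then have "r = frag_relabel (map (act A g)) (frag_relabel (map (act A (inv\<^bsub>G\<^esub> g))) r)"
        by (rule relabel_inverse[OF g, symmetric])
      then show "r \<in> frag_relabel (map (act A g)) ` R"
        using relabel_R[OF G.inv_closed[OF g] r] by (rule image_eqI)
    qed
  qed
  then have "(\<lambda>r. r + frag_relabel (map (act A g)) x) ` R
      = (\<lambda>r. r + frag_relabel (map (act A g)) x) ` frag_relabel (map (act A g)) ` R" by simp
  then show ?thesis
    by (simp add: r_coset_def frag_extend_add image_image UNION_singleton_eq_range flip: image_UN)
qed

lemma tensor_simps:
  "carrier (tensor_power A k) = (\<lambda>x. R #>\<^bsub>F\<^esub> x) ` carrier F"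
  "x \<in> carrier F \<Longrightarrow> y \<in> carrier F
    \<Longrightarrow> (R #>\<^bsub>F\<^esub> x) \<otimes>\<^bsub>tensor_power A k\<^esub> (R #>\<^bsub>F\<^esub> y) = R #>\<^bsub>F\<^esub> (x + y)"
  "g \<in> carrier G \<Longrightarrow> x \<in> carrier F
    \<Longrightarrow> act (tensor_power A k) g (R #>\<^bsub>F\<^esub> x) = R #>\<^bsub>F\<^esub> frag_relabel (map (act A g)) x"
  by (simp_all add: tensor_power_def with_act_def carrier_FactGroup R.rcos_sum relabel_coset
      del: carrier_free_Abelian_group_iff)

lemma gmodule_tensor_power: "gmodule G (tensor_power A k)"
  unfolding gmodule_def
proof (intro conjI ballI)
  show "comm_group (tensor_power A k)"
    unfolding tensor_power_def by (rule comm_group_with_act[OF F.abelian_FactGroup[OF subgroup_R]])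
  note cases = imageE[of _ "\<lambda>x. R #>\<^bsub>F\<^esub> x" "carrier F", folded tensor_simps(1)]
  fix g assume g: "g \<in> carrier G"
  show "act (tensor_power A k) g \<in> hom (tensor_power A k) (tensor_power A k)"
  proof (rule homI)
    fix x assume "x \<in> carrier (tensor_power A k)"
    then obtain a where a: "x = R #>\<^bsub>F\<^esub> a" "a \<in> carrier F" by (rule cases)
    show "act (tensor_power A k) g x \<in> carrier (tensor_power A k)"
      unfolding a(1) tensor_simps(3)[OF g a(2)] using relabel_closed[OF g a(2)]
      unfolding tensor_simps(1) by (rule imageI)
    fix y assume "y \<in> carrier (tensor_power A k)"
    then obtain b where b: "y = R #>\<^bsub>F\<^esub> b" "b \<in> carrier F" by (rule cases)
    have ab: "a + b \<in> carrier F" using F.m_closed[OF a(2) b(2)] by simp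
    show "act (tensor_power A k) g (x \<otimes>\<^bsub>tensor_power A k\<^esub> y)
        = act (tensor_power A k) g x \<otimes>\<^bsub>tensor_power A k\<^esub> act (tensor_power A k) g y"
      unfolding a(1) b(1) tensor_simps(2)[OF a(2) b(2)] tensor_simps(3)[OF g a(2)] tensor_simps(3)[OF g b(2)]
        tensor_simps(3)[OF g ab] tensor_simps(2)[OF relabel_closed[OF g a(2)] relabel_closed[OF g b(2)]]
        frag_extend_add ..
  qed
next
  note cases = imageE[of _ "\<lambda>x. R #>\<^bsub>F\<^esub> x" "carrier F", folded tensor_simps(1)]
  fix x assume "x \<in> carrier (tensor_power A k)"
  then obtain a where a: "x = R #>\<^bsub>F\<^esub> a" "a \<in> carrier F" by (rule cases)
  have a': "Poly_Mapping.keys a \<subseteq> T" using a(2) by simp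
  have "frag_relabel (map (act A \<one>\<^bsub>G\<^esub>)) a = a"
    by (rule frag_relabel_id[OF a'], rule map_idI) (auto simp: tuples_def gmoduleD(6)[OF A])
  then show "act (tensor_power A k) \<one>\<^bsub>G\<^esub> x = x"
    by (simp only: a(1) tensor_simps(3)[OF G.one_closed a(2)])
  fix g h assume g: "g \<in> carrier G" and h: "h \<in> carrier G"
  have "frag_relabel (map (act A (g \<otimes>\<^bsub>G\<^esub> h))) a = frag_relabel (map (act A g)) (frag_relabel (map (act A h)) a)"
    by (rule frag_relabel_comp[OF a']) (auto simp: tuples_def gmoduleD(7)[OF A g h])
  then show "act (tensor_power A k) (g \<otimes>\<^bsub>G\<^esub> h) x = act (tensor_power A k) g (act (tensor_power A k) h x)"
    by (simp only: a(1) tensor_simps(3)[OF G.m_closed[OF g h] a(2)] tensor_simps(3)[OF h a(2)]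
        tensor_simps(3)[OF g relabel_closed[OF h a(2)]])
qed

lemma coset_add_relation:
  assumes "r \<in> R" "x \<in> carrier F"
  shows "R #>\<^bsub>F\<^esub> (r + x) = R #>\<^bsub>F\<^esub> x"
proof -
  have r: "r \<in> carrier F" using R.subset assms(1) by blast
  have "R #>\<^bsub>F\<^esub> (r \<otimes>\<^bsub>F\<^esub> x) = R #>\<^bsub>F\<^esub> r #>\<^bsub>F\<^esub> x"
    by (rule F.coset_mult_assoc[symmetric, OF R.subset r assms(2)])
  also have "R #>\<^bsub>F\<^esub> r = R" by (rule F.coset_join2[OF r subgroup_R assms(1)])
  finally show ?thesis by simp
qed

text \<open>Restriction to pure tensors: the coset of \<open>frag_of xs\<close> is the tensor
  product of the entries of \<open>xs\<close>.\<close>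

definition tensor_restrict :: "(('a list \<Rightarrow>\<^sub>0 int) set \<Rightarrow> 'm) \<Rightarrow> 'a list \<Rightarrow> 'm" where
  "tensor_restrict \<phi> = (\<lambda>xs\<in>T. \<phi> (R #>\<^bsub>F\<^esub> frag_of xs))"

lemma tensor_restrict_ghom:
  assumes M: "gmodule G M"
  shows "tensor_restrict \<in> ghom G (hom_module G (tensor_power A k) M) (multilinear_module G A M k)"
proof (rule ghomI)
  let ?N = "tensor_power A k"
  fix \<phi> assume "\<phi> \<in> carrier (hom_module G ?N M)"
  then have \<phi>: "\<phi> \<in> hom ?N M" by (simp add: hom_module_eq_function_module function_module_simps)
  have of: "frag_of xs \<in> carrier F" if "xs \<in> T" for xs using that by simp
  have cl: "R #>\<^bsub>F\<^esub> frag_of xs \<in> carrier ?N" if "xs \<in> T" for xs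
    unfolding tensor_simps(1) using of[OF that] by (rule imageI)
  have "tensor_restrict \<phi> \<in> multilinear_maps A M k"
    unfolding tensor_restrict_def
  proof (rule multilinear_mapsI[OF _ _ A.comm_group_axioms])
    fix xs assume xs: "xs \<in> T"
    show "\<phi> (R #>\<^bsub>F\<^esub> frag_of xs) \<in> carrier M" using hom_in_carrier[OF \<phi> cl[OF xs]] .
    fix i x y assume i: "i < k" "x \<in> carrier A" "y \<in> carrier A"
    let ?r = "frag_of (xs[i := x \<otimes>\<^bsub>A\<^esub> y]) - frag_of (xs[i := x]) - frag_of (xs[i := y])"
    have "?r \<in> relators" using xs i unfolding relators_def by blast
    then have r: "?r \<in> R" unfolding R_eq by (rule generate.incl)
    have t: "xs[i := x] \<in> T" "xs[i := y] \<in> T" using xs i by (simp_all add: tuples_update)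
    \<comment> \<open>Adding \<open>?r\<close> to this sum gives \<open>frag_of\<close> of the tuple
      with the product in slot \<open>i\<close>; as \<open>?r\<close> lies in \<open>R\<close>, the
      two have the same coset.\<close>
    have "frag_of (xs[i := x]) + frag_of (xs[i := y]) \<in> carrier F"
      using F.m_closed[OF of[OF t(1)] of[OF t(2)]] by simp
    from coset_add_relation[OF r this]
    have "R #>\<^bsub>F\<^esub> frag_of (xs[i := x \<otimes>\<^bsub>A\<^esub> y]) = R #>\<^bsub>F\<^esub> (frag_of (xs[i := x]) + frag_of (xs[i := y]))"
      by simp
    also have "\<dots> = (R #>\<^bsub>F\<^esub> frag_of (xs[i := x])) \<otimes>\<^bsub>?N\<^esub> (R #>\<^bsub>F\<^esub> frag_of (xs[i := y]))"
      by (rule tensor_simps(2)[OF of[OF t(1)] of[OF t(2)], symmetric])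
    finally show "\<phi> (R #>\<^bsub>F\<^esub> frag_of (xs[i := x \<otimes>\<^bsub>A\<^esub> y]))
        = \<phi> (R #>\<^bsub>F\<^esub> frag_of (xs[i := x])) \<otimes>\<^bsub>M\<^esub> \<phi> (R #>\<^bsub>F\<^esub> frag_of (xs[i := y]))"
      by (simp only: hom_mult[OF \<phi> cl[OF t(1)] cl[OF t(2)]])
  qed
  then show "tensor_restrict \<phi> \<in> carrier (multilinear_module G A M k)"
    by (simp add: multilinear_module_def function_module_simps)
  {
    fix \<psi>
    show "tensor_restrict (\<phi> \<otimes>\<^bsub>hom_module G ?N M\<^esub> \<psi>)
        = tensor_restrict \<phi> \<otimes>\<^bsub>multilinear_module G A M k\<^esub> tensor_restrict \<psi>"
      unfolding hom_module_eq_function_module multilinear_module_def function_module_simps tensor_restrict_def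
      by (rule restrict_ext) (simp add: cl)
  }
  fix g assume g: "g \<in> carrier G"
  show "tensor_restrict (act (hom_module G ?N M) g \<phi>)
      = act (multilinear_module G A M k) g (tensor_restrict \<phi>)"
    unfolding hom_module_eq_function_module multilinear_module_def function_module_simps tensor_restrict_def
    by (rule restrict_ext)
      (simp add: cl tensor_simps(3)[OF G.inv_closed[OF g] of] tuples_act[OF G.inv_closed[OF g]])
qed

text \<open>Injective because the pure tensors generate the tensor power. Surjective because the
  additive extension of a multilinear map kills every relator and so descends to the
  quotient.\<close>

lemma tensor_restrict_bij:
  assumes M: "gmodule G M"
  shows "bij_betw tensor_restrict (carrier (hom_module G (tensor_power A k) M))
    (carrier (multilinear_module G A M k))"
  unfolding bij_betw_def
proof
  let ?N = "tensor_power A k"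
  interpret M: comm_group M by (rule gmoduleD(1)[OF M])
  have carr: "carrier (hom_module G ?N M) = hom ?N M \<inter> extensional (carrier ?N)"
    by (simp add: hom_module_eq_function_module function_module_simps)
  have proj: "(\<lambda>x. R #>\<^bsub>F\<^esub> x) \<in> hom F ?N"
    by (rule homI) (simp_all add: tensor_simps(1,2) del: carrier_free_Abelian_group_iff)
  show "inj_on tensor_restrict (carrier (hom_module G ?N M))"
  proof (rule inj_onI)
    fix \<phi> \<psi> assume "\<phi> \<in> carrier (hom_module G ?N M)" "\<psi> \<in> carrier (hom_module G ?N M)"
      and eq: "tensor_restrict \<phi> = tensor_restrict \<psi>"
    then have \<phi>: "\<phi> \<in> hom ?N M" "\<phi> \<in> extensional (carrier ?N)" and \<psi>: "\<psi> \<in> hom ?N M" "\<psi> \<in> extensional (carrier ?N)"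
      by (simp_all add: carr)
    show "\<phi> = \<psi>"
    proof (rule extensionalityI[OF \<phi>(2) \<psi>(2)])
      fix c assume "c \<in> carrier ?N"
      then obtain x where x: "x \<in> carrier F" "c = R #>\<^bsub>F\<^esub> x" unfolding tensor_simps(1) by blast
      have h: "(\<lambda>x. \<phi> (R #>\<^bsub>F\<^esub> x)) \<in> hom F M" "(\<lambda>x. \<psi> (R #>\<^bsub>F\<^esub> x)) \<in> hom F M"
        using hom_compose[OF proj \<phi>(1)] hom_compose[OF proj \<psi>(1)] by (simp_all add: comp_def)
      have "\<phi> (R #>\<^bsub>F\<^esub> frag_of xs) = \<psi> (R #>\<^bsub>F\<^esub> frag_of xs)" if "xs \<in> T" for xs
        using fun_cong[OF eq, of xs] that by (simp add: tensor_restrict_def)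
      then have "\<phi> (R #>\<^bsub>F\<^esub> x) = \<psi> (R #>\<^bsub>F\<^esub> x)"
        by (rule hom_free_Abelian_group_eq[OF M.is_group h]) (use x(1) in simp_all)
      then show "\<phi> c = \<psi> c" by (simp add: x(2))
    qed
  qed
  show "tensor_restrict ` carrier (hom_module G ?N M) = carrier (multilinear_module G A M k)"
  proof
    show "tensor_restrict ` carrier (hom_module G ?N M) \<subseteq> carrier (multilinear_module G A M k)"
      using ghomD(2)[OF tensor_restrict_ghom[OF M]] by blast
    show "carrier (multilinear_module G A M k) \<subseteq> tensor_restrict ` carrier (hom_module G ?N M)"
    proof
      fix v assume "v \<in> carrier (multilinear_module G A M k)"
      then have v: "v \<in> multilinear_maps A M k" by (simp add: multilinear_module_def function_module_simps)
      note vD = multilinear_mapsD[OF v]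
      let ?h = "frag_eval M T v"
      have h: "?h \<in> hom F M" by (rule frag_eval(1)[OF M.comm_group_axioms vD(1)])
      have h_of: "?h (frag_of xs) = v xs" if "xs \<in> T" for xs
        using frag_eval(2)[OF M.comm_group_axioms, of T v] vD(1) that by blast
      interpret h: group_hom F M ?h
        using h by (simp add: group_hom_def group_hom_axioms_def M.is_group)
      have "relators \<subseteq> kernel F M ?h"
      proof
        fix r assume r: "r \<in> relators"
        then obtain xs i x y where r': "r = frag_of (xs[i := x \<otimes>\<^bsub>A\<^esub> y]) - frag_of (xs[i := x]) - frag_of (xs[i := y])"
          "xs \<in> T" "i < k" "x \<in> carrier A" "y \<in> carrier A"
          by (auto simp: relators_def)
        have t: "xs[i := x \<otimes>\<^bsub>A\<^esub> y] \<in> T" "xs[i := x] \<in> T" "xs[i := y] \<in> T"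
          using r' by (simp_all add: tuples_update)
        have rF: "r \<in> carrier F" using r relators_subset by blast
        have "?h (r + (frag_of (xs[i := x]) + frag_of (xs[i := y])))
            = ?h r \<otimes>\<^bsub>M\<^esub> (?h (frag_of (xs[i := x])) \<otimes>\<^bsub>M\<^esub> ?h (frag_of (xs[i := y])))"
        proof -
          have s: "frag_of (xs[i := x]) \<in> carrier F" "frag_of (xs[i := y]) \<in> carrier F" using t by simp_all
          show ?thesis
            using h.hom_mult[OF rF F.m_closed[OF s]] h.hom_mult[OF s] by simp
        qed
        then have "v (xs[i := x \<otimes>\<^bsub>A\<^esub> y]) = ?h r \<otimes>\<^bsub>M\<^esub> (v (xs[i := x]) \<otimes>\<^bsub>M\<^esub> v (xs[i := y]))"
          using t by (simp add: r'(1) h_of)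
        \<comment> \<open>By multilinearity of \<open>v\<close> the left side equals the bracket on
          the right, and cancelling it leaves the value at the relator.\<close>
        then have "?h r = \<one>\<^bsub>M\<^esub>"
          using vD(3)[OF r'(2-5)] vD(1)[OF t(2)] vD(1)[OF t(3)] h.hom_closed[OF rF] by simp
        then show "r \<in> kernel F M ?h" using rF by (simp add: kernel_def)
      qed
      then have "R \<subseteq> kernel F M ?h"
        unfolding R_eq by (rule F.generate_subgroup_incl[OF _ h.subgroup_kernel])
      then have hR: "?h r = \<one>\<^bsub>M\<^esub>" if "r \<in> R" for r using that by (auto simp: kernel_def)
      obtain \<phi> where \<phi>: "\<phi> \<in> hom (F Mod R) M" "\<And>x. x \<in> carrier F \<Longrightarrow> \<phi> (R #>\<^bsub>F\<^esub> x) = ?h x"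
      proof (rule FactGroup_universal[OF h.homh F.subgroup_imp_normal[OF subgroup_R]])
        fix x y assume xy: "x \<in> carrier F" "y \<in> carrier F" "R #>\<^bsub>F\<^esub> x = R #>\<^bsub>F\<^esub> y"
        have "x \<in> R #>\<^bsub>F\<^esub> y" unfolding xy(3)[symmetric] by (rule F.rcos_self[OF xy(1) subgroup_R])
        then obtain r where r: "r \<in> R" "x = r \<otimes>\<^bsub>F\<^esub> y" unfolding r_coset_def by blast
        then have "r \<in> carrier F" using R.subset by blast
        then have "?h x = ?h r \<otimes>\<^bsub>M\<^esub> ?h y" unfolding r(2) by (rule h.hom_mult[OF _ xy(2)])
        then show "?h x = ?h y" using hR[OF r(1)] h.hom_closed[OF xy(2)] by simp
      qed (rule that)
      let ?\<phi> = "restrict \<phi> (carrier ?N)"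
      have "?\<phi> \<in> hom ?N M"
      proof -
        have "\<phi> \<in> hom ?N M" using \<phi>(1) by (simp add: hom_def tensor_power_def with_act_def)
        then show ?thesis
          using comm_group.axioms(1)[OF gmoduleD(1)[OF gmodule_tensor_power]]
          by (auto simp: hom_def Pi_iff comm_monoid_def monoid.m_closed)
      qed
      then have "?\<phi> \<in> carrier (hom_module G ?N M)" by (simp add: carr)
      moreover have "v = tensor_restrict ?\<phi>"
      proof (rule extensionalityI[OF vD(2)])
        fix xs assume xs: "xs \<in> T"
        then have "frag_of xs \<in> carrier F" by simp
        then show "v xs = tensor_restrict ?\<phi> xs"
          using xs \<phi>(2) h_of[OF xs] by (simp add: tensor_restrict_def tensor_simps(1) del: carrier_free_Abelian_group_iff)
      qed (simp add: tensor_restrict_def)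
      ultimately show "v \<in> tensor_restrict ` carrier (hom_module G ?N M)" by blast
    qed
  qed
qed

end

section \<open>Iterated dimension shifting\<close>

text \<open>The start of the iteration: \<open>[]\<close> is the only tuple of length 0, so a
  multilinear map in no arguments is one element of \<open>M\<close>.\<close>

lemma multilinear_module_0:
  fixes A :: "('g, 'a) gmod" and M :: "('g, 'm) gmod"
  assumes M: "gmodule G M"
  shows "(\<lambda>m. \<lambda>xs\<in>tuples (carrier A) 0. m) \<in> ghom G M (multilinear_module G A M 0)"
    "bij_betw (\<lambda>m. \<lambda>xs\<in>tuples (carrier A) 0. m) (carrier M) (carrier (multilinear_module G A M 0))"
proof -
  show "(\<lambda>m. \<lambda>xs\<in>tuples (carrier A) 0. m) \<in> ghom G M (multilinear_module G A M 0)"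
    by (rule ghomI)
      (auto simp: multilinear_module_def function_module_simps multilinear_maps_def tuples_0 intro!: restrict_ext)
  show "bij_betw (\<lambda>m. \<lambda>xs\<in>tuples (carrier A) 0. m) (carrier M) (carrier (multilinear_module G A M 0))"
  proof (rule bij_betw_byWitness[where f' = "\<lambda>v. v []"], goal_cases)
    case 2
    show ?case
    proof
      fix v assume "v \<in> carrier (multilinear_module G A M 0)"
      then have "v \<in> extensional {[]}"
        by (simp add: multilinear_module_def function_module_simps multilinear_maps_def tuples_0 PiE_def)
      then show "(\<lambda>xs\<in>tuples (carrier A) 0. v []) = v"
        by (intro extensionalityI[of _ "{[]}"]) (simp_all add: tuples_0)
    qed
  qed (auto simp: multilinear_module_def function_module_simps multilinear_maps_def tuples_0
      split: if_splits)
qed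

context adamson_resolution
begin

text \<open>\<open>k\<close> is general in the induction because every step that lowers the degree
  raises it.\<close>

lemma multilinear_shift_iterated:
  assumes M: "gmodule G M"
  shows "adamson_cohomology G P d (multilinear_module G (augmentation_kernel G H) M k) (Suc n)
    \<cong> adamson_cohomology G P d (multilinear_module G (augmentation_kernel G H) M (k + n)) (Suc 0)"
proof (induction n arbitrary: k)
  case 0
  show ?case by (simp add: iso_refl)
next
  case (Suc n)
  show ?case using iso_trans[OF multilinear_shift[OF M, of k n] Suc[of "Suc k"]] by simp
qed

text \<open>Replace \<open>M\<close> by multilinear maps in no arguments, shift \<open>n\<close>
  times down to degree 1, exchange multilinear maps in \<open>n\<close> arguments for homomorphisms
  on the tensor power, and apply the degree 1 case to that module.\<close>

lemma adamson_cohomology_iso_restriction_kernel: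
  assumes M: "gmodule G M"
  shows "adamson_cohomology G P d M (Suc n)
    \<cong> restriction_kernel G H (hom_module G (tensor_power (augmentation_kernel G H) n) M) (Suc 0)"
proof -
  let ?A = "\<lambda>k. multilinear_module G (augmentation_kernel G H) M k"
  let ?B = "hom_module G (tensor_power (augmentation_kernel G H) n) M"
  interpret t: tensor_module G "augmentation_kernel G H" n
    by (rule tensor_module.intro[OF G pair.gmodule_I])
  have A: "gmodule G (?A k)" for k by (rule gmodule_multilinear_module[OF G pair.gmodule_I M])
  have B: "gmodule G ?B" by (rule gmodule_hom_module[OF G t.gmodule_tensor_power M])
  note e1 = adamson_cohomology_iso[OF M A multilinear_module_0[OF M], of n]
  note e2 = multilinear_shift_iterated[OF M, of 0 n, simplified]
  note e3 = adamson_cohomology_iso[OF B A t.tensor_restrict_ghom[OF M] t.tensor_restrict_bij[OF M], of 0]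
  \<comment> \<open>\<open>e3\<close> points from homomorphisms to multilinear maps; to reverse it,
    its source has to be known as a group.\<close>
  have "group (adamson_cohomology G P d ?B (Suc 0))"
  proof -
    interpret B: comm_group ?B by (rule gmoduleD(1)[OF B])
    interpret K: comm_group "product_group (carrier (P (Suc 0))) (\<lambda>_. ?B)"
      by (rule comm_group_product_group[OF B.comm_group_axioms])
    interpret Z: comm_group "(product_group (carrier (P (Suc 0))) (\<lambda>_. ?B))\<lparr>carrier := adamson_cocycles G P d ?B 0\<rparr>"
      by (rule comm_group_subgroup[OF K.comm_group_axioms subgroup_cocycles[OF B]])
    show ?thesis
      unfolding adamson_cohomology_Suc[OF B]
      by (intro normal.factorgroup_is_group Z.subgroup_imp_normal K.subgroup_incl
          subgroup_coboundaries[OF B] subgroup_cocycles[OF B] coboundaries_subset_cocycles[OF B])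
  qed
  note e3' = group.iso_sym[OF this e3]
  note e4 = adamson_cohomology_1_iso[OF B]
  show ?thesis by (rule iso_trans[OF iso_trans[OF iso_trans[OF e1 e2] e3'] e4])
qed

end

theorem proposition2p6:
  fixes G :: "('g, 'b) monoid_scheme" and H :: "'g set" and M :: "('g, 'm) gmod"
    and P :: "nat \<Rightarrow> ('g, 'p) gmod" and d :: "nat \<Rightarrow> 'p \<Rightarrow> 'p" and \<epsilon> :: "'p \<Rightarrow> int"
  assumes "group G" and "subgroup H G" and "gmodule G M"
    and "rel_projective_resolution G H P d \<epsilon> trivial_int_module"
  shows "(\<forall>n\<ge>1. adamson_cohomology G P d M n
            \<cong> restriction_kernel G H
                (hom_module G (tensor_power (augmentation_kernel G H) (n - 1)) M) 1)
         \<and> adamson_cohomology G P d M 1 \<cong> restriction_kernel G H M 1"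
proof -
  interpret adamson_resolution G H P d \<epsilon>
    by (rule adamson_resolution.intro[OF assms(1,2,4)])
  have "adamson_cohomology G P d M n
      \<cong> restriction_kernel G H (hom_module G (tensor_power (augmentation_kernel G H) (n - 1)) M) 1"
    if "n \<ge> 1" for n
    using adamson_cohomology_iso_restriction_kernel[OF assms(3), of "n - 1"] that by simp
  \<comment> \<open>The second claim is the degree 1 case for \<open>M\<close> itself. Taking
    \<open>n = 1\<close> in the first would give \<open>Hom(I^0, M)\<close>, which is isomorphic to
    \<open>M\<close> but lives on another type.\<close>
  then show ?thesis using adamson_cohomology_1_iso[OF assms(3)] by simp
qed

end
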